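(* Let $n\in\{2,3\}$ and let $N^{2n}$ be a $2n$-manifold endowed with an $\mathrm{SU}(n)$-structure $(\omega,\Psi)$ solving the twisted Calabi-Yau equation $$d\Psi=\theta_\omega\wedge\Psi,\qquad dd^c\omega=0,\qquad d\theta_\omega=0.$$ Then the $7$-manifold $M=N^{2n}\times\mathbb{R}^{7-2n}$ admits a strong $\mathrm{G}_2T$-structure $\varphi$ solving the twisted $\mathrm{G}_2$ equation $$d\varphi\wedge\varphi=0,\qquad d\star\varphi=\theta\wedge\star\varphi,\qquad dT=0,\qquad d\theta=0,$$ and whose Lee form $\theta$ and torsion $3$-form $T$ coincide with (the pullbacks to $M$ of) $\theta_\omega$ and $d^c\omega$, respectively.
   Context: $\mathrm{SU}(n)$-structures: an $\mathrm{SU}(n)$-structure on a $2n$-manifold is an almost Hermitian structure $(g,J)$ with fundamental $2$-form $\omega=g(J\cdot,\cdot)$, together with a complex $(n,0)$-form $\Psi=\psi_++i\psi_-$ of unit norm (normalized so that $\omega^2=\psi_+^2=\psi_-^2$ if $n=2$, and $3\,\psi_+\wedge\psi_-=2\,\omega^3$ if $n=3$). The orientation is $\frac1{n!}\omega^n$. For a $k$-form $\alpha$, $J\alpha=\alpha(J\cdot,\dots,J\cdot)$. The Lee form is $\theta_\omega=-J\delta_g\omega$, equivalently the unique $1$-form with $d\omega^{n-1}=\theta_\omega\wedge\omega^{n-1}$. $d^c\omega=Jd\omega$. $\mathrm{G}_2$-structures: write $e^{ij\cdots}=e^i\wedge e^j\wedge\cdots$. A $\mathrm{G}_2$-structure on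 a $7$-manifold $M$ is a definite $3$-form $\varphi$: at each point there is a coframe $(e^1,\dots,e^7)$ with $\varphi=e^{123}+e^1\wedge(e^{45}+e^{67})+e^2\wedge(e^{46}-e^{57})-e^3\wedge(e^{47}+e^{56})$. It induces the metric $g_\varphi$ for which this coframe is orthonormal, the orientation $e^{1234567}$, and a Hodge operator $\star$. It is a $\mathrm{G}_2T$-structure if $d\star\varphi=\theta\wedge\star\varphi$ for some $1$-form $\theta$ (the Lee form; necessarily $\theta=-\frac13\star(\star d\varphi\wedge\varphi)$). Its torsion $3$-form is $T=\frac16\star(d\varphi\wedge\varphi)\,\varphi-\star d\varphi+\star(\theta\wedge\varphi)$. It is strong if $dT=0$. *)

theory Defs
  imports "HOL-Analysis.Analysis"
begin

section \<open>Smooth manifolds\<close>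

text \<open>Only meaningful for open \<open>S\<close>.\<close>

fun Ck_on :: "nat \<Rightarrow> 'e::euclidean_space set \<Rightarrow> ('e \<Rightarrow> 'b::real_normed_vector) \<Rightarrow> bool" where
  "Ck_on 0 S f \<longleftrightarrow> continuous_on S f"
| "Ck_on (Suc k) S f \<longleftrightarrow> (\<forall>x\<in>S. f differentiable (at x)) \<and>
     (\<forall>v. Ck_on k S (\<lambda>x. frechet_derivative f (at x) v))"

definition smooth_on :: "'e::euclidean_space set \<Rightarrow> ('e \<Rightarrow> 'b::real_normed_vector) \<Rightarrow> bool" where
  "smooth_on S f \<longleftrightarrow> (\<forall>k. Ck_on k S f)"

text \<open>A chart is a pair \<open>(U, x)\<close> of a domain and a coordinate map; the values of \<open>x\<close> outside \<open>U\<close>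
  are irrelevant.\<close>

type_synonym ('a, 'e) chart = "'a set \<times> ('a \<Rightarrow> 'e)"

abbreviation chart_range :: "('a, 'e) chart \<Rightarrow> 'e set" where
  "chart_range c \<equiv> snd c ` fst c"

definition is_chart :: "'a topology \<Rightarrow> ('a, 'e::euclidean_space) chart \<Rightarrow> bool" where
  "is_chart X c \<longleftrightarrow> openin X (fst c) \<and> open (chart_range c) \<and>
     homeomorphic_map (subtopology X (fst c)) (top_of_set (chart_range c)) (snd c)"

definition coord_rep :: "('a, 'e) chart \<Rightarrow> ('b, 'f) chart \<Rightarrow> ('a \<Rightarrow> 'b) \<Rightarrow> 'e \<Rightarrow> 'f" where
  "coord_rep c c' F = snd c' \<circ> F \<circ> inv_into (fst c) (snd c)"

text \<open>The dimension is that of the model space \<open>'e\<close>. The atlas need not be maximal.\<close>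

definition smooth_manifold :: "'a topology \<Rightarrow> ('a, 'e::euclidean_space) chart set \<Rightarrow> bool" where
  "smooth_manifold X A \<longleftrightarrow>
     Hausdorff_space X \<and> second_countable X \<and>
     (\<forall>c\<in>A. is_chart X c) \<and> (\<Union>c\<in>A. fst c) = topspace X \<and>
     (\<forall>c\<in>A. \<forall>c'\<in>A. smooth_on (snd c ` (fst c \<inter> fst c')) (coord_rep c c' id))"

definition prod_atlas ::
  "('a, 'e) chart set \<Rightarrow> ('b, 'f) chart set \<Rightarrow> ('a \<times> 'b, 'e \<times> 'f) chart set" where
  "prod_atlas A B = {(fst c \<times> fst d, map_prod (snd c) (snd d)) | c d. c \<in> A \<and> d \<in> B}"

definition standard_atlas :: "('e, 'e) chart set" where
  "standard_atlas = {(UNIV, id)}"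


section \<open>Exterior and Hodge algebra of a vector space\<close>

text \<open>A form of degree \<open>k\<close> takes a list of \<open>k\<close> vectors and is \<open>0\<close> on lists of any other length,
  so that equal forms are equal as functions. Coefficients are real or complex.\<close>

definition kform :: "nat \<Rightarrow> ('v::real_vector list \<Rightarrow> 'b::real_vector) \<Rightarrow> bool" where
  "kform k \<alpha> \<longleftrightarrow> (\<forall>vs. length vs \<noteq> k \<longrightarrow> \<alpha> vs = 0) \<and>
     (\<forall>vs i. length vs = k \<and> i < k \<longrightarrow> linear (\<lambda>v. \<alpha> (vs[i := v]))) \<and>
     (\<forall>vs. length vs = k \<and> \<not> distinct vs \<longrightarrow> \<alpha> vs = 0)"

text \<open>The sign of the shuffle that moves the positions in \<open>S\<close> to the front.\<close>

definition shuffle_sign :: "nat \<Rightarrow> nat set \<Rightarrow> 'b::comm_ring_1" where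
  "shuffle_sign m S = (- 1) ^ card {(i, j). i \<in> S \<and> j \<in> {..<m} - S \<and> j < i}"

text \<open>The sum over all shuffles; this is the normalization with
  \<open>(e\<^sup>1 \<and> e\<^sup>2)(e\<^sub>1, e\<^sub>2) = 1\<close> for dual bases. Sets \<open>S\<close> of the wrong size contribute \<open>0\<close>.\<close>

definition wedge :: "('v list \<Rightarrow> 'b::comm_ring_1) \<Rightarrow> ('v list \<Rightarrow> 'b) \<Rightarrow> 'v list \<Rightarrow> 'b"
    (infixr \<open>\<^bold>\<and>\<close> 75) where
  "(\<alpha> \<^bold>\<and> \<beta>) vs = (\<Sum>S\<in>Pow {..<length vs}.
     shuffle_sign (length vs) S * \<alpha> (nths vs S) * \<beta> (nths vs ({..<length vs} - S)))"

definition wedge_one :: "'v list \<Rightarrow> 'b::comm_ring_1" where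
  "wedge_one vs = (if vs = [] then 1 else 0)"

fun wedge_pow :: "('v list \<Rightarrow> 'b::comm_ring_1) \<Rightarrow> nat \<Rightarrow> 'v list \<Rightarrow> 'b" where
  "wedge_pow \<alpha> 0 = wedge_one"
| "wedge_pow \<alpha> (Suc k) = \<alpha> \<^bold>\<and> wedge_pow \<alpha> k"

definition covector :: "('v \<Rightarrow> real) \<Rightarrow> 'v list \<Rightarrow> real" where
  "covector l vs = (case vs of [v] \<Rightarrow> l v | _ \<Rightarrow> 0)"

text \<open>\<open>ewedge e [i, j, \<dots>]\<close> is \<open>e\<^sup>i \<and> e\<^sup>j \<and> \<dots>\<close>.\<close>

definition ewedge :: "(nat \<Rightarrow> 'v \<Rightarrow> real) \<Rightarrow> nat list \<Rightarrow> 'v list \<Rightarrow> real" where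
  "ewedge e is = foldr (\<lambda>i \<alpha>. covector (e i) \<^bold>\<and> \<alpha>) is wedge_one"

definition inner_product_on_type :: "('v::real_vector \<Rightarrow> 'v \<Rightarrow> real) \<Rightarrow> bool" where
  "inner_product_on_type g \<longleftrightarrow> (\<forall>v. linear (g v)) \<and> (\<forall>v w. g v w = g w v) \<and>
     (\<forall>v. v \<noteq> 0 \<longrightarrow> g v v > 0)"

definition orthonormal_basis :: "('v::euclidean_space \<Rightarrow> 'v \<Rightarrow> real) \<Rightarrow> 'v list \<Rightarrow> bool" where
  "orthonormal_basis g es \<longleftrightarrow> length es = DIM('v) \<and>
     (\<forall>i<length es. \<forall>j<length es. g (es ! i) (es ! j) = (if i = j then 1 else 0))"

text \<open>The Hodge operator of an inner product \<open>g\<close> and the volume form \<open>\<mu>\<close> that \<open>g\<close> and the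
  orientation determine, with the convention \<open>\<beta> \<and> \<star>\<alpha> = g(\<beta>, \<alpha>) \<mu>\<close>. It is obtained by contracting
  \<open>\<alpha>\<close> with the first arguments of \<open>\<mu>\<close>:
  \<open>(\<star>\<alpha>)(v\<^sub>1, \<dots>) = \<Sum> \<alpha>(e\<^sub>i\<^sub>1, \<dots>, e\<^sub>i\<^sub>k) \<mu>(e\<^sub>i\<^sub>1, \<dots>, e\<^sub>i\<^sub>k, v\<^sub>1, \<dots>)\<close> over \<open>i\<^sub>1 < \<dots> < i\<^sub>k\<close>, where \<open>e\<close> is any
  \<open>g\<close>-orthonormal basis; the sum does not depend on its choice.\<close>

definition hodge :: "('v::euclidean_space \<Rightarrow> 'v \<Rightarrow> real) \<Rightarrow> ('v list \<Rightarrow> real) \<Rightarrow>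
    ('v list \<Rightarrow> real) \<Rightarrow> 'v list \<Rightarrow> real" where
  "hodge g \<mu> \<alpha> vs = (let es = (SOME es. orthonormal_basis g es) in
     \<Sum>S\<in>Pow {..<length es}. \<alpha> (nths es S) * \<mu> (nths es S @ vs))"


section \<open>Tensor fields and differential forms on a manifold\<close>

text \<open>A field is given by its coordinate representatives: \<open>\<alpha> c x\<close> is the value at the point with
  coordinates \<open>x \<in> chart_range c\<close>, expressed in the chart \<open>c\<close>. Representatives in overlapping
  charts are required to transform correctly; their values off \<open>chart_range c\<close> are irrelevant.\<close>

type_synonym ('a, 'e, 'b) form_field = "('a, 'e) chart \<Rightarrow> 'e \<Rightarrow> 'e list \<Rightarrow> 'b"
type_synonym ('a, 'e) metric_field = "('a, 'e) chart \<Rightarrow> 'e \<Rightarrow> 'e \<Rightarrow> 'e \<Rightarrow> real"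
type_synonym ('a, 'e) endo_field = "('a, 'e) chart \<Rightarrow> 'e \<Rightarrow> 'e \<Rightarrow> 'e"

definition field_eq :: "('a, 'e) chart set \<Rightarrow> ('a, 'e, 'b) form_field \<Rightarrow> ('a, 'e, 'b) form_field \<Rightarrow> bool"
  where "field_eq A \<alpha> \<beta> \<longleftrightarrow> (\<forall>c\<in>A. \<forall>x\<in>chart_range c. \<alpha> c x = \<beta> c x)"

text \<open>\<open>is_pullback B A F \<alpha> \<beta>\<close> says that \<open>\<beta> = F\<^sup>*\<alpha>\<close>, for a smooth map \<open>F\<close> from the manifold with
  atlas \<open>B\<close> to the manifold with atlas \<open>A\<close>.\<close>

definition is_pullback ::
  "('b, 'f::euclidean_space) chart set \<Rightarrow> ('a, 'e::euclidean_space) chart set \<Rightarrow> ('b \<Rightarrow> 'a) \<Rightarrow>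
   ('a, 'e, 'r) form_field \<Rightarrow> ('b, 'f, 'r) form_field \<Rightarrow> bool" where
  "is_pullback B A F \<alpha> \<beta> \<longleftrightarrow> (\<forall>d\<in>B. \<forall>c\<in>A. \<forall>p\<in>fst d. F p \<in> fst c \<longrightarrow>
     (\<forall>vs. \<beta> d (snd d p) vs =
        \<alpha> c (snd c (F p)) (map (frechet_derivative (coord_rep d c F) (at (snd d p))) vs)))"

text \<open>The transformation law for forms says that \<open>\<alpha>\<close> is its own pullback under the identity.\<close>

definition differential_form ::
  "('a, 'e::euclidean_space) chart set \<Rightarrow> nat \<Rightarrow> ('a, 'e, 'b::real_normed_vector) form_field \<Rightarrow> bool"
  where
  "differential_form A k \<alpha> \<longleftrightarrow>
     (\<forall>c\<in>A. (\<forall>x\<in>chart_range c. kform k (\<alpha> c x)) \<and> (\<forall>vs. smooth_on (chart_range c) (\<lambda>x. \<alpha> c x vs))) \<and>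
     is_pullback A A id \<alpha> \<alpha>"

definition riemannian_metric ::
  "('a, 'e::euclidean_space) chart set \<Rightarrow> ('a, 'e) metric_field \<Rightarrow> bool" where
  "riemannian_metric A g \<longleftrightarrow>
     (\<forall>c\<in>A. (\<forall>x\<in>chart_range c. inner_product_on_type (g c x)) \<and>
            (\<forall>v w. smooth_on (chart_range c) (\<lambda>x. g c x v w))) \<and>
     (\<forall>c\<in>A. \<forall>c'\<in>A. \<forall>p\<in>fst c \<inter> fst c'. \<forall>v w.
        let D = frechet_derivative (coord_rep c c' id) (at (snd c p))
        in g c (snd c p) v w = g c' (snd c' p) (D v) (D w))"

definition almost_complex_structure ::
  "('a, 'e::euclidean_space) chart set \<Rightarrow> ('a, 'e) endo_field \<Rightarrow> bool" where
  "almost_complex_structure A J \<longleftrightarrow>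
     (\<forall>c\<in>A. (\<forall>x\<in>chart_range c. linear (J c x) \<and> (\<forall>v. J c x (J c x v) = - v)) \<and>
            (\<forall>v. smooth_on (chart_range c) (\<lambda>x. J c x v))) \<and>
     (\<forall>c\<in>A. \<forall>c'\<in>A. \<forall>p\<in>fst c \<inter> fst c'. \<forall>v.
        let D = frechet_derivative (coord_rep c c' id) (at (snd c p))
        in D (J c (snd c p) v) = J c' (snd c' p) (D v))"

definition fwedge :: "('a, 'e, 'b::comm_ring_1) form_field \<Rightarrow> ('a, 'e, 'b) form_field \<Rightarrow>
    ('a, 'e, 'b) form_field" (infixr \<open>\<and>\<^sub>M\<close> 75) where
  "(\<alpha> \<and>\<^sub>M \<beta>) c x = \<alpha> c x \<^bold>\<and> \<beta> c x"

text \<open>\<open>(d\<alpha>)(v\<^sub>0, \<dots>, v\<^sub>k) = \<Sum>\<^sub>i (-1)\<^sup>i v\<^sub>i(\<alpha>(v\<^sub>0, \<dots>, v\<^sub>i omitted, \<dots>, v\<^sub>k))\<close> for vectors \<open>v\<^sub>j\<close> regarded as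
  constant vector fields in the chart.\<close>

definition ext_d :: "('a, 'e::euclidean_space, 'b::real_normed_field) form_field \<Rightarrow>
    ('a, 'e, 'b) form_field" where
  "ext_d \<alpha> c x vs = (\<Sum>i<length vs.
     (- 1) ^ i * frechet_derivative (\<lambda>y. \<alpha> c y (nths vs (- {i}))) (at x) (vs ! i))"

definition zero_field :: "('a, 'e, 'b::zero) form_field" where
  "zero_field c x vs = 0"

text \<open>\<open>J\<alpha> = \<alpha>(J\<cdot>, \<dots>, J\<cdot>)\<close>.\<close>

definition J_act :: "('a, 'e) endo_field \<Rightarrow> ('a, 'e, 'b) form_field \<Rightarrow> ('a, 'e, 'b) form_field" where
  "J_act J \<alpha> c x vs = \<alpha> c x (map (J c x) vs)"

definition fhodge :: "('a, 'e::euclidean_space) metric_field \<Rightarrow> ('a, 'e, real) form_field \<Rightarrow>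
    ('a, 'e, real) form_field \<Rightarrow> ('a, 'e, real) form_field" where
  "fhodge g \<mu> \<alpha> c x = hodge (g c x) (\<mu> c x) (\<alpha> c x)"

text \<open>In even dimension the formal adjoint of \<open>d\<close> is \<open>-\<star>d\<star>\<close> in every degree.\<close>

definition codiff_even :: "('a, 'e::euclidean_space) metric_field \<Rightarrow> ('a, 'e, real) form_field \<Rightarrow>
    ('a, 'e, real) form_field \<Rightarrow> ('a, 'e, real) form_field" where
  "codiff_even g \<mu> \<alpha> c x vs = - fhodge g \<mu> (ext_d (fhodge g \<mu> \<alpha>)) c x vs"


section \<open>\<open>SU(n)\<close>-structures\<close>

definition fundamental_form :: "('a, 'e) metric_field \<Rightarrow> ('a, 'e) endo_field \<Rightarrow>
    ('a, 'e, real) form_field" where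
  "fundamental_form g J c x vs = (case vs of [v, w] \<Rightarrow> g c x (J c x v) w | _ \<Rightarrow> 0)"

definition hermitian_vol :: "nat \<Rightarrow> ('a, 'e) metric_field \<Rightarrow> ('a, 'e) endo_field \<Rightarrow>
    ('a, 'e, real) form_field" where
  "hermitian_vol n g J c x vs = wedge_pow (fundamental_form g J c x) n vs / fact n"

text \<open>\<open>\<theta>\<^sub>\<omega> = -J\<delta>\<^sub>g\<omega>\<close>.\<close>

definition lee_form :: "nat \<Rightarrow> ('a, 'e::euclidean_space) metric_field \<Rightarrow> ('a, 'e) endo_field \<Rightarrow>
    ('a, 'e, real) form_field" where
  "lee_form n g J c x vs =
     - J_act J (codiff_even g (hermitian_vol n g J) (fundamental_form g J)) c x vs"

definition d_c_omega :: "('a, 'e::euclidean_space) metric_field \<Rightarrow> ('a, 'e) endo_field \<Rightarrow>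
    ('a, 'e, real) form_field" where
  "d_c_omega g J = J_act J (ext_d (fundamental_form g J))"

definition almost_hermitian :: "('a, 'e::euclidean_space) chart set \<Rightarrow> ('a, 'e) metric_field \<Rightarrow>
    ('a, 'e) endo_field \<Rightarrow> bool" where
  "almost_hermitian A g J \<longleftrightarrow> riemannian_metric A g \<and> almost_complex_structure A J \<and>
     (\<forall>c\<in>A. \<forall>x\<in>chart_range c. \<forall>v w. g c x (J c x v) (J c x w) = g c x v w)"

definition Re_part :: "('a, 'e, complex) form_field \<Rightarrow> ('a, 'e, real) form_field" where
  "Re_part \<Psi> c x vs = Re (\<Psi> c x vs)"

definition Im_part :: "('a, 'e, complex) form_field \<Rightarrow> ('a, 'e, real) form_field" where
  "Im_part \<Psi> c x vs = Im (\<Psi> c x vs)"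

definition complexify :: "('a, 'e, real) form_field \<Rightarrow> ('a, 'e, complex) form_field" where
  "complexify \<alpha> c x vs = complex_of_real (\<alpha> c x vs)"

text \<open>A complex \<open>n\<close>-form is of type \<open>(n, 0)\<close> if it is complex linear, with respect to \<open>J\<close>, in every
  argument.\<close>

definition type_n0 :: "('a, 'e) chart set \<Rightarrow> nat \<Rightarrow> ('a, 'e) endo_field \<Rightarrow>
    ('a, 'e, complex) form_field \<Rightarrow> bool" where
  "type_n0 A n J \<Psi> \<longleftrightarrow> (\<forall>c\<in>A. \<forall>x\<in>chart_range c. \<forall>vs. length vs = n \<longrightarrow>
     (\<forall>i<n. \<Psi> c x (vs[i := J c x (vs ! i)]) = \<i> * \<Psi> c x vs))"

text \<open>For a form of type \<open>(n, 0)\<close> the last two clauses express that \<open>\<Psi>\<close> has unit norm: they fix the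
  normalization of the norm on \<open>(n, 0)\<close>-forms. Only \<open>n = 2\<close> and \<open>n = 3\<close> are considered.\<close>

definition SU_structure :: "('a, 'e::euclidean_space) chart set \<Rightarrow> nat \<Rightarrow> ('a, 'e) metric_field \<Rightarrow>
    ('a, 'e) endo_field \<Rightarrow> ('a, 'e, complex) form_field \<Rightarrow> bool" where
  "SU_structure A n g J \<Psi> \<longleftrightarrow>
     n \<in> {2, 3} \<and> DIM('e) = 2 * n \<and>
     almost_hermitian A g J \<and> differential_form A n \<Psi> \<and> type_n0 A n J \<Psi> \<and>
     (let \<omega> = fundamental_form g J; \<psi>p = Re_part \<Psi>; \<psi>m = Im_part \<Psi> in
       (n = 2 \<longrightarrow> field_eq A (\<omega> \<and>\<^sub>M \<omega>) (\<psi>p \<and>\<^sub>M \<psi>p) \<and> field_eq A (\<psi>p \<and>\<^sub>M \<psi>p) (\<psi>m \<and>\<^sub>M \<psi>m)) \<and>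
       (n = 3 \<longrightarrow> field_eq A (\<lambda>c x vs. 3 * (\<psi>p \<and>\<^sub>M \<psi>m) c x vs)
                              (\<lambda>c x vs. 2 * (\<omega> \<and>\<^sub>M \<omega> \<and>\<^sub>M \<omega>) c x vs)))"


section \<open>\<open>G\<^sub>2\<close>-structures\<close>

text \<open>Seven covectors \<open>e\<^sup>1, \<dots>, e\<^sup>7\<close> on a space of dimension \<open>7\<close> form a basis of the dual space iff
  they have no common zero other than \<open>0\<close>.\<close>

definition coframe7 :: "(nat \<Rightarrow> 'v::euclidean_space \<Rightarrow> real) \<Rightarrow> bool" where
  "coframe7 e \<longleftrightarrow> DIM('v) = 7 \<and> (\<forall>i\<in>{1..7}. linear (e i)) \<and>
     (\<forall>v. (\<forall>i\<in>{1..7}. e i v = 0) \<longrightarrow> v = 0)"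

definition g2_model :: "(nat \<Rightarrow> 'v \<Rightarrow> real) \<Rightarrow> 'v list \<Rightarrow> real" where
  "g2_model e vs = ewedge e [1, 2, 3] vs
     + (covector (e 1) \<^bold>\<and> (\<lambda>ws. ewedge e [4, 5] ws + ewedge e [6, 7] ws)) vs
     + (covector (e 2) \<^bold>\<and> (\<lambda>ws. ewedge e [4, 6] ws - ewedge e [5, 7] ws)) vs
     - (covector (e 3) \<^bold>\<and> (\<lambda>ws. ewedge e [4, 7] ws + ewedge e [5, 6] ws)) vs"

definition g2_adapted :: "('v::euclidean_space list \<Rightarrow> real) \<Rightarrow> (nat \<Rightarrow> 'v \<Rightarrow> real) \<Rightarrow> bool" where
  "g2_adapted \<phi> e \<longleftrightarrow> coframe7 e \<and> \<phi> = g2_model e"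

definition g2_structure :: "('a, 'e::euclidean_space) chart set \<Rightarrow> ('a, 'e, real) form_field \<Rightarrow> bool"
  where
  "g2_structure A \<phi> \<longleftrightarrow> differential_form A 3 \<phi> \<and>
     (\<forall>c\<in>A. \<forall>x\<in>chart_range c. \<exists>e. g2_adapted (\<phi> c x) e)"

text \<open>Two coframes adapted to the same \<open>\<phi>\<close> differ by an element of \<open>G\<^sub>2 \<subseteq> SO(7)\<close>, so the metric and
  the volume form do not depend on the choice made below.\<close>

definition g2_metric :: "('a, 'e::euclidean_space, real) form_field \<Rightarrow> ('a, 'e) metric_field" where
  "g2_metric \<phi> c x v w = (let e = (SOME e. g2_adapted (\<phi> c x) e) in \<Sum>i=1..7. e i v * e i w)"

definition g2_vol :: "('a, 'e::euclidean_space, real) form_field \<Rightarrow> ('a, 'e, real) form_field" where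
  "g2_vol \<phi> c x = (let e = (SOME e. g2_adapted (\<phi> c x) e) in ewedge e [1, 2, 3, 4, 5, 6, 7])"

definition g2_star :: "('a, 'e::euclidean_space, real) form_field \<Rightarrow> ('a, 'e, real) form_field \<Rightarrow>
    ('a, 'e, real) form_field" where
  "g2_star \<phi> = fhodge (g2_metric \<phi>) (g2_vol \<phi>)"

definition g2T_structure :: "('a, 'e::euclidean_space) chart set \<Rightarrow> ('a, 'e, real) form_field \<Rightarrow>
    ('a, 'e, real) form_field \<Rightarrow> bool" where
  "g2T_structure A \<phi> \<theta> \<longleftrightarrow> g2_structure A \<phi> \<and> differential_form A 1 \<theta> \<and>
     field_eq A (ext_d (g2_star \<phi> \<phi>)) (\<theta> \<and>\<^sub>M g2_star \<phi> \<phi>)"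

text \<open>\<open>T = 1/6 \<star>(d\<phi> \<and> \<phi>) \<phi> - \<star>d\<phi> + \<star>(\<theta> \<and> \<phi>)\<close>; the \<open>0\<close>-form \<open>\<star>(d\<phi> \<and> \<phi>)\<close> is evaluated on the empty
  list to give a function.\<close>

definition g2_torsion :: "('a, 'e::euclidean_space, real) form_field \<Rightarrow> ('a, 'e, real) form_field \<Rightarrow>
    ('a, 'e, real) form_field" where
  "g2_torsion \<phi> \<theta> c x vs =
     1 / 6 * g2_star \<phi> (ext_d \<phi> \<and>\<^sub>M \<phi>) c x [] * \<phi> c x vs
     - g2_star \<phi> (ext_d \<phi>) c x vs + g2_star \<phi> (\<theta> \<and>\<^sub>M \<phi>) c x vs"

definition strong_g2T_structure :: "('a, 'e::euclidean_space) chart set \<Rightarrow>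
    ('a, 'e, real) form_field \<Rightarrow> ('a, 'e, real) form_field \<Rightarrow> bool" where
  "strong_g2T_structure A \<phi> \<theta> \<longleftrightarrow> g2T_structure A \<phi> \<theta> \<and>
     field_eq A (ext_d (g2_torsion \<phi> \<theta>)) zero_field"

end

theory Submission imports Defs
begin

text \<open>On the product take \<open>\<phi> = dt \<and> \<omega> + \<psi>\<^sub>+\<close>, where for \<open>n = 2\<close> the data of \<open>N\<^sup>4\<close> are first replaced by
  \<open>\<omega> + dt\<^sup>2 \<and> dt\<^sup>3\<close> and \<open>(dt\<^sup>2 + i dt\<^sup>3) \<and> \<Psi>\<close>, so that both cases look like an \<open>SU(3)\<close>-structure
  times a line. Then \<open>\<star>\<phi> = \<omega>\<^sup>2/2 - dt \<and> \<psi>\<^sub>-\<close>, and \<open>d\<omega>\<^sup>2 = \<theta> \<and> \<omega>\<^sup>2\<close> and \<open>d\<psi>\<^sub>\<plusminus> = \<theta> \<and> \<psi>\<^sub>\<plusminus>\<close> give \<open>d\<star>\<phi> = \<theta> \<and> \<star>\<phi>\<close>.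
  Differentiating \<open>\<omega> \<and> \<psi>\<^sub>+ = 0\<close> gives \<open>d\<omega> \<and> \<psi>\<^sub>+ = 0\<close>, hence \<open>d\<phi> \<and> \<phi> = 0\<close>, and the torsion is
  \<open>T = \<star>(dt \<and> (d\<omega> - \<theta> \<and> \<omega>))\<close>, which is \<open>d\<omega>(J\<cdot>, J\<cdot>, J\<cdot>)\<close> by linear algebra in a unitary frame.

  Forms are functions of argument lists. The wedge product satisfies the recursion
  \<open>\<iota>\<^sub>v(\<alpha> \<and> \<beta>) = \<iota>\<^sub>v\<alpha> \<and> \<beta> + (-1)\<^sup>|\<^sup>\<alpha>\<^sup>| \<alpha> \<and> \<iota>\<^sub>v\<beta>\<close>, and \<open>d\<close> satisfies \<open>\<iota>\<^sub>v d = \<partial>\<^sub>v - d \<iota>\<^sub>v\<close> for constant \<open>v\<close>;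
  associativity and the Leibniz rule follow from these by induction on the argument list, for functions
  that need not be alternating. The Lee form is only defined through a choice of orthonormal bases; its
  smoothness and its transformation law come from \<open>\<theta>(v) \<omega>\<^sup>n = n(n - 1) \<omega>\<^sup>n\<^sup>-\<^sup>2 \<and> d\<omega> \<and> \<iota>\<^sub>v\<omega>\<close>.\<close>

section \<open>The wedge product on functions of lists\<close>

text \<open>The obstacle is that frames exist only point by point: an adapted or unitary frame is
  chosen separately at each point, with no control over how it varies. Hence nothing is ever
  differentiated in a frame. A frame only serves to prove an algebraic identity at every point of a
  chart range; as an equality of coefficient functions on an open set it may then be differentiated.
  The definitions hide choices as well: the metric and orientation of a
  \<open>G\<^sub>2\<close>-form come from some adapted coframe, the Hodge operator from some
  orthonormal basis. Both choices are shown to be immaterial at each point, the first by a cubic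
  expression in the 3-form, the second by passing from increasing tuples to all tuples. That the
  torsion is \<open>d\<^sup>c\<omega>\<close> rests on a fact about 3-forms in complex dimension 3:
  the star and J agree on primitive forms and differ by a sign on multiples of \<omega>. The Lee
  term in the torsion corrects exactly this sign. Closedness of torsion and Lee form is then
  inherited from the base, since both are pullbacks.\<close>

definition ins :: "'v \<Rightarrow> ('v list \<Rightarrow> 'b) \<Rightarrow> 'v list \<Rightarrow> 'b" where
  "ins v \<alpha> vs = \<alpha> (v # vs)"

text \<open>The parity automorphism of the exterior algebra. Reading the sign off the length of the
  argument list, not off a degree, lets the antiderivation rules hold for functions of mixed
  degree.\<close>

definition grade_inv :: "('v list \<Rightarrow> 'b::comm_ring_1) \<Rightarrow> 'v list \<Rightarrow> 'b" where
  "grade_inv \<alpha> vs = (- 1) ^ length vs * \<alpha> vs"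

lemma wedge_Nil [simp]: "(\<alpha> \<^bold>\<and> \<beta>) [] = \<alpha> [] * \<beta> []"
  by (simp add: wedge_def shuffle_sign_def)

text \<open>Position 0 creates no inversion when it goes to the left factor. When it goes to the
  right factor, every element of \<open>S\<close> has to pass it, which adds \<open>card S\<close>
  inversions.\<close>

lemma shuffle_sign_Suc:
  assumes "S \<subseteq> {..<n}"
  shows "(shuffle_sign (Suc n) (insert 0 (Suc ` S)) :: 'b::comm_ring_1) = shuffle_sign n S"
    and "(shuffle_sign (Suc n) (Suc ` S) :: 'b) = (- 1) ^ card S * shuffle_sign n S"
proof -
  let ?P = "{(i, j). i \<in> S \<and> j \<in> {..<n} - S \<and> j < i}"
  have fin: "finite S" using assms finite_subset by blast
  have finP: "finite ?P"
    by (rule finite_subset[of _ "S \<times> {..<n}"]) (auto simp: fin)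
  have inj: "inj_on (map_prod Suc Suc) ?P" by (auto simp: inj_on_def)
  have "{(i, j). i \<in> insert 0 (Suc ` S) \<and> j \<in> {..<Suc n} - insert 0 (Suc ` S) \<and> j < i}
      = map_prod Suc Suc ` ?P" (is "?L = _")
  proof (intro set_eqI iffI)
    fix p assume "p \<in> ?L"
    then obtain i j where p: "p = (i, j)" "i \<in> insert 0 (Suc ` S)"
      "j \<in> {..<Suc n}" "j \<notin> insert 0 (Suc ` S)" "j < i" by auto
    then obtain i' j' where "i = Suc i'" "j = Suc j'" by (metis insertI1 not0_implies_Suc not_less_zero)
    with p show "p \<in> map_prod Suc Suc ` ?P" by (auto intro!: image_eqI[of _ _ "(i', j')"])
  qed auto
  then show "(shuffle_sign (Suc n) (insert 0 (Suc ` S)) :: 'b) = shuffle_sign n S"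
    unfolding shuffle_sign_def by (simp only: card_image[OF inj])
  have "{(i, j). i \<in> Suc ` S \<and> j \<in> {..<Suc n} - Suc ` S \<and> j < i}
      = map_prod Suc Suc ` ?P \<union> (\<lambda>i. (Suc i, 0)) ` S" (is "?L = _")
  proof (intro set_eqI iffI)
    fix p assume "p \<in> ?L"
    then obtain i j where p: "p = (Suc i, j)" "i \<in> S"
      "j \<in> {..<Suc n}" "j \<notin> Suc ` S" "j < Suc i" by auto
    then show "p \<in> map_prod Suc Suc ` ?P \<union> (\<lambda>i. (Suc i, 0)) ` S"
      by (cases j) (auto intro!: image_eqI[of _ _ "(i, j - 1)"])
  qed auto
  moreover have "card (map_prod Suc Suc ` ?P \<union> (\<lambda>i. (Suc i, 0)) ` S) = card ?P + card S"
    by (subst card_Un_disjoint) (use finP in \<open>auto simp: fin card_image[OF inj] card_image inj_on_def simp del: lessThan_iff\<close>)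
  ultimately show "(shuffle_sign (Suc n) (Suc ` S) :: 'b) = (- 1) ^ card S * shuffle_sign n S"
    by (simp add: shuffle_sign_def power_add mult.commute)
qed

lemma Pow_lessThan_Suc: "Pow {..<Suc n} = (image Suc) ` Pow {..<n} \<union> (\<lambda>S. insert 0 (Suc ` S)) ` Pow {..<n}"
proof -
  have e: "{..<Suc n} = insert 0 (Suc ` {..<n})" by (simp add: lessThan_Suc_eq_insert_0)
  show ?thesis unfolding e Pow_insert image_Pow_surj[OF refl, symmetric] image_image ..
qed

lemma sum_Pow_lessThan_Suc:
  "(\<Sum>S\<in>Pow {..<Suc n}. F S) =
    (\<Sum>S\<in>Pow {..<n}. F (insert 0 (Suc ` S))) + (\<Sum>S\<in>Pow {..<n}. F (Suc ` S))"
proof -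
  have i1: "inj_on (image Suc) (Pow {..<n})" by (auto simp: inj_on_def inj_image_eq_iff)
  have i2: "inj_on (\<lambda>S. insert 0 (Suc ` S)) (Pow {..<n})"
  proof (rule inj_onI)
    fix S T assume "insert 0 (Suc ` S) = insert 0 (Suc ` T)"
    then have "Suc ` S = Suc ` T" by (metis Diff_insert_absorb image_iff nat.distinct(1))
    then show "S = T" by (simp add: inj_image_eq_iff)
  qed
  have d: "image Suc ` Pow {..<n} \<inter> (\<lambda>S. insert 0 (Suc ` S)) ` Pow {..<n} = {}" by auto
  show ?thesis unfolding Pow_lessThan_Suc
    by (subst sum.union_disjoint) (use d in \<open>auto simp: sum.reindex[OF i1] sum.reindex[OF i2] add.commute o_def\<close>)
qed

text \<open>The shuffles split by the factor that receives \<open>v\<close>. If it is \<beta>, then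
  \<open>v\<close> jumps over as many arguments as \<alpha> receives, and this number is the length
  that \<open>grade_inv\<close> sees.\<close>

lemma wedge_Cons: "(\<alpha> \<^bold>\<and> \<beta>) (v # vs) = (ins v \<alpha> \<^bold>\<and> \<beta>) vs + (grade_inv \<alpha> \<^bold>\<and> ins v \<beta>) vs"
proof -
  let ?n = "length vs"
  have 1: "nths (v # vs) (insert 0 (Suc ` S)) = v # nths vs S"
    "nths (v # vs) (Suc ` S) = nths vs S"
    "nths (v # vs) ({..<Suc ?n} - insert 0 (Suc ` S)) = nths vs ({..<?n} - S)"
    "nths (v # vs) ({..<Suc ?n} - Suc ` S) = v # nths vs ({..<?n} - S)" for S
  proof -
    have "{j. Suc j \<in> insert 0 (Suc ` S)} = S" "{j. Suc j \<in> Suc ` S} = S"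
      "{j. Suc j \<in> {..<Suc ?n} - insert 0 (Suc ` S)} = {..<?n} - S"
      "{j. Suc j \<in> {..<Suc ?n} - Suc ` S} = {..<?n} - S" by auto
    then show "nths (v # vs) (insert 0 (Suc ` S)) = v # nths vs S"
    "nths (v # vs) (Suc ` S) = nths vs S"
    "nths (v # vs) ({..<Suc ?n} - insert 0 (Suc ` S)) = nths vs ({..<?n} - S)"
    "nths (v # vs) ({..<Suc ?n} - Suc ` S) = v # nths vs ({..<?n} - S)"
      by (auto simp: nths_Cons)
  qed
  have 2: "length (nths vs S) = card S" if "S \<subseteq> {..<?n}" for S
    using that by (auto simp: length_nths intro!: arg_cong[of _ _ card])
  show ?thesis
    unfolding wedge_def length_Cons sum_Pow_lessThan_Suc
    by (rule arg_cong2[of _ _ _ _ "(+)"]; rule sum.cong)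
      (auto simp: shuffle_sign_Suc 1 2 ins_def grade_inv_def)
qed

lemma ins_wedge: "ins v (\<alpha> \<^bold>\<and> \<beta>) = (\<lambda>vs. (ins v \<alpha> \<^bold>\<and> \<beta>) vs + (grade_inv \<alpha> \<^bold>\<and> ins v \<beta>) vs)"
  by (rule ext) (simp add: ins_def wedge_Cons)

lemma ins_grade_inv: "ins v (grade_inv \<alpha>) = (\<lambda>vs. - grade_inv (ins v \<alpha>) vs)"
  by (rule ext) (simp add: ins_def grade_inv_def)

lemma grade_inv_grade_inv [simp]: "grade_inv (grade_inv \<alpha>) = \<alpha>"
  by (rule ext) (simp add: grade_inv_def flip: mult.assoc power_add)

lemma wedge_add_left: "((\<lambda>vs. \<alpha> vs + \<alpha>' vs) \<^bold>\<and> \<beta>) vs = (\<alpha> \<^bold>\<and> \<beta>) vs + (\<alpha>' \<^bold>\<and> \<beta>) vs"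
  and wedge_add_right: "(\<beta> \<^bold>\<and> (\<lambda>vs. \<alpha> vs + \<alpha>' vs)) vs = (\<beta> \<^bold>\<and> \<alpha>) vs + (\<beta> \<^bold>\<and> \<alpha>') vs"
  and wedge_diff_left: "((\<lambda>vs. \<alpha> vs - \<alpha>' vs) \<^bold>\<and> \<beta>) vs = (\<alpha> \<^bold>\<and> \<beta>) vs - (\<alpha>' \<^bold>\<and> \<beta>) vs"
  and wedge_diff_right: "(\<beta> \<^bold>\<and> (\<lambda>vs. \<alpha> vs - \<alpha>' vs)) vs = (\<beta> \<^bold>\<and> \<alpha>) vs - (\<beta> \<^bold>\<and> \<alpha>') vs"
  and wedge_mult_left: "((\<lambda>vs. c * \<alpha> vs) \<^bold>\<and> \<beta>) vs = c * (\<alpha> \<^bold>\<and> \<beta>) vs"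
  and wedge_mult_right: "(\<beta> \<^bold>\<and> (\<lambda>vs. c * \<alpha> vs)) vs = c * (\<beta> \<^bold>\<and> \<alpha>) vs"
  and wedge_minus_left: "((\<lambda>vs. - \<alpha> vs) \<^bold>\<and> \<beta>) vs = - (\<alpha> \<^bold>\<and> \<beta>) vs"
  and wedge_minus_right: "(\<beta> \<^bold>\<and> (\<lambda>vs. - \<alpha> vs)) vs = - (\<beta> \<^bold>\<and> \<alpha>) vs"
  and wedge_zero_left: "((\<lambda>vs. 0) \<^bold>\<and> \<beta>) vs = 0"
  and wedge_zero_right: "(\<beta> \<^bold>\<and> (\<lambda>vs. 0)) vs = 0"
  by (simp_all add: wedge_def algebra_simps sum.distrib sum_subtractf sum_distrib_left sum_negf)

lemmas wedge_linear = wedge_add_left wedge_add_right wedge_diff_left wedge_diff_right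
  wedge_mult_left wedge_mult_right wedge_minus_left wedge_minus_right wedge_zero_left wedge_zero_right

lemma grade_inv_wedge: "grade_inv (\<alpha> \<^bold>\<and> \<beta>) = grade_inv \<alpha> \<^bold>\<and> grade_inv \<beta>"
proof (rule ext)
  fix vs show "grade_inv (\<alpha> \<^bold>\<and> \<beta>) vs = (grade_inv \<alpha> \<^bold>\<and> grade_inv \<beta>) vs"
  proof (induction vs arbitrary: \<alpha> \<beta>)
    case Nil show ?case by (simp add: grade_inv_def)
  next
    case (Cons v vs)
    have "grade_inv (\<alpha> \<^bold>\<and> \<beta>) (v # vs) = - (grade_inv (ins v \<alpha> \<^bold>\<and> \<beta>) vs + grade_inv (grade_inv \<alpha> \<^bold>\<and> ins v \<beta>) vs)"
      by (simp add: grade_inv_def wedge_Cons algebra_simps)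
    then show ?case by (simp add: Cons wedge_Cons ins_grade_inv wedge_linear)
  qed
qed

lemma wedge_assoc: "(\<alpha> \<^bold>\<and> \<beta>) \<^bold>\<and> \<gamma> = \<alpha> \<^bold>\<and> (\<beta> \<^bold>\<and> \<gamma>)"
proof (rule ext)
  fix vs show "((\<alpha> \<^bold>\<and> \<beta>) \<^bold>\<and> \<gamma>) vs = (\<alpha> \<^bold>\<and> (\<beta> \<^bold>\<and> \<gamma>)) vs"
    by (induction vs arbitrary: \<alpha> \<beta> \<gamma>) 
      (simp_all add: wedge_Cons ins_wedge grade_inv_wedge wedge_linear mult.assoc)
qed

lemma wedge_map: "(\<alpha> \<^bold>\<and> \<beta>) (map L vs) = ((\<lambda>ws. \<alpha> (map L ws)) \<^bold>\<and> (\<lambda>ws. \<beta> (map L ws))) vs"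
  by (simp add: wedge_def nths_map)

lemma wedge_one_left: "wedge_one \<^bold>\<and> \<alpha> = (\<alpha> :: 'v list \<Rightarrow> 'b::comm_ring_1)"
proof (rule ext)
  have 1: "ins v wedge_one = (\<lambda>_. 0::'b)" "grade_inv wedge_one = (wedge_one :: 'v list \<Rightarrow> 'b)" for v :: 'v
    by (auto simp: ins_def wedge_one_def grade_inv_def fun_eq_iff)
  fix vs show "(wedge_one \<^bold>\<and> \<alpha>) vs = \<alpha> vs"
    by (induction vs arbitrary: \<alpha>)
      (simp_all add: wedge_Cons wedge_linear 1, simp_all add: wedge_one_def ins_def)
qed

lemma wedge_one_right: "\<alpha> \<^bold>\<and> wedge_one = (\<alpha> :: 'v list \<Rightarrow> 'b::comm_ring_1)"
proof (rule ext)
  have 1: "ins v wedge_one = (\<lambda>_. 0::'b)" for v :: 'v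
    by (auto simp: ins_def wedge_one_def fun_eq_iff)
  fix vs show "(\<alpha> \<^bold>\<and> wedge_one) vs = \<alpha> vs"
    by (induction vs arbitrary: \<alpha>)
      (simp_all add: wedge_Cons wedge_linear 1, simp_all add: wedge_one_def ins_def)
qed

section \<open>Alternating forms\<close>

definition degree_form :: "nat \<Rightarrow> ('v list \<Rightarrow> 'b::zero) \<Rightarrow> bool" where
  "degree_form k \<alpha> \<longleftrightarrow> (\<forall>vs. length vs \<noteq> k \<longrightarrow> \<alpha> vs = 0)"

text \<open>Unlike \<open>kform\<close> this fixes no degree and forbids only adjacent repetitions,
  so it passes to \<open>ins v \<alpha>\<close> at once and suits induction on the argument
  list.\<close>

definition multi :: "('v::real_vector list \<Rightarrow> 'b::real_vector) \<Rightarrow> bool" where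
  "multi \<alpha> \<longleftrightarrow> (\<forall>us ws. linear (\<lambda>v. \<alpha> (us @ v # ws))) \<and> (\<forall>us v ws. \<alpha> (us @ v # v # ws) = 0)"

lemma multi_linear: "multi \<alpha> \<Longrightarrow> linear (\<lambda>v. \<alpha> (us @ v # ws))"
  by (simp add: multi_def)

lemmas multi_args_add = linear_add[OF multi_linear]
lemmas multi_args_scale = linear_cmul[OF multi_linear]

lemma multi_swap: "multi \<alpha> \<Longrightarrow> \<alpha> (us @ v # w # ws) = - \<alpha> (us @ w # v # ws)"
proof -
  assume m: "multi \<alpha>"
  have l1: "\<alpha> (us @ (a + b) # vs) = \<alpha> (us @ a # vs) + \<alpha> (us @ b # vs)" for us a b vs
    by (rule multi_args_add[OF m])
  have "0 = \<alpha> (us @ (v + w) # (v + w) # ws)" using m by (simp add: multi_def)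
  also have "\<dots> = \<alpha> (us @ v # (v + w) # ws) + \<alpha> (us @ w # (v + w) # ws)" by (rule l1)
  also have "\<dots> = \<alpha> ((us @ [v]) @ (v + w) # ws) + \<alpha> ((us @ [w]) @ (v + w) # ws)" by simp
  also have "\<dots> = \<alpha> (us @ v # v # ws) + \<alpha> (us @ v # w # ws) + (\<alpha> (us @ w # v # ws) + \<alpha> (us @ w # w # ws))"
    unfolding l1 by simp
  finally show ?thesis using m by (simp add: multi_def eq_neg_iff_add_eq_0)
qed

lemma multi_rep: "multi \<alpha> \<Longrightarrow> \<alpha> (us @ v # v # ws) = 0"
  by (simp add: multi_def)

lemma multi_ins:
  assumes "multi \<alpha>" shows "multi (ins v \<alpha>)"
  using multi_linear[OF assms, of "v # us" for us] multi_rep[OF assms, of "v # us" for us]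
  unfolding multi_def ins_def by simp

lemma multi_move:
  assumes "multi (\<alpha> :: 'v::real_vector list \<Rightarrow> real)"
  shows "\<alpha> (us @ a # vs) = (- 1) ^ length us * \<alpha> (a # us @ vs)"
  using assms
proof (induction us arbitrary: \<alpha>)
  case (Cons u us)
  have "\<alpha> ((u # us) @ a # vs) = ins u \<alpha> (us @ a # vs)" by (simp add: ins_def)
  also have "\<dots> = (- 1) ^ length us * \<alpha> (u # a # us @ vs)"
    using Cons.IH[OF multi_ins[OF Cons.prems]] by (simp add: ins_def)
  also have "\<alpha> (u # a # us @ vs) = - \<alpha> (a # u # us @ vs)"
    by (rule multi_swap[OF Cons.prems, of "[]", unfolded append_Nil])
  finally show ?case by simp
qed simp

text \<open>Both copies of the repeated vector are moved to the front by \<open>multi_move\<close>,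
  where they are adjacent.\<close>

lemma multi_not_distinct:
  assumes "multi (\<alpha> :: 'v::real_vector list \<Rightarrow> real)" "\<not> distinct vs"
  shows "\<alpha> vs = 0"
proof -
  obtain xs ys zs v where vs: "vs = xs @ v # ys @ v # zs"
    using not_distinct_decomp[OF assms(2)] by auto
  have "\<alpha> vs = (- 1) ^ length (xs @ v # ys) * \<alpha> (v # (xs @ v # ys) @ zs)"
    unfolding vs using multi_move[OF assms(1), of "xs @ v # ys" v zs] by simp
  also have "\<alpha> (v # (xs @ v # ys) @ zs) = (- 1) ^ length (v # xs) * \<alpha> (v # (v # xs) @ ys @ zs)"
    using multi_move[OF assms(1), of "v # xs" v "ys @ zs"] by simp
  also have "\<alpha> (v # (v # xs) @ ys @ zs) = 0"
    using multi_rep[OF assms(1), of "[]"] by simp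
  finally show ?thesis by simp
qed

lemma kform_iff: "kform k (\<alpha> :: 'v::real_vector list \<Rightarrow> real) \<longleftrightarrow> multi \<alpha> \<and> degree_form k \<alpha>"
proof
  assume k: "kform k \<alpha>"
  have d: "degree_form k \<alpha>" using k by (auto simp: kform_def degree_form_def)
  have "linear (\<lambda>v. \<alpha> (us @ v # ws))" for us ws
  proof (cases "length us + Suc (length ws) = k")
    case True
    then have "linear (\<lambda>v. \<alpha> ((us @ 0 # ws)[length us := v]))"
      using k unfolding kform_def by (metis length_append length_Cons less_add_Suc1 add_Suc_right)
    then show ?thesis by simp
  next
    case False
    then have "(\<lambda>v. \<alpha> (us @ v # ws)) = (\<lambda>_. 0)" using d by (auto simp: degree_form_def)
    then show ?thesis by (simp add: linear_zero)
  qed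
  moreover have "\<alpha> (us @ v # v # ws) = 0" for us v ws
    using k unfolding kform_def by (cases "length us + Suc (Suc (length ws)) = k") auto
  ultimately show "multi \<alpha> \<and> degree_form k \<alpha>" using d by (simp add: multi_def)
next
  assume a: "multi \<alpha> \<and> degree_form k \<alpha>"
  have "linear (\<lambda>v. \<alpha> (vs[i := v]))" if "length vs = k" "i < k" for vs i
    using multi_linear[of \<alpha> "take i vs" "drop (Suc i) vs"] a that by (simp add: upd_conv_take_nth_drop)
  then show "kform k \<alpha>" using a multi_not_distinct by (auto simp: kform_def degree_form_def)
qed

lemma multi_add: "multi \<alpha> \<Longrightarrow> multi \<beta> \<Longrightarrow> multi (\<lambda>vs. \<alpha> vs + \<beta> vs)"
  and multi_diff: "multi \<alpha> \<Longrightarrow> multi \<beta> \<Longrightarrow> multi (\<lambda>vs. \<alpha> vs - \<beta> vs)"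
  and multi_zero: "multi (\<lambda>_. 0)"
  by (auto simp: multi_def linear_compose_add linear_compose_sub linear_zero)

lemma multi_mult: "multi (\<alpha> :: _ \<Rightarrow> real) \<Longrightarrow> multi (\<lambda>vs. c * \<alpha> vs)"
  unfolding multi_def using linear_compose_scale_right[where c=c] by fastforce

lemma multi_grade_inv:
  assumes "multi (\<alpha> :: _ \<Rightarrow> real)" shows "multi (grade_inv \<alpha>)"
proof -
  have "linear (\<lambda>v. grade_inv \<alpha> (us @ v # ws))" for us ws
    using linear_compose_scale_right[OF multi_linear[OF assms, of us ws], of "(- 1) ^ Suc (length us + length ws)"]
    by (simp only: grade_inv_def length_append length_Cons add_Suc_right real_scaleR_def)
  then show ?thesis using multi_rep[OF assms] by (simp add: multi_def grade_inv_def)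
qed

lemma multi_map: "multi \<alpha> \<Longrightarrow> linear L \<Longrightarrow> multi (\<lambda>vs. \<alpha> (map L vs))"
  unfolding multi_def using linear_compose[of L] by (fastforce simp: o_def)

lemma multi_wedge:
  assumes "multi (\<alpha> :: 'v::real_vector list \<Rightarrow> real)" "multi \<beta>"
  shows "multi (\<alpha> \<^bold>\<and> \<beta>)"
proof -
  have insl: "ins (a + b) \<alpha> = (\<lambda>vs. ins a \<alpha> vs + ins b \<alpha> vs)" "ins (r *\<^sub>R a) \<alpha> = (\<lambda>vs. r * ins a \<alpha> vs)"
    if "multi \<alpha>" for a b :: 'v and \<alpha> :: "_ \<Rightarrow> real" and r
    using multi_args_add[OF that, of "[]"] multi_args_scale[OF that, of "[]"] by (auto simp: ins_def fun_eq_iff)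
  have "linear (\<lambda>v. (\<alpha> \<^bold>\<and> \<beta>) (us @ v # ws))" for us ws using assms
  proof (induction us arbitrary: \<alpha> \<beta>)
    case Nil
    show ?case by (rule linearI) (simp_all add: wedge_Cons insl Nil wedge_linear algebra_simps)
  next
    case (Cons u us)
    show ?case using Cons by (simp add: wedge_Cons linear_compose_add multi_ins multi_grade_inv)
  qed
  moreover have "(\<alpha> \<^bold>\<and> \<beta>) (us @ v # v # ws) = 0" for us v ws using assms
  proof (induction us arbitrary: \<alpha> \<beta>)
    case Nil
    have "ins v (ins v \<gamma>) = (\<lambda>_. 0)" if "multi \<gamma>" for \<gamma> :: "_ \<Rightarrow> real"
      using multi_rep[OF that, of "[]"] by (auto simp: ins_def)
    \<comment> \<open>The two terms with one \<open>v\<close> in each factor cancel because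
      \<open>ins v\<close> anticommutes with \<open>grade_inv\<close>.\<close>
    then show ?case using Nil by (simp add: wedge_Cons ins_grade_inv wedge_linear)
  next
    case (Cons u us)
    show ?case using Cons by (simp add: wedge_Cons multi_ins multi_grade_inv)
  qed
  ultimately show ?thesis by (simp add: multi_def)
qed

lemma degree_form_ins: "degree_form (Suc k) \<alpha> \<Longrightarrow> degree_form k (ins v \<alpha>)"
  by (auto simp: degree_form_def ins_def)

lemma degree_form_ins_0: "degree_form 0 \<alpha> \<Longrightarrow> ins v \<alpha> = (\<lambda>_. 0)"
  by (auto simp: degree_form_def ins_def)

lemma degree_form_add: "degree_form k \<alpha> \<Longrightarrow> degree_form k \<beta> \<Longrightarrow> degree_form k (\<lambda>vs. \<alpha> vs + \<beta> vs :: 'b::comm_ring_1)"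
  and degree_form_diff: "degree_form k \<alpha> \<Longrightarrow> degree_form k \<beta> \<Longrightarrow> degree_form k (\<lambda>vs. \<alpha> vs - \<beta> vs)"
  and degree_form_mult: "degree_form k \<alpha> \<Longrightarrow> degree_form k (\<lambda>vs. c * \<alpha> vs)"
  and degree_form_zero: "degree_form k (\<lambda>vs. 0 :: 'b)"
  and degree_form_grade_inv: "degree_form k \<alpha> \<Longrightarrow> degree_form k (grade_inv \<alpha>)"
  by (auto simp: degree_form_def grade_inv_def)

lemma degree_form_map: "degree_form k \<alpha> \<Longrightarrow> degree_form k (\<lambda>vs. \<alpha> (map L vs))"
  by (auto simp: degree_form_def)

lemma degree_form_wedge:
  assumes "degree_form k (\<alpha> :: _ \<Rightarrow> 'b::comm_ring_1)" "degree_form l \<beta>"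
  shows "degree_form (k + l) (\<alpha> \<^bold>\<and> \<beta>)"
proof -
  have "(\<alpha> \<^bold>\<and> \<beta>) vs = 0" if "length vs \<noteq> k + l" for vs using assms that
  proof (induction vs arbitrary: \<alpha> \<beta> k l)
    case Nil then show ?case by (auto simp: degree_form_def)
  next
    case (Cons v vs)
    have "(ins v \<alpha> \<^bold>\<and> \<beta>) vs = 0"
    proof (cases k)
      case 0 then show ?thesis using Cons by (simp add: degree_form_ins_0 wedge_linear)
    next
      case (Suc k') then show ?thesis using Cons by (intro Cons.IH[of k']) (auto intro: degree_form_ins)
    qed
    moreover have "(grade_inv \<alpha> \<^bold>\<and> ins v \<beta>) vs = 0"
    proof (cases l)
      case 0 then show ?thesis using Cons by (simp add: degree_form_ins_0 wedge_linear)
    next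
      case (Suc l') then show ?thesis using Cons by (intro Cons.IH[of k _ l']) (auto intro: degree_form_ins degree_form_grade_inv)
    qed
    ultimately show ?case by (simp add: wedge_Cons)
  qed
  then show ?thesis by (simp add: degree_form_def)
qed

lemma grade_inv_degree: "degree_form k \<alpha> \<Longrightarrow> grade_inv \<alpha> = (\<lambda>vs. (- 1) ^ k * \<alpha> vs)"
  by (auto simp: grade_inv_def degree_form_def fun_eq_iff)

text \<open>Exchanging the factors reverses every shuffle, and the sign depends on the degrees
  alone. In the recursion one degree drops by one, which changes the sign by \<open>(-1)^l\<close>
  or \<open>(-1)^k\<close>; the sign of \<open>grade_inv\<close> makes up for it.\<close>

lemma wedge_commute:
  assumes "degree_form k (\<alpha> :: _ \<Rightarrow> 'b::comm_ring_1)" "degree_form l \<beta>"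
  shows "(\<alpha> \<^bold>\<and> \<beta>) vs = (- 1) ^ (k * l) * (\<beta> \<^bold>\<and> \<alpha>) vs"
  using assms
proof (induction vs arbitrary: \<alpha> \<beta> k l)
  case Nil then show ?case by (cases "k = 0 \<and> l = 0") (auto simp: degree_form_def)
next
  case (Cons v vs)
  have 1: "(ins v \<alpha> \<^bold>\<and> \<beta>) vs = (- 1) ^ (k * l) * (- 1) ^ l * (\<beta> \<^bold>\<and> ins v \<alpha>) vs"
  proof (cases k)
    case 0 then show ?thesis using Cons by (simp add: degree_form_ins_0 wedge_linear)
  next
    case (Suc k') 
    have "(- 1) ^ (k * l) * (- 1) ^ l = ((- 1) ^ (k' * l) :: 'b)"
      by (cases "even l"; cases "even k"; simp add: Suc)
    then show ?thesis using Cons.IH[of k' "ins v \<alpha>" l \<beta>] Cons.prems Suc by (auto intro: degree_form_ins)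
  qed
  have 2: "(\<alpha> \<^bold>\<and> ins v \<beta>) vs = (- 1) ^ (k * l) * (- 1) ^ k * (ins v \<beta> \<^bold>\<and> \<alpha>) vs"
  proof (cases l)
    case 0 then show ?thesis using Cons by (simp add: degree_form_ins_0 wedge_linear)
  next
    case (Suc l') 
    have "(- 1) ^ (k * l) * (- 1) ^ k = ((- 1) ^ (k * l') :: 'b)"
      by (cases "even l"; cases "even k"; simp add: Suc)
    then show ?thesis using Cons.IH[of k \<alpha> l' "ins v \<beta>"] Cons.prems Suc by (auto intro: degree_form_ins)
  qed
  have s: "(- 1) ^ k * ((- 1) ^ k * x) = x" for x :: 'b by (simp flip: mult.assoc power_add)
  show ?case
    by (simp add: wedge_Cons grade_inv_degree[OF Cons.prems(1)] grade_inv_degree[OF Cons.prems(2)]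
        wedge_linear 1 2) (simp add: algebra_simps s)
qed

lemma degree_form_covector: "degree_form (Suc 0) (covector l)"
  by (auto simp: degree_form_def covector_def split: list.splits)

lemma multi_covector: "linear l \<Longrightarrow> multi (covector l)"
proof -
  assume l: "linear l"
  have "linear (\<lambda>v. covector l (us @ v # ws))" for us ws
    by (cases us; cases ws) (auto simp: covector_def linear_add[OF l] linear_cmul[OF l] linear_iff split: list.splits)
  then show ?thesis by (auto simp: multi_def covector_def split: list.splits)
qed

lemma kform_covector: "linear l \<Longrightarrow> kform 1 (covector l)"
  by (simp add: kform_iff degree_form_covector multi_covector)

lemma kform_wedge: "kform k \<alpha> \<Longrightarrow> kform l \<beta> \<Longrightarrow> kform (k + l) (\<alpha> \<^bold>\<and> \<beta> :: _ \<Rightarrow> real)"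
  by (simp add: kform_iff multi_wedge degree_form_wedge)

lemma multi_wedge_one: "multi (wedge_one :: _ \<Rightarrow> real)"
  by (auto simp: multi_def wedge_one_def linear_zero)

lemma degree_form_wedge_one: "degree_form 0 wedge_one"
  by (auto simp: degree_form_def wedge_one_def)

lemma kform_ewedge: "\<forall>i\<in>set is. linear (e i) \<Longrightarrow> kform (length is) (ewedge e is)"
proof (induction "is")
  case Nil then show ?case by (simp add: ewedge_def kform_iff multi_wedge_one degree_form_wedge_one)
next
  case (Cons i "is")
  then show ?case using kform_wedge[OF kform_covector[of "e i"] Cons.IH] by (simp add: ewedge_def)
qed

lemma kform_add: "kform k \<alpha> \<Longrightarrow> kform k \<beta> \<Longrightarrow> kform k (\<lambda>vs. \<alpha> vs + \<beta> vs :: real)"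
  and kform_diff: "kform k \<alpha> \<Longrightarrow> kform k \<beta> \<Longrightarrow> kform k (\<lambda>vs. \<alpha> vs - \<beta> vs)"
  and kform_mult: "kform k \<alpha> \<Longrightarrow> kform k (\<lambda>vs. c * \<alpha> vs)"
  and kform_zero: "kform k (\<lambda>vs. 0 :: real)"
  by (auto simp: kform_iff multi_add multi_diff multi_mult multi_zero
     degree_form_add degree_form_diff degree_form_mult degree_form_zero)

lemma kform_map: "kform k (\<alpha> :: _ \<Rightarrow> real) \<Longrightarrow> linear L \<Longrightarrow> kform k (\<lambda>vs. \<alpha> (map L vs))"
  by (simp add: kform_iff multi_map degree_form_map)

lemma kform_ins: "kform (Suc k) \<alpha> \<Longrightarrow> kform k (ins v \<alpha> :: _ \<Rightarrow> real)"
  by (simp add: kform_iff multi_ins degree_form_ins)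

lemma kform_degree: "kform k (\<alpha> :: _ \<Rightarrow> real) \<Longrightarrow> length vs \<noteq> k \<Longrightarrow> \<alpha> vs = 0"
  by (simp add: kform_iff degree_form_def)

text \<open>Expansion of a determinant along a row: with it, products of covectors are evaluated one
  vector at a time.\<close>

lemma covector_wedge_Cons:
  "(covector l \<^bold>\<and> \<alpha>) (v # vs) = l v * \<alpha> vs - (covector l \<^bold>\<and> ins v \<alpha>) vs"
proof -
  have "ins v (covector l) = (\<lambda>ws. l v * wedge_one ws)"
    by (auto simp: ins_def covector_def wedge_one_def fun_eq_iff split: list.splits)
  then show ?thesis
    by (simp add: wedge_Cons grade_inv_degree[OF degree_form_covector] wedge_linear wedge_one_left)
qed

lemma covector_wedge_Nil: "(covector l \<^bold>\<and> \<alpha>) [] = 0"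
  by (simp add: covector_def)

section \<open>Bases and the Hodge operator\<close>

fun combs :: "nat \<Rightarrow> 'a list \<Rightarrow> 'a list list" where
  "combs 0 xs = [[]]"
| "combs (Suc k) [] = []"
| "combs (Suc k) (x # xs) = map ((#) x) (combs k xs) @ combs (Suc k) xs"

lemma combs_map: "combs k (map f xs) = map (map f) (combs k xs)"
  by (induction k xs rule: combs.induct) auto

lemma combs_length: "ws \<in> set (combs k xs) \<Longrightarrow> length ws = k"
  by (induction k xs arbitrary: ws rule: combs.induct) auto

lemma combs_subset: "ws \<in> set (combs k xs) \<Longrightarrow> set ws \<subseteq> set xs"
  by (induction k xs arbitrary: ws rule: combs.induct) fastforce+

lemma combs_sorted: "sorted_wrt (<) (xs::nat list) \<Longrightarrow> ws \<in> set (combs k xs) \<Longrightarrow> sorted_wrt (<) ws"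
proof (induction k xs arbitrary: ws rule: combs.induct)
  case (1 xs)
  then show ?case by simp
next
  case (2 k)
  then show ?case by simp
next
  case (3 k x xs)
  have xs: "sorted_wrt (<) xs" "\<forall>y\<in>set xs. x < y" using 3(3) by simp_all
  from 3(4) consider us where "us \<in> set (combs k xs)" "ws = x # us" | "ws \<in> set (combs (Suc k) xs)"
    by fastforce
  then show ?case
  proof cases
    case 1
    then show ?thesis using 3(1)[OF xs(1) 1(1)] xs(2) combs_subset[OF 1(1)] by force
  next
    case 2
    then show ?thesis using 3(2)[OF xs(1)] by blast
  qed
qed

lemma combs_distinct: "distinct xs \<Longrightarrow> distinct (combs k xs)"
proof (induction k xs rule: combs.induct)
  case (3 k x xs)
  have "x # ws \<notin> set (combs (Suc k) xs)" for ws
    using combs_subset[of "x # ws"] 3 by auto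
  then show ?case using 3 by (auto simp: distinct_map)
qed auto

lemma filter_in_combs: "filter P xs \<in> set (combs (length (filter P xs)) xs)"
proof (induction xs)
  case (Cons x xs)
  then show ?case by (cases "length (filter P xs)") auto
qed simp

text \<open>Turns the sum over index sets in \<open>hodge\<close> into a list that can be enumerated
  for a concrete frame; sets of a size other than \<open>k\<close> drop out by degree.\<close>

lemma sum_nths_combs:
  fixes F :: "'a list \<Rightarrow> 'b::comm_ring_1"
  assumes "degree_form k F"
  shows "(\<Sum>S\<in>Pow {..<length es}. F (nths es S)) = sum_list (map F (combs k es))"
  using assms
proof (induction es arbitrary: k F)
  case Nil
  then show ?case by (cases k) (auto simp: degree_form_def)
next
  case (Cons e es)
  have n: "nths (e # es) (insert 0 (Suc ` S)) = e # nths es S" "nths (e # es) (Suc ` S) = nths es S" for S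
  proof -
    have "{j. Suc j \<in> insert 0 (Suc ` S)} = S" "{j. Suc j \<in> Suc ` S} = S" by auto
    then show "nths (e # es) (insert 0 (Suc ` S)) = e # nths es S" "nths (e # es) (Suc ` S) = nths es S"
      by (auto simp: nths_Cons)
  qed
  have "(\<Sum>S\<in>Pow {..<length (e # es)}. F (nths (e # es) S)) =
     (\<Sum>S\<in>Pow {..<length es}. ins e F (nths es S)) + (\<Sum>S\<in>Pow {..<length es}. F (nths es S))"
    by (simp only: length_Cons sum_Pow_lessThan_Suc n ins_def)
  also have "(\<Sum>S\<in>Pow {..<length es}. F (nths es S)) = sum_list (map F (combs k es))"
    by (rule Cons.IH[OF Cons.prems])
  finally show ?case
  proof (cases k)
    case 0
    then show ?thesis using Cons.IH[OF Cons.prems] Cons.prems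
      \<open>(\<Sum>S\<in>Pow {..<length (e # es)}. F (nths (e # es) S)) = _\<close> 
      by (simp add: degree_form_ins_0)
  next
    case (Suc k')
    then show ?thesis using Cons.IH[OF degree_form_ins[of k' F e]] Cons.prems Cons.IH[OF Cons.prems]
      \<open>(\<Sum>S\<in>Pow {..<length (e # es)}. F (nths (e # es) S)) = _\<close> 
      by (simp add: o_def ins_def)
  qed
qed

definition pairing :: "nat \<Rightarrow> 'v list \<Rightarrow> ('v list \<Rightarrow> real) \<Rightarrow> ('v list \<Rightarrow> real) \<Rightarrow> real" where
  "pairing k es \<alpha> \<nu> = sum_list (map (\<lambda>ws. \<alpha> ws * \<nu> ws) (combs k es))"

text \<open>The pairing summed over all \<open>k\<close>-tuples, repetitions included. In each
  single slot it is the trace of a bilinear form, so independence of the basis follows by induction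
  on \<open>k\<close>; increasing tuples do not decouple in this way.\<close>

fun tuple_sum :: "nat \<Rightarrow> 'v list \<Rightarrow> ('v list \<Rightarrow> real) \<Rightarrow> ('v list \<Rightarrow> real) \<Rightarrow> real" where
  "tuple_sum 0 es \<alpha> \<nu> = \<alpha> [] * \<nu> []"
| "tuple_sum (Suc k) es \<alpha> \<nu> = (\<Sum>e\<leftarrow>es. tuple_sum k es (ins e \<alpha>) (ins e \<nu>))"

lemma pairing_0 [simp]: "pairing 0 es \<alpha> \<nu> = \<alpha> [] * \<nu> []"
  by (simp add: pairing_def)

lemma pairing_Suc_Nil [simp]: "pairing (Suc k) [] \<alpha> \<nu> = 0"
  by (simp add: pairing_def)

lemma pairing_Suc_Cons [simp]:
  "pairing (Suc k) (e # es) \<alpha> \<nu> = pairing k es (ins e \<alpha>) (ins e \<nu>) + pairing (Suc k) es \<alpha> \<nu>"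
  by (simp add: pairing_def o_def ins_def)

lemma multi_ins_ins:
  assumes "multi (\<alpha> :: _ \<Rightarrow> real)"
  shows "ins v (ins v \<alpha>) = (\<lambda>_. 0)" "ins v (ins w \<alpha>) = (\<lambda>ws. - ins w (ins v \<alpha>) ws)"
  by (rule ext; unfold ins_def; rule multi_rep[OF assms, of "[]", unfolded append_Nil]
      multi_swap[OF assms, of "[]", unfolded append_Nil])+

lemma pairing_minus_minus: "pairing k es (\<lambda>ws. - \<alpha> ws) (\<lambda>ws. - \<nu> ws) = pairing k es \<alpha> \<nu>"
  by (simp add: pairing_def)

lemma pairing_zero: "pairing k es (\<lambda>ws. 0) \<nu> = 0"
  by (simp add: pairing_def)

text \<open>Each increasing tuple of length \<open>k + 1\<close> arises from each of its
  \<open>k + 1\<close> members, pulled to the front. The sign of this move enters both factors and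
  cancels.\<close>

lemma pairing_step:
  assumes "multi \<alpha>" "multi \<nu>"
  shows "real (Suc k) * pairing (Suc k) es \<alpha> \<nu> = (\<Sum>e\<leftarrow>es. pairing k es (ins e \<alpha>) (ins e \<nu>))"
  using assms
proof (induction es arbitrary: k \<alpha> \<nu>)
  case (Cons a es)
  note m = Cons.prems
  show ?case
  proof (cases k)
    case 0
    have "(\<Sum>e\<leftarrow>es. pairing 0 es (ins e \<alpha>) (ins e \<nu>)) = pairing (Suc 0) es \<alpha> \<nu>"
      using Cons.IH[OF m, of 0] by simp
    then show ?thesis by (simp add: 0)
  next
    case (Suc j)
    have "(\<Sum>e\<leftarrow>a # es. pairing k (a # es) (ins e \<alpha>) (ins e \<nu>))
      = pairing k es (ins a \<alpha>) (ins a \<nu>)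
        + (\<Sum>e\<leftarrow>es. pairing j es (ins a (ins e \<alpha>)) (ins a (ins e \<nu>)) + pairing k es (ins e \<alpha>) (ins e \<nu>))"
      by (simp add: Suc multi_ins_ins(1)[OF m(1)] pairing_zero)
    also have "\<dots> = pairing k es (ins a \<alpha>) (ins a \<nu>)
        + (\<Sum>e\<leftarrow>es. pairing j es (ins e (ins a \<alpha>)) (ins e (ins a \<nu>))) 
        + (\<Sum>e\<leftarrow>es. pairing k es (ins e \<alpha>) (ins e \<nu>))"
    proof -
      have "pairing j es (ins a (ins e \<alpha>)) (ins a (ins e \<nu>)) = pairing j es (ins e (ins a \<alpha>)) (ins e (ins a \<nu>))" for e
        unfolding multi_ins_ins(2)[OF m(1), of a e] multi_ins_ins(2)[OF m(2), of a e] pairing_minus_minus ..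
      then show ?thesis by (simp add: sum_list_addf)
    qed
    also have "\<dots> = pairing k es (ins a \<alpha>) (ins a \<nu>) + real (Suc j) * pairing (Suc j) es (ins a \<alpha>) (ins a \<nu>)
       + real (Suc k) * pairing (Suc k) es \<alpha> \<nu>"
      using Cons.IH[OF multi_ins[OF m(1)] multi_ins[OF m(2)], of j a a] Cons.IH[OF m, of k] by simp
    finally show ?thesis by (simp add: Suc algebra_simps)
  qed
qed simp

lemma tuple_sum_eq_pairing:
  assumes "multi \<alpha>" "multi \<nu>"
  shows "tuple_sum k es \<alpha> \<nu> = fact k * pairing k es \<alpha> \<nu>"
  using assms
proof (induction k arbitrary: \<alpha> \<nu>)
  case (Suc k)
  have "tuple_sum (Suc k) es \<alpha> \<nu> = fact k * (\<Sum>e\<leftarrow>es. pairing k es (ins e \<alpha>) (ins e \<nu>))"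
    using Suc by (simp add: multi_ins sum_list_const_mult)
  then show ?case using pairing_step[OF Suc.prems, of k es] by (simp only: fact_Suc of_nat_mult mult_ac)
qed simp

lemma tuple_sum_linear:
  "tuple_sum k es (\<lambda>ws. \<alpha> ws + \<alpha>' ws) \<nu> = tuple_sum k es \<alpha> \<nu> + tuple_sum k es \<alpha>' \<nu>"
  "tuple_sum k es (\<lambda>ws. c * \<alpha> ws) \<nu> = c * tuple_sum k es \<alpha> \<nu>"
  "tuple_sum k es \<alpha> (\<lambda>ws. \<nu> ws + \<nu>' ws) = tuple_sum k es \<alpha> \<nu> + tuple_sum k es \<alpha> \<nu>'"
  "tuple_sum k es \<alpha> (\<lambda>ws. c * \<nu> ws) = c * tuple_sum k es \<alpha> \<nu>"
proof -
  have i: "ins e (\<lambda>ws. \<beta> ws + \<beta>' ws) = (\<lambda>ws. ins e \<beta> ws + ins e \<beta>' ws)" 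
    "ins e (\<lambda>ws. c * \<beta> ws) = (\<lambda>ws. c * ins e \<beta> ws)" for e and \<beta> \<beta>' :: "_ \<Rightarrow> real"
    by (auto simp: ins_def)
  show "tuple_sum k es (\<lambda>ws. \<alpha> ws + \<alpha>' ws) \<nu> = tuple_sum k es \<alpha> \<nu> + tuple_sum k es \<alpha>' \<nu>"
    by (induction k arbitrary: \<alpha> \<alpha>' \<nu>) (simp_all add: algebra_simps i sum_list_addf)
  show "tuple_sum k es (\<lambda>ws. c * \<alpha> ws) \<nu> = c * tuple_sum k es \<alpha> \<nu>"
    by (induction k arbitrary: \<alpha> \<nu>) (simp_all add: i sum_list_const_mult)
  show "tuple_sum k es \<alpha> (\<lambda>ws. \<nu> ws + \<nu>' ws) = tuple_sum k es \<alpha> \<nu> + tuple_sum k es \<alpha> \<nu>'"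
    by (induction k arbitrary: \<alpha> \<nu> \<nu>') (simp_all add: algebra_simps i sum_list_addf)
  show "tuple_sum k es \<alpha> (\<lambda>ws. c * \<nu> ws) = c * tuple_sum k es \<alpha> \<nu>"
    by (induction k arbitrary: \<alpha> \<nu>) (simp_all add: i sum_list_const_mult)
qed

lemma ins_linear:
  assumes "multi (\<alpha> :: _ \<Rightarrow> real)"
  shows "ins (v + w) \<alpha> = (\<lambda>ws. ins v \<alpha> ws + ins w \<alpha> ws)" "ins (c *\<^sub>R v) \<alpha> = (\<lambda>ws. c * ins v \<alpha> ws)"
  using multi_args_add[OF assms, of "[]"] multi_args_scale[OF assms, of "[]"] by (auto simp: ins_def)

text \<open>Covectors and vectors are numbered from 1, as in the paper.\<close>

definition dual_frame :: "nat \<Rightarrow> (nat \<Rightarrow> 'v::euclidean_space \<Rightarrow> real) \<Rightarrow> (nat \<Rightarrow> 'v) \<Rightarrow> bool" where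
  "dual_frame m e b \<longleftrightarrow> DIM('v) = m \<and> (\<forall>i\<in>{1..m}. linear (e i)) \<and>
     (\<forall>i\<in>{1..m}. \<forall>j\<in>{1..m}. e i (b j) = (if i = j then 1 else 0))"

definition frame_list :: "nat \<Rightarrow> (nat \<Rightarrow> 'v) \<Rightarrow> 'v list" where
  "frame_list m b = map b [1..<Suc m]"

definition frame_metric :: "nat \<Rightarrow> (nat \<Rightarrow> 'v \<Rightarrow> real) \<Rightarrow> 'v \<Rightarrow> 'v \<Rightarrow> real" where
  "frame_metric m e v w = (\<Sum>i=1..m. e i v * e i w)"

text \<open>The duality relations make the \<open>b i\<close> independent, and their number is the
  dimension; hence they span, and \<open>e i\<close> reads off the coefficients.\<close>

lemma dual_frame_expand:
  assumes "dual_frame m e (b :: nat \<Rightarrow> 'v::euclidean_space)"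
  shows "v = (\<Sum>i=1..m. e i v *\<^sub>R b i)"
proof -
  have dim: "DIM('v) = m" and lin: "\<And>i. i \<in> {1..m} \<Longrightarrow> linear (e i)"
    and dual: "\<And>i j. i \<in> {1..m} \<Longrightarrow> j \<in> {1..m} \<Longrightarrow> e i (b j) = (if i = j then 1 else 0)"
    using assms by (auto simp: dual_frame_def)
  have inj: "inj_on b {1..m}"
  proof (rule inj_onI)
    fix i j assume "i \<in> {1..m}" "j \<in> {1..m}" "b i = b j"
    then show "i = j" using dual[of i i] dual[of i j] by (auto split: if_splits)
  qed
  have dual_sum: "e j (\<Sum>i=1..m. c i *\<^sub>R b i) = c j" if "j \<in> {1..m}" for c j
  proof -
    have "e j (\<Sum>i=1..m. c i *\<^sub>R b i) = (\<Sum>i=1..m. c i * e j (b i))"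
      by (simp add: linear_sum[OF lin[OF that]] linear_cmul[OF lin[OF that]])
    also have "\<dots> = (\<Sum>i=1..m. if i = j then c i else 0)"
      by (rule sum.cong) (use that dual in auto)
    finally show ?thesis using that by simp
  qed
  have "independent (b ` {1..m})"
  proof (rule independent_if_scalars_zero)
    fix f x assume z: "(\<Sum>x\<in>b ` {1..m}. f x *\<^sub>R x) = 0" and "x \<in> b ` {1..m}"
    then obtain j where j: "j \<in> {1..m}" "x = b j" by auto
    have "(\<Sum>i=1..m. f (b i) *\<^sub>R b i) = 0" using z unfolding sum.reindex[OF inj] o_def .
    then show "f x = 0" using dual_sum[OF j(1), of "\<lambda>i. f (b i)"] j linear_0[OF lin[OF j(1)]] by simp
  qed simp
  moreover have "card (b ` {1..m}) = DIM('v)" using card_image[OF inj] dim by simp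
  ultimately have "UNIV \<subseteq> span (b ` {1..m})" by (intro card_ge_dim_independent) (auto simp: dim_UNIV)
  then have "v \<in> span (b ` {1..m})" by auto
  then obtain u where "v = (\<Sum>x\<in>b ` {1..m}. u x *\<^sub>R x)" by (auto simp: span_finite)
  then have v: "v = (\<Sum>i=1..m. u (b i) *\<^sub>R b i)" unfolding sum.reindex[OF inj] o_def .
  then have "e j v = u (b j)" if "j \<in> {1..m}" for j using dual_sum[OF that] by simp
  then show ?thesis by (subst (1) v) (auto intro!: sum.cong)
qed

lemma dual_frame_coframe7:
  assumes "dual_frame 7 e b" shows "coframe7 e"
proof -
  have "v = 0" if "\<forall>i\<in>{1..7}. e i v = 0" for v
    using that dual_frame_expand[OF assms, of v] by simp
  then show ?thesis using assms by (auto simp: coframe7_def dual_frame_def)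
qed

text \<open>The map \<open>T\<close> sends \<open>v\<close> to the vector with coordinates
  \<open>e i v\<close>. It is injective since the covectors have no common zero, hence bijective,
  and the preimages of the standard basis form the dual frame.\<close>

lemma coframe7_dual_frame:
  assumes "coframe7 (e :: nat \<Rightarrow> 'v::euclidean_space \<Rightarrow> real)"
  shows "\<exists>b. dual_frame 7 e b"
proof -
  have dim: "DIM('v) = 7" and lin: "\<And>i. i \<in> {1..7} \<Longrightarrow> linear (e i)"
    and ker: "\<And>v. (\<forall>i\<in>{1..7}. e i v = 0) \<Longrightarrow> v = 0"
    using assms by (auto simp: coframe7_def)
  obtain h where h: "bij_betw h {1..7::nat} (Basis :: 'v set)"
    using dim by (metis card_atLeastAtMost diff_Suc_1 finite_Basis finite_atLeastAtMost finite_same_card_bij)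
  define T where "T v = (\<Sum>i=1..7. e i v *\<^sub>R h i)" for v
  have linT: "linear T" unfolding T_def
    by (rule linear_compose_sum) (use lin in \<open>auto simp: linear_iff algebra_simps\<close>)
  have Th: "T v \<bullet> h j = e j v" if "j \<in> {1..7}" for v j
  proof -
    have "T v \<bullet> h j = (\<Sum>i=1..7. e i v * (h i \<bullet> h j))" by (simp add: T_def inner_sum_left)
    also have "\<dots> = (\<Sum>i=1..7. if i = j then e i v else 0)"
    proof (rule sum.cong)
      fix i :: nat assume i: "i \<in> {1..7}"
      then have "h i \<in> Basis" "h j \<in> Basis" "h i = h j \<longleftrightarrow> i = j"
        using h that by (auto simp: bij_betw_def inj_on_def)
      then show "e i v * (h i \<bullet> h j) = (if i = j then e i v else 0)" by (simp add: inner_Basis)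
    qed simp
    finally show ?thesis using that by simp
  qed
  have "inj T"
  proof (subst linear_injective_0[OF linT], intro allI impI)
    fix v assume "T v = 0"
    then show "v = 0" using ker Th by (metis inner_zero_left)
  qed
  then have "surj T" by (rule linear_inj_imp_surj[OF linT])
  then have b: "T (inv T (h j)) = h j" for j by (rule surj_f_inv_f)
  have "e i (inv T (h j)) = (if i = j then 1 else 0)" if "i \<in> {1..7}" "j \<in> {1..7}" for i j
  proof -
    have "h i \<in> Basis" "h j \<in> Basis" "h i = h j \<longleftrightarrow> i = j"
        using h that by (auto simp: bij_betw_def inj_on_def)
    then show ?thesis using Th[OF that(1), of "inv T (h j)"] by (auto simp: b inner_Basis)
  qed
  then have "dual_frame 7 e (\<lambda>j. inv T (h j))" using dim lin by (simp add: dual_frame_def)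
  then show ?thesis by metis
qed

lemma length_frame_list [simp]: "length (frame_list m b) = m"
  by (simp add: frame_list_def)

lemma frame_list_nth: "i < m \<Longrightarrow> frame_list m b ! i = b (Suc i)"
  by (simp add: frame_list_def nth_map nth_upt del: upt_Suc)

lemma frame_metric_basis:
  assumes "dual_frame m e b" "j \<in> {1..m}"
  shows "frame_metric m e (b j) w = e j w" "frame_metric m e w (b j) = e j w"
proof -
  have "frame_metric m e (b j) w = (\<Sum>i=1..m. if i = j then e i w else 0)"
    unfolding frame_metric_def by (rule sum.cong) (use assms in \<open>auto simp: dual_frame_def\<close>)
  then show "frame_metric m e (b j) w = e j w" using assms(2) by simp
  then show "frame_metric m e w (b j) = e j w" by (simp add: frame_metric_def mult.commute)
qed

lemma inner_product_frame_metric: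
  assumes "dual_frame m e b"
  shows "inner_product_on_type (frame_metric m e)"
proof -
  have lin: "\<And>i. i \<in> {1..m} \<Longrightarrow> linear (e i)" using assms by (auto simp: dual_frame_def)
  have "linear (frame_metric m e v)" for v
    unfolding frame_metric_def
    by (rule linear_compose_sum, intro ballI)
      (auto simp: linear_iff linear_add[OF lin] linear_cmul[OF lin] algebra_simps)
  moreover have "frame_metric m e v v > 0" if "v \<noteq> 0" for v
  proof -
    have "\<exists>i\<in>{1..m}. e i v \<noteq> 0" using dual_frame_expand[OF assms, of v] that
      by (metis (no_types, lifting) scaleR_zero_left sum.neutral)
    then obtain i where "i \<in> {1..m}" "e i v \<noteq> 0" by blast
    then have "0 < e i v * e i v" "i \<in> {1..m}" by (auto simp: zero_less_mult_iff)
    then show ?thesis unfolding frame_metric_def by (intro sum_pos2[of _ i]) auto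
  qed
  ultimately show ?thesis by (auto simp: inner_product_on_type_def frame_metric_def mult.commute)
qed

lemma orthonormal_frame_list:
  assumes "dual_frame m e b"
  shows "orthonormal_basis (frame_metric m e) (frame_list m b)"
  using assms frame_metric_basis(1)[OF assms]
  by (auto simp: orthonormal_basis_def frame_list_nth dual_frame_def)

lemma orthonormal_dual_frame:
  assumes "inner_product_on_type g" "orthonormal_basis g (es :: 'v::euclidean_space list)"
  shows "dual_frame (DIM('v)) (\<lambda>i. g (es ! (i - 1))) (\<lambda>i. es ! (i - 1))"
  using assms by (auto simp: dual_frame_def inner_product_on_type_def orthonormal_basis_def)

lemma orthonormal_expand:
  assumes "inner_product_on_type g" "orthonormal_basis g es"
  shows "v = (\<Sum>i<length es. g (es ! i) v *\<^sub>R es ! i)"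
proof -
  have l: "length es = DIM('a)" using assms by (simp add: orthonormal_basis_def)
  have "v = (\<Sum>i=1..DIM('a). g (es ! (i - 1)) v *\<^sub>R es ! (i - 1))"
    by (rule dual_frame_expand[OF orthonormal_dual_frame[OF assms]])
  also have "\<dots> = (\<Sum>i<length es. g (es ! i) v *\<^sub>R es ! i)"
    by (rule sum.reindex_bij_witness[of _ Suc "\<lambda>i. i - 1"]) (auto simp: l)
  finally show ?thesis .
qed

text \<open>The first argument is expanded in \<open>es'\<close> and the coefficients are then
  absorbed into the second argument, as its expansion in \<open>es\<close>. The same numbers
  \<open>g (es' ! j) (es ! i)\<close> serve both expansions, so orthogonality of the transition
  matrix need not be spelled out.\<close>

lemma trace_invariant:
  assumes g: "inner_product_on_type g" and o: "orthonormal_basis g es" "orthonormal_basis g es'"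
    and B: "\<And>w. linear (\<lambda>v. B v w :: real)" "\<And>v. linear (B v)"
  shows "(\<Sum>i<length es. B (es ! i) (es ! i)) = (\<Sum>i<length es'. B (es' ! i) (es' ! i))"
proof -
  have sym: "g v w = g w v" for v w using g by (auto simp: inner_product_on_type_def)
  have "(\<Sum>i<length es. B (es ! i) (es ! i)) =
     (\<Sum>i<length es. B (\<Sum>j<length es'. g (es' ! j) (es ! i) *\<^sub>R es' ! j) (es ! i))"
    using orthonormal_expand[OF g o(2)] by (intro sum.cong refl) metis
  also have "\<dots> = (\<Sum>i<length es. \<Sum>j<length es'. g (es' ! j) (es ! i) * B (es' ! j) (es ! i))"
    by (simp add: linear_sum[OF B(1)] linear_cmul[OF B(1)])
  also have "\<dots> = (\<Sum>j<length es'. \<Sum>i<length es. g (es' ! j) (es ! i) * B (es' ! j) (es ! i))"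
    by (rule sum.swap)
  also have "\<dots> = (\<Sum>j<length es'. B (es' ! j) (\<Sum>i<length es. g (es ! i) (es' ! j) *\<^sub>R es ! i))"
    by (simp add: linear_sum[OF B(2)] linear_cmul[OF B(2)] sym)
  also have "\<dots> = (\<Sum>j<length es'. B (es' ! j) (es' ! j))"
    using orthonormal_expand[OF g o(1)] by (intro sum.cong refl) metis
  finally show ?thesis .
qed

lemma tuple_sum_invariant:
  assumes g: "inner_product_on_type g" and o: "orthonormal_basis g es" "orthonormal_basis g es'"
    and "multi \<alpha>" "multi \<nu>"
  shows "tuple_sum k es \<alpha> \<nu> = tuple_sum k es' \<alpha> \<nu>"
  using assms(4,5)
proof (induction k arbitrary: \<alpha> \<nu>)
  case (Suc k)
  have "tuple_sum (Suc k) es \<alpha> \<nu> = (\<Sum>e\<leftarrow>es. tuple_sum k es' (ins e \<alpha>) (ins e \<nu>))"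
    using Suc by (simp add: multi_ins cong: map_cong)
  also have "\<dots> = (\<Sum>i<length es. tuple_sum k es' (ins (es ! i) \<alpha>) (ins (es ! i) \<nu>))"
    by (simp add: sum_list_sum_nth atLeast0LessThan)
  also have "\<dots> = (\<Sum>i<length es'. tuple_sum k es' (ins (es' ! i) \<alpha>) (ins (es' ! i) \<nu>))"
    by (rule trace_invariant[OF g o])
      (auto simp: linear_iff ins_linear[OF Suc.prems(1)] ins_linear[OF Suc.prems(2)] tuple_sum_linear)
  also have "\<dots> = tuple_sum (Suc k) es' \<alpha> \<nu>"
    by (simp add: sum_list_sum_nth atLeast0LessThan)
  finally show ?case .
qed simp

lemma pairing_invariant:
  assumes "inner_product_on_type g" "orthonormal_basis g es" "orthonormal_basis g es'"
    and "multi \<alpha>" "multi \<nu>"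
  shows "pairing k es \<alpha> \<nu> = pairing k es' \<alpha> \<nu>"
  using tuple_sum_invariant[OF assms, of k] tuple_sum_eq_pairing[OF assms(4,5), of k] by simp

lemma multi_append: "multi \<mu> \<Longrightarrow> multi (\<lambda>ws. \<mu> (ws @ vs))"
  by (auto simp: multi_def)

text \<open>Any orthonormal basis may replace the one selected inside \<open>hodge\<close>, so the
  star can be computed in a frame adapted to the geometry.\<close>

lemma hodge_eq_pairing:
  assumes g: "inner_product_on_type g" and o: "orthonormal_basis g es"
    and \<alpha>: "kform k \<alpha>" and \<mu>: "multi \<mu>"
  shows "hodge g \<mu> \<alpha> vs = pairing k es \<alpha> (\<lambda>ws. \<mu> (ws @ vs))"
proof -
  define es' where "es' = (SOME es. orthonormal_basis g es)"
  have o': "orthonormal_basis g es'" unfolding es'_def by (rule someI[of _ es]) (rule o)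
  have "degree_form k (\<lambda>ws. \<alpha> ws * \<mu> (ws @ vs))"
    using \<alpha> by (auto simp: kform_iff degree_form_def)
  from sum_nths_combs[OF this, of es'] have "hodge g \<mu> \<alpha> vs = pairing k es' \<alpha> (\<lambda>ws. \<mu> (ws @ vs))"
    by (simp add: hodge_def Let_def pairing_def flip: es'_def)
  also have "\<dots> = pairing k es \<alpha> (\<lambda>ws. \<mu> (ws @ vs))"
    by (rule pairing_invariant[OF g o' o]) (use \<alpha> \<mu> in \<open>auto simp: kform_iff intro: multi_append\<close>)
  finally show ?thesis .
qed

lemma hodge_zero: "hodge g \<mu> (\<lambda>_. 0) vs = 0"
  by (simp add: hodge_def)

lemma hodge_linear:
  "hodge g \<mu> (\<lambda>vs. \<alpha> vs + \<beta> vs) vs = hodge g \<mu> \<alpha> vs + hodge g \<mu> \<beta> vs"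
  "hodge g \<mu> (\<lambda>vs. \<alpha> vs - \<beta> vs) vs = hodge g \<mu> \<alpha> vs - hodge g \<mu> \<beta> vs"
  by (simp_all add: hodge_def Let_def algebra_simps sum.distrib sum_subtractf)

lemma kform_hodge:
  assumes "inner_product_on_type g" "orthonormal_basis g es" "kform k \<alpha>" "kform (k + l) \<mu>"
  shows "kform l (hodge g \<mu> \<alpha>)"
proof -
  have m: "multi \<mu>" using assms by (simp add: kform_iff)
  have "kform l (\<lambda>vs. sum_list (map (\<lambda>ws. \<alpha> ws * \<mu> (ws @ vs)) wss))" if "\<forall>ws\<in>set wss. length ws = k" for wss
    using that
  proof (induction wss)
    case (Cons ws wss)
    have "multi (\<lambda>vs. \<mu> (ws @ vs))" using m by (auto simp: multi_def simp flip: append_assoc)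
    moreover have "degree_form l (\<lambda>vs. \<mu> (ws @ vs))" using assms(4) Cons.prems by (auto simp: kform_iff degree_form_def)
    ultimately show ?case using Cons by (auto simp: kform_iff intro!: multi_add degree_form_add multi_mult degree_form_mult)
  qed (simp add: kform_zero)
  from this[of "combs k es"] show ?thesis
    unfolding hodge_eq_pairing[OF assms(1-3) m] pairing_def using combs_length by (auto simp: fun_eq_iff)
qed

text \<open>Of the index tuples summed over, those that meet \<open>T\<close> repeat a vector, and
  the only increasing one of complementary length that avoids \<open>T\<close> is the complement.
  Each component of the star is thus a single product.\<close>

lemma hodge_frame:
  assumes F: "dual_frame m e b" and \<alpha>: "kform k \<alpha>" and \<mu>: "kform m \<mu>"
    and T: "T \<in> set (combs l [1..<Suc m])" and kl: "k + l = m"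
  shows "hodge (frame_metric m e) \<mu> \<alpha> (map b T) =
    \<alpha> (map b (filter (\<lambda>i. i \<notin> set T) [1..<Suc m])) *
    \<mu> (map b (filter (\<lambda>i. i \<notin> set T) [1..<Suc m] @ T))"
proof -
  let ?I = "[1..<Suc m]"
  let ?R = "filter (\<lambda>i. i \<notin> set T) ?I"
  have m: "multi \<mu>" using \<mu> by (simp add: kform_iff)
  have Ts: "sorted_wrt (<) T" "set T \<subseteq> {1..m}" "length T = l"
    using combs_sorted[OF sorted_wrt_upt T] combs_subset[OF T] combs_length[OF T] by auto
  have setR: "set ?R = {1..m} - set T" by auto
  have "length ?R = card (set ?R)" by (metis distinct_card distinct_filter distinct_upt)
  also have "\<dots> = m - card (set T)" unfolding setR using Ts(2) by (simp add: card_Diff_subset finite_subset)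
  also have "card (set T) = l" using Ts by (simp add: distinct_card strict_sorted_iff)
  finally have lenR: "length ?R = k" using kl by simp
  have R: "?R \<in> set (combs k ?I)" using filter_in_combs[of "\<lambda>i. i \<notin> set T" ?I] by (simp only: lenR)
  have zero: "\<mu> (map b is @ map b T) = 0" if "is \<in> set (combs k ?I)" "is \<noteq> ?R" for "is"
  proof (cases "set is \<inter> set T = {}")
    case True
    have s: "sorted_wrt (<) is" "set is \<subseteq> {1..m}" "length is = k"
      using combs_sorted[OF sorted_wrt_upt that(1)] combs_subset[OF that(1)] combs_length[OF that(1)] by auto
    have "set is \<subseteq> set ?R" using True s(2) setR by blast
    moreover have "card (set is) = card (set ?R)"
      using s lenR by (metis distinct_card distinct_filter distinct_upt strict_sorted_iff)
    ultimately have "set is = set ?R" by (intro card_subset_eq) auto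
    moreover have "sorted_wrt (<) ?R" by (rule sorted_wrt_filter[OF sorted_wrt_upt])
    ultimately have "is = ?R" using s(1) by (metis strict_sorted_equal)
    then show ?thesis using that by simp
  next
    case False
    then have "\<not> distinct (map b is @ map b T)" by auto
    then show ?thesis by (rule multi_not_distinct[OF m])
  qed
  have "hodge (frame_metric m e) \<mu> \<alpha> (map b T) =
      (\<Sum>is\<leftarrow>combs k ?I. \<alpha> (map b is) * \<mu> (map b is @ map b T))"
    unfolding hodge_eq_pairing[OF inner_product_frame_metric[OF F] orthonormal_frame_list[OF F] \<alpha> m]
      pairing_def frame_list_def combs_map by (simp add: o_def)
  also have "\<dots> = (\<Sum>is\<in>set (combs k ?I). \<alpha> (map b is) * \<mu> (map b is @ map b T))"
    by (rule sum_list_distinct_conv_sum_set) (simp add: combs_distinct)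
  also have "\<dots> = (\<Sum>is\<in>{?R}. \<alpha> (map b is) * \<mu> (map b is @ map b T))"
    by (rule sum.mono_neutral_right) (use R zero in auto)
  finally show ?thesis by simp
qed

section \<open>Forms are determined by their values on a frame\<close>

lemma multi_zero_on_span:
  assumes "multi (\<alpha> :: 'v::real_vector list \<Rightarrow> real)" "\<And>k ws. ws \<in> set (combs k bs) \<Longrightarrow> \<alpha> ws = 0"
    and "set vs \<subseteq> span (set bs)"
  shows "\<alpha> vs = 0"
  using assms
proof (induction bs arbitrary: \<alpha> vs)
  case Nil
  show ?case
  proof (cases vs)
    case Nil' : Nil
    then show ?thesis using Nil.prems(2)[of vs 0] by simp
  next
    case (Cons v ws)
    then have "v = 0" using Nil by simp
    then show ?thesis using linear_0[OF multi_linear[OF Nil.prems(1), of "[]" ws]] Cons by simp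
  qed
next
  case (Cons a bs)
  note m = Cons.prems(1)
  have z1: "\<alpha> us = 0" if "set us \<subseteq> span (set bs)" for us
  proof (rule Cons.IH[OF m _ that])
    fix k ws assume "ws \<in> set (combs k bs)"
    then have "ws \<in> set (combs k (a # bs))" by (cases k) auto
    then show "\<alpha> ws = 0" by (rule Cons.prems(2))
  qed
  have z2: "\<alpha> (a # us) = 0" if "set us \<subseteq> span (set bs)" for us
  proof -
    have "ins a \<alpha> us = 0"
    proof (rule Cons.IH[OF multi_ins[OF m] _ that])
      fix k ws assume "ws \<in> set (combs k bs)"
      then have "a # ws \<in> set (combs (Suc k) (a # bs))" by simp
      then show "ins a \<alpha> ws = 0" unfolding ins_def by (rule Cons.prems(2))
    qed
    then show ?thesis by (simp add: ins_def)
  qed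
  \<comment> \<open>The vectors are reduced from left to right: \<open>us\<close> collects their
    parts in the span of \<open>bs\<close>, and the second half of the claim records that one
    \<open>a\<close> has been split off. A second \<open>a\<close> gives zero.\<close>
  have "\<forall>us. set us \<subseteq> span (set bs) \<longrightarrow> \<alpha> (us @ vs) = 0 \<and> \<alpha> (a # us @ vs) = 0"
    using Cons.prems(3)
  proof (induction vs)
    case Nil
    then show ?case using z1 z2 by simp
  next
    case (Cons v vs)
    obtain c where c: "v - c *\<^sub>R a \<in> span (set bs)" using Cons.prems by (auto simp: span_insert)
    define w where "w = v - c *\<^sub>R a"
    have v: "v = c *\<^sub>R a + w" and w: "w \<in> span (set bs)" using c by (auto simp: w_def)
    have IH: "\<alpha> (us @ vs) = 0" "\<alpha> (a # us @ vs) = 0" if "set us \<subseteq> span (set bs)" for us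
      using Cons.IH Cons.prems that by auto
    show ?case
    proof (intro allI impI conjI)
      fix us assume us: "set us \<subseteq> span (set bs)"
      have usw: "set (us @ [w]) \<subseteq> span (set bs)" using us w by simp
      have "\<alpha> (us @ v # vs) = c * \<alpha> (us @ a # vs) + \<alpha> ((us @ [w]) @ vs)"
        unfolding v multi_args_add[OF m] multi_args_scale[OF m] by simp
      also have "\<alpha> (us @ a # vs) = 0" unfolding multi_move[OF m, of us a vs] using IH(2)[OF us] by simp
      finally show "\<alpha> (us @ v # vs) = 0" using IH(1)[OF usw] by simp
      have "\<alpha> (a # us @ v # vs) = c * \<alpha> ((a # us) @ a # vs) + \<alpha> (a # (us @ [w]) @ vs)"
        using multi_args_add[OF m, of "a # us"] multi_args_scale[OF m, of "a # us"] by (simp add: v)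
      also have "\<alpha> ((a # us) @ a # vs) = 0" by (rule multi_not_distinct[OF m]) simp
      finally show "\<alpha> (a # us @ v # vs) = 0" using IH(2)[OF usw] by simp
    qed
  qed
  from this[rule_format, of "[]"] show ?case by simp
qed

lemma dual_frame_span: "dual_frame m e b \<Longrightarrow> v \<in> span (set (frame_list m b))"
proof -
  assume F: "dual_frame m e b"
  have "(\<Sum>i=1..m. e i v *\<^sub>R b i) \<in> span (set (frame_list m b))"
    by (intro span_sum span_scale span_base) (auto simp: frame_list_def simp del: upt_Suc)
  then show ?thesis using dual_frame_expand[OF F, of v] by simp
qed

text \<open>Reduces an identity between forms to a finite table of values on increasing tuples; the
  explicit computations in frames below rest on it.\<close>

lemma kform_frame_eqI:
  assumes F: "dual_frame m e b" and k: "kform k (\<alpha> :: _ \<Rightarrow> real)" "kform k \<beta>"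
    and eq: "\<And>is. is \<in> set (combs k [1..<Suc m]) \<Longrightarrow> \<alpha> (map b is) = \<beta> (map b is)"
  shows "\<alpha> = \<beta>"
proof (rule ext)
  fix vs
  have d: "kform k (\<lambda>vs. \<alpha> vs - \<beta> vs)" by (rule kform_diff[OF k])
  have "(\<lambda>vs. \<alpha> vs - \<beta> vs) vs = 0"
  proof (rule multi_zero_on_span[of _ "frame_list m b"])
    show "multi (\<lambda>vs. \<alpha> vs - \<beta> vs)" using d by (simp add: kform_iff)
    show "set vs \<subseteq> span (set (frame_list m b))" using dual_frame_span[OF F] by auto
    fix l ws assume ws: "ws \<in> set (combs l (frame_list m b))"
    show "\<alpha> ws - \<beta> ws = 0"
    proof (cases "l = k")
      case True
      then obtain "is" where "is \<in> set (combs k [1..<Suc m])" "ws = map b is"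
        using ws unfolding frame_list_def combs_map by auto
      then show ?thesis using eq by simp
    next
      case False
      then show ?thesis using combs_length[OF ws] kform_degree[OF d, of ws] by simp
    qed
  qed
  then show "\<alpha> vs = \<beta> vs" by simp
qed

section \<open>The model \<open>G\<^sub>2\<close>-form\<close>

lemma upt_1_7: "[1..<Suc 7] = [1, 2, 3, 4, 5, 6, 7]"
  by (simp add: upt_rec)

lemma combs_numeral:
  "combs (numeral n) [] = []"
  "combs (numeral n) (x # xs) = map ((#) x) (combs (pred_numeral n) xs) @ combs (numeral n) xs"
  "combs 1 xs = map (\<lambda>x. [x]) xs"
  by (simp_all add: numeral_eq_Suc) (induction xs; simp)

lemma covector_simps: "covector l [] = 0" "covector l [v] = l v" "covector l (v # w # vs) = 0"
  by (simp_all add: covector_def)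

lemma kform_wedge_eq: "kform k \<alpha> \<Longrightarrow> kform l \<beta> \<Longrightarrow> m = k + l \<Longrightarrow> kform m (\<alpha> \<^bold>\<and> \<beta> :: _ \<Rightarrow> real)"
  by (simp add: kform_wedge)

text \<open>The guard \<open>l v = 0\<close> is decided before \<open>\<alpha> vs\<close> is looked
  at, so vanishing branches are discarded unexpanded.\<close>

lemma covector_wedge_eval:
  "(covector l \<^bold>\<and> \<alpha>) (v # vs) = (if l v = 0 then 0 else l v * \<alpha> vs) - (covector l \<^bold>\<and> ins v \<alpha>) vs"
  by (simp add: covector_wedge_Cons)

lemma ewedge_Cons: "ewedge e (i # is) = covector (e i) \<^bold>\<and> ewedge e is"
  and ewedge_Nil: "ewedge e [] = wedge_one"
  by (simp_all add: ewedge_def)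

text \<open>The standard Kaehler form with complex lines (2, 3), (4, 5) and (6, 7); index 1 is kept
  for the remaining real direction.\<close>

definition model_omega :: "(nat \<Rightarrow> 'v \<Rightarrow> real) \<Rightarrow> 'v list \<Rightarrow> real" where
  "model_omega e = (\<lambda>vs. ewedge e [2, 3] vs + ewedge e [4, 5] vs + ewedge e [6, 7] vs)"

text \<open>Real and imaginary part of \<open>(e\<^sup>2 + i e\<^sup>3) \<and> (e\<^sup>4 + i e\<^sup>5) \<and> (e\<^sup>6 + i e\<^sup>7)\<close>.\<close>

definition model_psip :: "(nat \<Rightarrow> 'v \<Rightarrow> real) \<Rightarrow> 'v list \<Rightarrow> real" where
  "model_psip e = (\<lambda>vs. ewedge e [2, 4, 6] vs - ewedge e [2, 5, 7] vs - ewedge e [3, 4, 7] vs - ewedge e [3, 5, 6] vs)"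

definition model_psim :: "(nat \<Rightarrow> 'v \<Rightarrow> real) \<Rightarrow> 'v list \<Rightarrow> real" where
  "model_psim e = (\<lambda>vs. ewedge e [2, 4, 7] vs + ewedge e [2, 5, 6] vs + ewedge e [3, 4, 6] vs - ewedge e [3, 5, 7] vs)"

lemma g2_model_eq: "g2_model e = (\<lambda>vs. (covector (e 1) \<^bold>\<and> model_omega e) vs + model_psip e vs)"
  by (simp add: fun_eq_iff g2_model_def model_omega_def model_psip_def ewedge_Cons wedge_linear)

lemma ewedge_append: "ewedge e is \<^bold>\<and> ewedge e js = ewedge e (is @ js)"
  by (induction "is") (simp_all add: ewedge_Cons ewedge_Nil wedge_one_left wedge_assoc)

text \<open>Evaluation of \<open>ewedge e is\<close> on vectors \<open>b\<^sub>j\<close> of the dual frame with distinct indices \<open>j\<close>, reduced to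
  a computation with the indices.\<close>

fun dual_contract :: "nat \<Rightarrow> (nat list \<Rightarrow> real) \<Rightarrow> nat list \<Rightarrow> real" where
  "dual_contract i f [] = 0"
| "dual_contract i f (j # js) = (if i = j then f js else - dual_contract i (\<lambda>ks. f (j # ks)) js)"

fun ewedge_index :: "nat list \<Rightarrow> nat list \<Rightarrow> real" where
  "ewedge_index [] js = (if js = [] then 1 else 0)"
| "ewedge_index (i # is) js = dual_contract i (ewedge_index is) js"

lemma dual_contract_cong:
  "(\<And>ks. distinct ks \<Longrightarrow> set ks \<subseteq> set js \<Longrightarrow> f ks = g ks) \<Longrightarrow> distinct js \<Longrightarrow>
    dual_contract i f js = dual_contract i g js"
proof (induction js arbitrary: f g)
  case (Cons j js)
  have "dual_contract i (\<lambda>ks. f (j # ks)) js = dual_contract i (\<lambda>ks. g (j # ks)) js"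
    using Cons.prems by (intro Cons.IH Cons.prems(1)) auto
  moreover have "f js = g js" using Cons.prems by (intro Cons.prems(1)) auto
  ultimately show ?case by simp
qed simp

text \<open>Since the indices are distinct, the expansion can stop at the first match:
  \<open>e i\<close> vanishes on all later vectors.\<close>

lemma covector_wedge_dual_frame:
  assumes F: "dual_frame m e b" and i: "i \<in> {1..m}" and js: "set js \<subseteq> {1..m}" "distinct js"
  shows "(covector (e i) \<^bold>\<and> \<alpha>) (map b js) = dual_contract i (\<lambda>ks. \<alpha> (map b ks)) js"
proof -
  have e_b: "e i (b j) = (if i = j then 1 else 0)" if "j \<in> {1..m}" for j
    using F i that by (simp add: dual_frame_def)
  have z: "(covector (e i) \<^bold>\<and> \<alpha>) (map b js) = 0" if "i \<notin> set js" "set js \<subseteq> {1..m}" for js \<alpha>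
    using that by (induction js arbitrary: \<alpha>) (use e_b in \<open>auto simp: covector_simps covector_wedge_Cons\<close>)
  show ?thesis using js
  proof (induction js arbitrary: \<alpha>)
    case Nil then show ?case by (simp add: covector_simps)
  next
    case (Cons j js)
    then show ?case using z[of js] e_b[of j] by (auto simp: covector_wedge_Cons ins_def)
  qed
qed

lemma ewedge_dual_frame:
  assumes F: "dual_frame m e b" and "set is \<subseteq> {1..m}" "set js \<subseteq> {1..m}" "distinct js"
  shows "ewedge e is (map b js) = ewedge_index is js"
  using assms(2-)
proof (induction "is" arbitrary: js)
  case Nil then show ?case by (simp add: ewedge_Nil wedge_one_def)
next
  case (Cons i "is")
  have "ewedge e (i # is) (map b js) = dual_contract i (\<lambda>ks. ewedge e is (map b ks)) js"
    unfolding ewedge_Cons by (rule covector_wedge_dual_frame[OF F]) (use Cons.prems in auto)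
  also have "\<dots> = dual_contract i (ewedge_index is) js"
    by (rule dual_contract_cong) (use Cons in auto)
  finally show ?case by simp
qed

lemmas model_defs = model_omega_def model_psip_def model_psim_def

section \<open>Computations in a frame of the model form\<close>

locale g2_frame =
  fixes e :: "nat \<Rightarrow> 'v::euclidean_space \<Rightarrow> real" and b :: "nat \<Rightarrow> 'v"
  assumes frame: "dual_frame 7 e b"
begin

lemma e_linear: "i \<in> {1..7} \<Longrightarrow> linear (e i)"
  using frame by (simp add: dual_frame_def)

lemma e_b: "i \<in> {1..7} \<Longrightarrow> j \<in> {1..7} \<Longrightarrow> e i (b j) = (if i = j then 1 else 0)"
  using frame by (simp add: dual_frame_def)

lemma kform_ewedge_frame: "set is \<subseteq> {1..7} \<Longrightarrow> kform (length is) (ewedge e is)"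
  using e_linear by (intro kform_ewedge) auto

lemma kform_models: "kform 2 (model_omega e)" "kform 3 (model_psip e)" "kform 3 (model_psim e)" 
  "kform 3 (g2_model e)" "kform 7 (ewedge e [1, 2, 3, 4, 5, 6, 7])" "kform 1 (covector (e 1))"
proof -
  show o: "kform 2 (model_omega e)" and p: "kform 3 (model_psip e)" and "kform 3 (model_psim e)"
    unfolding model_defs
    using kform_ewedge_frame[of "[_, _]"] kform_ewedge_frame[of "[_, _, _]"]
    by (auto intro!: kform_add kform_diff simp: numeral_eq_Suc)
  show "kform 7 (ewedge e [1, 2, 3, 4, 5, 6, 7])"
    using kform_ewedge_frame[of "[1, 2, 3, 4, 5, 6, 7]"] by (simp add: numeral_eq_Suc)
  show c: "kform 1 (covector (e 1))" by (rule kform_covector) (simp add: e_linear)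
  show "kform 3 (g2_model e)" unfolding g2_model_eq
    by (intro kform_add kform_wedge_eq[OF c o] p) simp
qed

lemmas ewedge_frame = ewedge_dual_frame[OF frame]

text \<open>Two sets of evaluation rules: \<open>frame_eval\<close> expands covectors on frame
  vectors and also copes with unknown forms, while \<open>index_eval\<close> reduces products of
  basis monomials to a computation with indices.\<close>

lemmas frame_eval = covector_wedge_eval[where l = "e i" for i] covector_wedge_Nil covector_simps ins_def wedge_one_def e_b
  wedge_linear wedge_assoc wedge_one_left wedge_one_right ewedge_Cons ewedge_Nil

lemmas index_eval = ewedge_append ewedge_Cons[symmetric] wedge_linear ewedge_frame

lemma star_model:
  "hodge (frame_metric 7 e) (ewedge e [1, 2, 3, 4, 5, 6, 7]) (g2_model e)
    = (\<lambda>vs. 1 / 2 * (model_omega e \<^bold>\<and> model_omega e) vs - (covector (e 1) \<^bold>\<and> model_psim e) vs)"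
proof (rule kform_frame_eqI[OF frame])
  let ?\<mu> = "ewedge e [1, 2, 3, 4, 5, 6, 7]"
  show "kform 4 (hodge (frame_metric 7 e) ?\<mu> (g2_model e))"
    by (rule kform_hodge[OF inner_product_frame_metric[OF frame] orthonormal_frame_list[OF frame] kform_models(4)])
      (use kform_models(5) in simp)
  show "kform 4 (\<lambda>vs. 1 / 2 * (model_omega e \<^bold>\<and> model_omega e) vs - (covector (e 1) \<^bold>\<and> model_psim e) vs)"
    by (intro kform_diff kform_mult kform_wedge_eq[OF kform_models(1,1)] kform_wedge_eq[OF kform_models(6,3)]) simp_all
  fix "is" assume T: "is \<in> set (combs 4 [1..<Suc 7])"
  have "\<forall>is\<in>set (combs 4 [1..<Suc 7]). g2_model e (map b (filter (\<lambda>i. i \<notin> set is) [1..<Suc 7])) *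
    ?\<mu> (map b (filter (\<lambda>i. i \<notin> set is) [1..<Suc 7] @ is)) = 
    1 / 2 * (model_omega e \<^bold>\<and> model_omega e) (map b is) - (covector (e 1) \<^bold>\<and> model_psim e) (map b is)"
    unfolding upt_1_7 g2_model_eq model_defs
    by (simp add: combs_numeral index_eval del: One_nat_def list.map map_append)
  then show "hodge (frame_metric 7 e) ?\<mu> (g2_model e) (map b is) = 
    1 / 2 * (model_omega e \<^bold>\<and> model_omega e) (map b is) - (covector (e 1) \<^bold>\<and> model_psim e) (map b is)"
    using T by (simp only: hodge_frame[OF frame kform_models(4,5) T])
qed

text \<open>The form \<omega> has type (1, 1) and \<Psi> has type (3, 0), and there is nothing of
  type (4, 1) in complex dimension 3. The proof reads this off the 21 components.\<close>

lemma omega_wedge_psi: "model_omega e \<^bold>\<and> model_psip e = (\<lambda>_. 0)" "model_omega e \<^bold>\<and> model_psim e = (\<lambda>_. 0)"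
proof -
  have 1: "\<forall>is\<in>set (combs 5 [1..<Suc 7]). (model_omega e \<^bold>\<and> model_psip e) (map b is) = 0 \<and>
    (model_omega e \<^bold>\<and> model_psim e) (map b is) = 0"
    unfolding upt_1_7 model_defs
    by (simp add: combs_numeral index_eval del: One_nat_def list.map map_append)
  show "model_omega e \<^bold>\<and> model_psip e = (\<lambda>_. 0)"
    by (rule kform_frame_eqI[OF frame, of 5]) (use 1 in \<open>auto intro: kform_zero kform_wedge_eq[OF kform_models(1,2)]\<close>)
  show "model_omega e \<^bold>\<and> model_psim e = (\<lambda>_. 0)"
    by (rule kform_frame_eqI[OF frame, of 5]) (use 1 in \<open>auto intro: kform_zero kform_wedge_eq[OF kform_models(1,3)]\<close>)
qed

text \<open>The seven monomials of \<open>g2_model\<close> are orthonormal and have coefficients 1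
  or -1. The value 7 later excludes a rescaling of the metric.\<close>

lemma pairing_model: "pairing 3 (frame_list 7 b) (g2_model e) (g2_model e) = 7"
  unfolding frame_list_def upt_1_7 pairing_def combs_map g2_model_eq model_defs
  by (simp add: combs_numeral frame_eval del: One_nat_def)

lemma wedge_2_2:
  assumes "degree_form 2 (\<alpha> :: 'v list \<Rightarrow> real)"
  shows "(\<alpha> \<^bold>\<and> \<alpha>) [v1, v2, v3, v4] =
    2 * (\<alpha> [v1, v2] * \<alpha> [v3, v4] - \<alpha> [v1, v3] * \<alpha> [v2, v4] + \<alpha> [v1, v4] * \<alpha> [v2, v3])"
proof -
  have z: "\<alpha> [] = 0" "\<And>a. \<alpha> [a] = 0" "\<And>a b c. \<alpha> [a, b, c] = 0" "\<And>a b c d. \<alpha> [a, b, c, d] = 0"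
    using assms by (auto simp: degree_form_def)
  show ?thesis by (simp add: wedge_Cons ins_def grade_inv_def z)
qed

text \<open>Removes the guard of \<open>covector_wedge_eval\<close> where a covector meets the
  generic vector \<open>u\<close> and its vanishing cannot be decided.\<close>

lemma if_zero_mult: "(if x = 0 then 0 else x * y) = x * (y::real)"
  by simp

text \<open>Bryant's formula, which expresses the metric and the orientation through the 3-form
  alone.\<close>

lemma model_cubic:
  "g2_model e \<^bold>\<and> ins u (g2_model e) \<^bold>\<and> ins u (g2_model e)
    = (\<lambda>vs. 6 * frame_metric 7 e u u * ewedge e [1, 2, 3, 4, 5, 6, 7] vs)"
proof (rule kform_frame_eqI[OF frame])
  let ?\<alpha> = "ins u (g2_model e)"
  have \<alpha>: "kform 2 ?\<alpha>" using kform_models(4) by (intro kform_ins) (simp add: numeral_eq_Suc)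
  show "kform 7 (g2_model e \<^bold>\<and> ?\<alpha> \<^bold>\<and> ?\<alpha>)"
    by (rule kform_wedge_eq[OF kform_models(4) kform_wedge[OF \<alpha> \<alpha>]]) simp
  show "kform 7 (\<lambda>vs. 6 * frame_metric 7 e u u * ewedge e [1, 2, 3, 4, 5, 6, 7] vs)"
    by (rule kform_mult[OF kform_models(5)])
  fix "is" assume "is \<in> set (combs 7 [1..<Suc 7])"
  then have "is": "is = [1, 2, 3, 4, 5, 6, 7]" unfolding upt_1_7 by (simp add: combs_numeral del: One_nat_def)
  have m: "frame_metric 7 e u u = e 1 u * e 1 u + e 2 u * e 2 u + e 3 u * e 3 u + e 4 u * e 4 u
     + e 5 u * e 5 u + e 6 u * e 6 u + e 7 u * e 7 u"
    unfolding frame_metric_def by (simp add: numeral_eq_Suc)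
  \<comment> \<open>The 4-form stays opaque while the outer product is expanded, so that
    \<open>wedge_2_2\<close> meets only the components that survive.\<close>
  define X where "X = ?\<alpha> \<^bold>\<and> ?\<alpha>"
  have X: "X [v1, v2, v3, v4] = 2 * (g2_model e [u, v1, v2] * g2_model e [u, v3, v4] -
      g2_model e [u, v1, v3] * g2_model e [u, v2, v4] + g2_model e [u, v1, v4] * g2_model e [u, v2, v3])"
    for v1 v2 v3 v4
    unfolding X_def using wedge_2_2[of ?\<alpha>] \<alpha> by (simp add: kform_iff ins_def)
  have "(g2_model e \<^bold>\<and> X) (map b [1, 2, 3, 4, 5, 6, 7]) =
      6 * frame_metric 7 e u u * ewedge e [1, 2, 3, 4, 5, 6, 7] (map b [1, 2, 3, 4, 5, 6, 7])"
    unfolding m g2_model_eq model_defs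
    by (simp add: frame_eval del: One_nat_def)
      (simp add: X g2_model_eq model_defs frame_eval if_zero_mult del: One_nat_def)
  then show "(g2_model e \<^bold>\<and> ?\<alpha> \<^bold>\<and> ?\<alpha>) (map b is) =
      6 * frame_metric 7 e u u * ewedge e [1, 2, 3, 4, 5, 6, 7] (map b is)"
    unfolding "is" X_def .
qed

lemma vol_frame:
  assumes "T \<in> set (combs l [1..<Suc 7])"
  shows "ewedge e [1, 2, 3, 4, 5, 6, 7] (map b (filter (\<lambda>i. i \<notin> set T) [1..<Suc 7] @ T)) =
    ewedge_index [1, 2, 3, 4, 5, 6, 7] (filter (\<lambda>i. i \<notin> set T) [1..<Suc 7] @ T)"
  using combs_sorted[OF sorted_wrt_upt assms] combs_subset[OF assms]
  by (intro ewedge_frame) (auto simp: strict_sorted_iff)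

text \<open>Write \<gamma> as a primitive form \<gamma>' plus \<open>a \<and> \<omega>\<close>. The
  hypothesis \<open>lee\<close> says that \<open>t = 2 a\<close>, so the starred form is
  \<open>e 1\<close> times \<open>\<gamma>' - a \<and> \<omega>\<close>. The star of
  \<open>e 1\<close> times a form of the other six directions is the six-dimensional star, which is
  J on primitive 3-forms and -J on multiples of \<omega>; the result is J applied to \<gamma>. The
  proof itself compares the 35 components.\<close>

lemma star_torsion:
  assumes \<gamma>: "kform 3 \<gamma>" and t: "linear t" and \<gamma>1: "\<And>ws. \<gamma> (b 1 # ws) = 0" and t1: "t (b 1) = 0"
    and lee: "\<And>vs. 2 * (model_omega e \<^bold>\<and> \<gamma>) vs = (covector t \<^bold>\<and> model_omega e \<^bold>\<and> model_omega e) vs"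
    and L: "linear L" "L (b 1) = 0" "L (b 2) = b 3" "L (b 3) = - b 2" "L (b 4) = b 5" "L (b 5) = - b 4"
      "L (b 6) = b 7" "L (b 7) = - b 6"
  shows "hodge (frame_metric 7 e) (ewedge e [1, 2, 3, 4, 5, 6, 7])
      (covector (e 1) \<^bold>\<and> (\<lambda>vs. \<gamma> vs - (covector t \<^bold>\<and> model_omega e) vs)) = (\<lambda>vs. \<gamma> (map L vs))"
proof (rule kform_frame_eqI[OF frame])
  let ?\<mu> = "ewedge e [1, 2, 3, 4, 5, 6, 7]"
  let ?\<alpha> = "covector (e 1) \<^bold>\<and> (\<lambda>vs. \<gamma> vs - (covector t \<^bold>\<and> model_omega e) vs)"
  have k: "kform 3 (\<lambda>vs. \<gamma> vs - (covector t \<^bold>\<and> model_omega e) vs)"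
    by (intro kform_diff \<gamma> kform_wedge_eq[OF kform_covector[OF t] kform_models(1)]) simp
  have \<alpha>: "kform 4 ?\<alpha>" by (rule kform_wedge_eq[OF kform_models(6) k]) simp
  show "kform 3 (hodge (frame_metric 7 e) ?\<mu> ?\<alpha>)"
    by (rule kform_hodge[OF inner_product_frame_metric[OF frame] orthonormal_frame_list[OF frame] \<alpha>])
      (use kform_models(5) in simp)
  show "kform 3 (\<lambda>vs. \<gamma> (map L vs))" by (rule kform_map[OF \<gamma> L(1)])
  have m: "multi \<gamma>" using \<gamma> by (simp add: kform_iff)
  have neg: "\<gamma> [- x, y, z] = - \<gamma> [x, y, z]" "\<gamma> [x, - y, z] = - \<gamma> [x, y, z]" "\<gamma> [x, y, - z] = - \<gamma> [x, y, z]" for x y z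
    using linear_neg[OF multi_linear[OF m, of "[]"], of x "[y, z]"] linear_neg[OF multi_linear[OF m, of "[x]"], of y "[z]"]
      linear_neg[OF multi_linear[OF m, of "[x, y]"], of z "[]"] by simp_all
  have zero: "\<gamma> [0, y, z] = 0" for y z
    using linear_0[OF multi_linear[OF m, of "[]"], of "[y, z]"] by simp
  \<comment> \<open>The condition \<open>i < j\<close> orients these rules towards increasing
    indices, so that they terminate.\<close>
  have sort: "\<gamma> [b j, b i, z] = - \<gamma> [b i, b j, z]" "\<gamma> [z, b j, b i] = - \<gamma> [z, b i, b j]" if "i < j" for i j z
    using multi_swap[OF m, of "[]" "b j" "b i" "[z]"] multi_swap[OF m, of "[z]" "b j" "b i" "[]"] by simp_all
  note ev = covector_wedge_Cons[where l = t] frame_eval \<gamma>1 t1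
  \<comment> \<open>Among the indices 2 to 7, the five that omit the partner of \<open>i\<close> in
    its complex line isolate \<open>t (b i)\<close> in the Lee hypothesis.\<close>
  have lees: "t (b 2) = \<gamma> [b 2, b 4, b 5] + \<gamma> [b 2, b 6, b 7]" "t (b 3) = \<gamma> [b 3, b 4, b 5] + \<gamma> [b 3, b 6, b 7]"
    "t (b 4) = \<gamma> [b 2, b 3, b 4] + \<gamma> [b 4, b 6, b 7]" "t (b 5) = \<gamma> [b 2, b 3, b 5] + \<gamma> [b 5, b 6, b 7]"
    "t (b 6) = \<gamma> [b 2, b 3, b 6] + \<gamma> [b 4, b 5, b 6]" "t (b 7) = \<gamma> [b 2, b 3, b 7] + \<gamma> [b 4, b 5, b 7]"
    using lee[of "map b [2, 4, 5, 6, 7]"] lee[of "map b [3, 4, 5, 6, 7]"] lee[of "map b [2, 3, 4, 6, 7]"]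
      lee[of "map b [2, 3, 5, 6, 7]"] lee[of "map b [2, 3, 4, 5, 6]"] lee[of "map b [2, 3, 4, 5, 7]"]
    unfolding model_defs by (simp_all add: ev del: One_nat_def)
  fix "is" assume T: "is \<in> set (combs 3 [1..<Suc 7])"
  have "\<forall>is\<in>set (combs 3 [1..<Suc 7]). ?\<alpha> (map b (filter (\<lambda>i. i \<notin> set is) [1..<Suc 7])) *
    ewedge_index [1, 2, 3, 4, 5, 6, 7] (filter (\<lambda>i. i \<notin> set is) [1..<Suc 7] @ is) = \<gamma> (map L (map b is))"
    unfolding upt_1_7 model_defs
    by (simp add: combs_numeral ev L zero neg sort lees del: One_nat_def)
  then show "hodge (frame_metric 7 e) ?\<mu> ?\<alpha> (map b is) = \<gamma> (map L (map b is))"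
    using T by (simp only: hodge_frame[OF frame \<alpha> kform_models(5) T] vol_frame)
qed

end

section \<open>The exterior derivative in a chart\<close>

definition local_d :: "('e::euclidean_space \<Rightarrow> 'e list \<Rightarrow> 'b::real_normed_field) \<Rightarrow> 'e \<Rightarrow> 'e list \<Rightarrow> 'b" where
  "local_d F x vs = (\<Sum>i<length vs.
     (- 1) ^ i * frechet_derivative (\<lambda>y. F y (nths vs (- {i}))) (at x) (vs ! i))"

lemma ext_d_eq: "ext_d \<alpha> c x = local_d (\<alpha> c) x"
  by (simp add: fun_eq_iff ext_d_def local_d_def)

text \<open>Regularity is imposed on each coefficient function separately, so that no topology on
  the space of forms enters.\<close>

definition coeffs_diff :: "('e::real_normed_vector \<Rightarrow> 'v list \<Rightarrow> 'b::real_normed_vector) \<Rightarrow> 'e \<Rightarrow> bool" where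
  "coeffs_diff F x \<longleftrightarrow> (\<forall>vs. (\<lambda>y. F y vs) differentiable (at x))"

definition dir_deriv :: "('e::real_normed_vector \<Rightarrow> 'v list \<Rightarrow> 'b::real_normed_vector) \<Rightarrow> 'e \<Rightarrow> 'e \<Rightarrow> 'v list \<Rightarrow> 'b" where
  "dir_deriv F x h vs = frechet_derivative (\<lambda>y. F y vs) (at x) h"

lemma has_dir_deriv: "coeffs_diff F x \<Longrightarrow> ((\<lambda>y. F y vs) has_derivative (\<lambda>h. dir_deriv F x h vs)) (at x)"
  unfolding coeffs_diff_def dir_deriv_def by (metis frechet_derivative_works)

lemma dir_derivI: "((\<lambda>y. F y vs) has_derivative D) (at x) \<Longrightarrow> dir_deriv F x h vs = D h"
  unfolding dir_deriv_def by (metis frechet_derivative_at)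

lemma coeffs_diffI: "(\<And>vs. ((\<lambda>y. F y vs) has_derivative D vs) (at x)) \<Longrightarrow> coeffs_diff F x"
  unfolding coeffs_diff_def differentiable_def by blast

lemma local_d_Nil [simp]: "local_d F x [] = 0"
  by (simp add: local_d_def)

lemma local_d_Cons: "local_d F x (v # vs) = dir_deriv F x v vs - local_d (\<lambda>y. ins v (F y)) x vs"
proof -
  have 1: "nths (v # vs) (- {0}) = vs"
  proof -
    have "{j. Suc j \<in> - {0}} = UNIV" by auto
    then show ?thesis by (simp add: nths_Cons nths_all)
  qed
  have 2: "nths (v # vs) (- {Suc i}) = v # nths vs (- {i})" for i
  proof -
    have "{j. Suc j \<in> - {Suc i}} = - {i}" by auto
    then show ?thesis by (simp add: nths_Cons)
  qed
  show ?thesis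
    unfolding local_d_def length_Cons sum.lessThan_Suc_shift 1 2
    by (simp add: 1 2 ins_def dir_deriv_def sum_negf)
qed

lemma coeffs_diff_ins: "coeffs_diff F x \<Longrightarrow> coeffs_diff (\<lambda>y. ins v (F y)) x"
  by (simp add: coeffs_diff_def ins_def)

lemma dir_deriv_ins: "dir_deriv (\<lambda>y. ins v (F y)) x h = ins v (dir_deriv F x h)"
  by (simp add: dir_deriv_def ins_def fun_eq_iff)

lemma coeffs_diff_simps:
  fixes F G :: "'e::real_normed_vector \<Rightarrow> 'v list \<Rightarrow> real"
  assumes "coeffs_diff F x"
  shows "coeffs_diff G x \<Longrightarrow> coeffs_diff (\<lambda>y vs. F y vs + G y vs) x"
    "coeffs_diff G x \<Longrightarrow> coeffs_diff (\<lambda>y vs. F y vs - G y vs) x"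
    "coeffs_diff (\<lambda>y vs. c * F y vs) x" "coeffs_diff (\<lambda>y vs. - F y vs) x"
    "coeffs_diff (\<lambda>y. grade_inv (F y)) x"
  using assms unfolding coeffs_diff_def grade_inv_def by (auto intro!: derivative_intros)

lemma dir_deriv_simps:
  fixes F G :: "'e::real_normed_vector \<Rightarrow> 'v list \<Rightarrow> real"
  assumes "coeffs_diff F x"
  shows "coeffs_diff G x \<Longrightarrow> dir_deriv (\<lambda>y vs. F y vs + G y vs) x h vs = dir_deriv F x h vs + dir_deriv G x h vs"
    "coeffs_diff G x \<Longrightarrow> dir_deriv (\<lambda>y vs. F y vs - G y vs) x h vs = dir_deriv F x h vs - dir_deriv G x h vs"
    "dir_deriv (\<lambda>y vs. c * F y vs) x h vs = c * dir_deriv F x h vs"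
    "dir_deriv (\<lambda>y vs. - F y vs) x h vs = - dir_deriv F x h vs"
    "dir_deriv (\<lambda>y. grade_inv (F y)) x h vs = grade_inv (dir_deriv F x h) vs"
  unfolding grade_inv_def
  by (rule dir_derivI, (rule has_derivative_add has_derivative_diff has_derivative_mult_right has_derivative_minus)?;
      (rule has_dir_deriv)?; (rule assms | assumption))+

lemma coeffs_diff_const: "coeffs_diff (\<lambda>y. \<alpha>) x"
  by (simp add: coeffs_diff_def)

lemma ins_pointwise:
  "ins v (\<lambda>ws. \<alpha> ws + \<beta> ws) = (\<lambda>ws. ins v \<alpha> ws + ins v \<beta> ws)"
  "ins v (\<lambda>ws. \<alpha> ws - \<beta> ws) = (\<lambda>ws. ins v \<alpha> ws - ins v \<beta> ws)"
  "ins v (\<lambda>ws. c * \<alpha> ws) = (\<lambda>ws. c * ins v \<alpha> ws)"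
  "ins v (\<lambda>ws. - \<alpha> ws) = (\<lambda>ws. - ins v \<alpha> ws)"
  "ins v (\<lambda>ws. 0) = (\<lambda>ws. 0)"
  by (auto simp: ins_def)

lemma local_d_simps:
  fixes F G :: "'e::euclidean_space \<Rightarrow> 'e list \<Rightarrow> real"
  assumes "coeffs_diff F x"
  shows "coeffs_diff G x \<Longrightarrow> local_d (\<lambda>y vs. F y vs + G y vs) x vs = local_d F x vs + local_d G x vs"
    "coeffs_diff G x \<Longrightarrow> local_d (\<lambda>y vs. F y vs - G y vs) x vs = local_d F x vs - local_d G x vs"
    "local_d (\<lambda>y vs. c * F y vs) x vs = c * local_d F x vs"
    "local_d (\<lambda>y vs. - F y vs) x vs = - local_d F x vs"
    "local_d (\<lambda>y. grade_inv (F y)) x vs = - grade_inv (local_d F x) vs"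
proof -
  show "local_d (\<lambda>y vs. F y vs + G y vs) x vs = local_d F x vs + local_d G x vs" if "coeffs_diff G x"
    using assms that by (induction vs arbitrary: F G) (simp_all add: local_d_Cons dir_deriv_simps coeffs_diff_ins ins_pointwise)
  show "local_d (\<lambda>y vs. F y vs - G y vs) x vs = local_d F x vs - local_d G x vs" if "coeffs_diff G x"
    using assms that by (induction vs arbitrary: F G) (simp_all add: local_d_Cons dir_deriv_simps coeffs_diff_ins ins_pointwise)
  show "local_d (\<lambda>y vs. c * F y vs) x vs = c * local_d F x vs"
    using assms by (induction vs arbitrary: F) (simp_all add: local_d_Cons dir_deriv_simps coeffs_diff_ins ins_pointwise algebra_simps)
  have neg: "local_d (\<lambda>y vs. - F y vs) x vs = - local_d F x vs" if "coeffs_diff F x"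
    for F :: "'e \<Rightarrow> 'e list \<Rightarrow> real" and vs
    using that by (induction vs arbitrary: F) (simp_all add: local_d_Cons dir_deriv_simps coeffs_diff_ins ins_pointwise)
  show "local_d (\<lambda>y vs. - F y vs) x vs = - local_d F x vs" by (rule neg[OF assms])
  \<comment> \<open>The derivative takes one argument more than the form, whence the sign.\<close>
  show "local_d (\<lambda>y. grade_inv (F y)) x vs = - grade_inv (local_d F x) vs"
    using assms(1)
  proof (induction vs arbitrary: F)
    case Nil show ?case by (simp add: grade_inv_def)
  next
    case (Cons v vs)
    have "local_d (\<lambda>y. ins v (grade_inv (F y))) x vs = - local_d (\<lambda>y. grade_inv (ins v (F y))) x vs"
      unfolding ins_grade_inv using Cons.prems by (intro neg coeffs_diff_simps coeffs_diff_ins)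
    then show ?case using Cons
      by (simp add: local_d_Cons dir_deriv_simps coeffs_diff_ins) (simp add: grade_inv_def local_d_Cons algebra_simps)
  qed
qed

lemma local_d_const: "local_d (\<lambda>y. \<alpha>) x = (\<lambda>_. 0 :: 'b::real_normed_field)"
  by (simp add: local_d_def fun_eq_iff)

lemma has_derivative_wedge:
  fixes F G :: "'e::real_normed_vector \<Rightarrow> 'v list \<Rightarrow> real"
  assumes "coeffs_diff F x" "coeffs_diff G x"
  shows "((\<lambda>y. (F y \<^bold>\<and> G y) vs) has_derivative
    (\<lambda>h. (dir_deriv F x h \<^bold>\<and> G x) vs + (F x \<^bold>\<and> dir_deriv G x h) vs)) (at x)"
  using assms
proof (induction vs arbitrary: F G)
  case Nil
  show ?case using has_derivative_mult[OF has_dir_deriv[OF Nil(1), of "[]"] has_dir_deriv[OF Nil(2), of "[]"]]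
    by (simp add: add.commute)
next
  case (Cons v vs)
  note prems = Cons.prems coeffs_diff_ins[OF Cons.prems(1), of v] coeffs_diff_ins[OF Cons.prems(2), of v]
    coeffs_diff_simps(5)[OF Cons.prems(1)]
  have g: "dir_deriv (\<lambda>y. grade_inv (F y)) x h = grade_inv (dir_deriv F x h)" for h
    by (rule ext) (rule dir_deriv_simps(5)[OF Cons.prems(1)])
  show ?case
    using has_derivative_add[OF Cons.IH[OF prems(3,2)] Cons.IH[OF prems(5,4)]]
    by (simp add: wedge_Cons dir_deriv_ins g algebra_simps)
qed

lemma coeffs_diff_wedge:
  fixes F G :: "'e::real_normed_vector \<Rightarrow> 'v list \<Rightarrow> real"
  shows "coeffs_diff F x \<Longrightarrow> coeffs_diff G x \<Longrightarrow> coeffs_diff (\<lambda>y. F y \<^bold>\<and> G y) x"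
  by (rule coeffs_diffI, rule has_derivative_wedge)

lemma local_d_wedge:
  fixes F G :: "'e::euclidean_space \<Rightarrow> 'e list \<Rightarrow> real"
  assumes "coeffs_diff F x" "coeffs_diff G x"
  shows "local_d (\<lambda>y. F y \<^bold>\<and> G y) x vs = (local_d F x \<^bold>\<and> G x) vs + (grade_inv (F x) \<^bold>\<and> local_d G x) vs"
  using assms
proof (induction vs arbitrary: F G)
  case (Cons v vs)
  note p = Cons.prems coeffs_diff_ins[OF Cons.prems(1), of v] coeffs_diff_ins[OF Cons.prems(2), of v]
    coeffs_diff_simps(5)[OF Cons.prems(1)]
  have "local_d (\<lambda>y. ins v (F y \<^bold>\<and> G y)) x vs = 
     local_d (\<lambda>y. ins v (F y) \<^bold>\<and> G y) x vs + local_d (\<lambda>y. grade_inv (F y) \<^bold>\<and> ins v (G y)) x vs"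
    unfolding ins_wedge by (intro local_d_simps coeffs_diff_wedge p)
  also have "\<dots> = (local_d (\<lambda>y. ins v (F y)) x \<^bold>\<and> G x) vs + (grade_inv (ins v (F x)) \<^bold>\<and> local_d G x) vs
     + (local_d (\<lambda>y. grade_inv (F y)) x \<^bold>\<and> ins v (G x)) vs + (F x \<^bold>\<and> local_d (\<lambda>y. ins v (G y)) x) vs"
    using Cons.IH[OF p(3,2)] Cons.IH[OF p(5,4)] by simp
  also have "local_d (\<lambda>y. grade_inv (F y)) x = (\<lambda>vs. - grade_inv (local_d F x) vs)"
    by (rule ext) (rule local_d_simps(5)[OF p(1)])
  finally have 1: "local_d (\<lambda>y. ins v (F y \<^bold>\<and> G y)) x vs =
     (local_d (\<lambda>y. ins v (F y)) x \<^bold>\<and> G x) vs + (grade_inv (ins v (F x)) \<^bold>\<and> local_d G x) vs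
     + ((\<lambda>vs. - grade_inv (local_d F x) vs) \<^bold>\<and> ins v (G x)) vs + (F x \<^bold>\<and> local_d (\<lambda>y. ins v (G y)) x) vs" .
  have 2: "dir_deriv (\<lambda>y. F y \<^bold>\<and> G y) x v vs = (dir_deriv F x v \<^bold>\<and> G x) vs + (F x \<^bold>\<and> dir_deriv G x v) vs"
    by (rule dir_derivI[OF has_derivative_wedge[OF p(1,2)]])
  have 3: "ins v (local_d H x) = (\<lambda>vs. dir_deriv H x v vs - local_d (\<lambda>y. ins v (H y)) x vs)" for H :: "'e \<Rightarrow> 'e list \<Rightarrow> real"
    by (simp add: ins_def local_d_Cons fun_eq_iff)
  show ?case
    unfolding local_d_Cons[of "\<lambda>y. F y \<^bold>\<and> G y"] 1 2 wedge_Cons[of _ _ v] 3 ins_grade_inv wedge_linear grade_inv_grade_inv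
    by simp
qed simp

lemma frechet_derivative_cong_open:
  assumes "open U" "x \<in> U" "\<And>y. y \<in> U \<Longrightarrow> f y = g y"
  shows "frechet_derivative f (at x) = frechet_derivative g (at x)"
proof -
  have "(f has_derivative D) (at x) \<longleftrightarrow> (g has_derivative D) (at x)" for D
    using has_derivative_transform_within_open[OF _ assms(1,2), of f D UNIV g]
      has_derivative_transform_within_open[OF _ assms(1,2), of g D UNIV f] assms(3) by auto
  then show ?thesis by (simp add: frechet_derivative_def)
qed

lemma local_d_cong:
  assumes "open U" "x \<in> U" "\<And>y. y \<in> U \<Longrightarrow> F y = G y"
  shows "local_d F x = local_d G x"
proof -
  have "frechet_derivative (\<lambda>y. F y ws) (at x) = frechet_derivative (\<lambda>y. G y ws) (at x)" for ws
    by (rule frechet_derivative_cong_open[OF assms(1,2)]) (simp add: assms(3))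
  then show ?thesis by (simp add: local_d_def fun_eq_iff)
qed

lemma coeffs_diff_cong:
  assumes "open U" "x \<in> U" "\<And>y. y \<in> U \<Longrightarrow> F y = G y" "coeffs_diff F x"
  shows "coeffs_diff G x"
proof (rule coeffs_diffI)
  fix vs show "((\<lambda>y. G y vs) has_derivative (\<lambda>h. dir_deriv F x h vs)) (at x)"
    by (rule has_derivative_transform_within_open[OF has_dir_deriv[OF assms(4)] assms(1,2)]) (simp add: assms(3))
qed

lemma local_d_fst:
  fixes F :: "'e::euclidean_space \<Rightarrow> 'e list \<Rightarrow> 'b::real_normed_field"
  assumes "coeffs_diff F (fst z)"
  shows "local_d (\<lambda>y vs. F (fst y) (map fst vs)) (z :: 'e \<times> 'f::euclidean_space) vs = local_d F (fst z) (map fst vs)"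
    and "coeffs_diff (\<lambda>y vs. F (fst y) (map fst vs)) (z :: 'e \<times> 'f::euclidean_space)"
proof -
  have d: "((\<lambda>y. F (fst y) ws) has_derivative (\<lambda>h. dir_deriv F (fst z) (fst h) ws)) (at z)" for ws
    using has_derivative_compose[OF has_derivative_fst[OF has_derivative_ident] has_dir_deriv[OF assms, of ws], of UNIV] .
  have "frechet_derivative (\<lambda>y. F (fst y) ws) (at z) = (\<lambda>h. dir_deriv F (fst z) (fst h) ws)" for ws
    using frechet_derivative_at[OF d] by simp
  then show "local_d (\<lambda>y vs. F (fst y) (map fst vs)) z vs = local_d F (fst z) (map fst vs)"
    by (simp add: local_d_def nths_map dir_deriv_def)
  show "coeffs_diff (\<lambda>y vs. F (fst y) (map fst vs)) z"
    by (rule coeffs_diffI) (rule d)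
qed

section \<open>The exterior derivative of a form is a form\<close>

lemma multi_local_d_global:
  fixes F :: "'e::euclidean_space \<Rightarrow> 'e list \<Rightarrow> real"
  assumes "coeffs_diff F x" "\<And>y. multi (F y)"
  shows "multi (local_d F x)"
proof -
  have lin: "linear (\<lambda>h. dir_deriv F x h vs)" if "coeffs_diff F x" for vs and F :: "'e \<Rightarrow> 'e list \<Rightarrow> real"
    using has_derivative_linear[OF has_dir_deriv[OF that]] .
  have lin2: "linear (\<lambda>v. dir_deriv F x u (us @ v # ws))" if "coeffs_diff F x" "\<And>y. multi (F y)" for u us ws
    and F :: "'e \<Rightarrow> 'e list \<Rightarrow> real"
  proof (rule linearI)
    fix a c show "dir_deriv F x u (us @ (a + c) # ws) = dir_deriv F x u (us @ a # ws) + dir_deriv F x u (us @ c # ws)"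
      by (rule dir_derivI) (simp add: multi_args_add[OF that(2)] has_derivative_add has_dir_deriv that(1))
    fix r show "dir_deriv F x u (us @ (r *\<^sub>R a) # ws) = r *\<^sub>R dir_deriv F x u (us @ a # ws)"
      by (rule dir_derivI) (simp add: multi_args_scale[OF that(2)] has_derivative_mult_right has_dir_deriv that(1))
  qed
  have z: "local_d (\<lambda>y vs. 0) x vs = (0::real)" for vs by (simp add: local_d_const)
  have lin3: "linear (\<lambda>v. local_d (\<lambda>y. ins v (F y)) x vs)" if "coeffs_diff F x" "\<And>y. multi (F y)" for vs
    and F :: "'e \<Rightarrow> 'e list \<Rightarrow> real"
    by (rule linearI) (simp_all add: ins_linear[OF that(2)] local_d_simps coeffs_diff_ins that(1))
  have "linear (\<lambda>v. local_d F x (us @ v # ws))" for us ws using assms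
  proof (induction us arbitrary: F)
    case Nil
    then show ?case by (simp add: local_d_Cons linear_compose_sub lin lin3)
  next
    case (Cons u us)
    then show ?case by (simp add: local_d_Cons linear_compose_sub lin2 multi_ins coeffs_diff_ins)
  qed
  moreover have "local_d F x (us @ v # v # ws) = 0" for us v ws using assms
  proof (induction us arbitrary: F)
    case Nil
    \<comment> \<open>Two terms are the derivative of \<open>F\<close> on \<open>v # ws\<close> in
      direction \<open>v\<close>, with opposite signs; what remains is a double contraction.\<close>
    have "ins v (ins v (F y)) = (\<lambda>_. 0)" for y by (rule multi_ins_ins(1)[OF Nil(2)])
    then show ?case by (simp add: local_d_Cons dir_deriv_ins z) (simp add: ins_def)
  next
    case (Cons u us)
    have "F y (us @ v # v # ws) = 0" for y by (rule multi_rep[OF Cons.prems(2)])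
    then have "dir_deriv F x u (us @ v # v # ws) = 0" by (simp add: dir_deriv_def)
    then show ?case using Cons by (simp add: local_d_Cons multi_ins coeffs_diff_ins)
  qed
  ultimately show ?thesis by (simp add: multi_def)
qed

lemma kform_local_d:
  fixes F :: "'e::euclidean_space \<Rightarrow> 'e list \<Rightarrow> real"
  assumes U: "open U" "x \<in> U" and F: "\<And>y. y \<in> U \<Longrightarrow> kform k (F y)" and diff: "coeffs_diff F x"
  shows "kform (Suc k) (local_d F x)"
proof -
  \<comment> \<open>The preceding lemma wants forms at every point. Extension by zero supplies them,
    and the derivative at \<open>x\<close> sees only \<open>U\<close>.\<close>
  define G where "G y = (if y \<in> U then F y else (\<lambda>_. 0))" for y
  have eq: "F y = G y" if "y \<in> U" for y using that by (simp add: G_def)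
  have k: "kform k (G y)" for y by (simp add: G_def F kform_zero)
  have d: "coeffs_diff G x" by (rule coeffs_diff_cong[OF U eq diff])
  have z: "G y ws = 0" if "length ws \<noteq> k" for y ws using kform_degree[OF k that] .
  have "local_d G x vs = 0" if "length vs \<noteq> Suc k" for vs
  proof -
    have "length (nths vs (- {i})) \<noteq> k" if "i < length vs" for i
    proof -
      have "{j. j < length vs \<and> j \<in> - {i}} = {..<length vs} - {i}" by auto
      then have "length (nths vs (- {i})) = length vs - 1" using that by (simp add: length_nths)
      then show ?thesis using \<open>length vs \<noteq> Suc k\<close> that by auto
    qed
    then show ?thesis by (simp add: local_d_def z)
  qed
  then have "kform (Suc k) (local_d G x)"
    using multi_local_d_global[OF d] k by (simp add: kform_iff degree_form_def)
  then show ?thesis using local_d_cong[OF U eq] by simp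
qed


section \<open>Smooth functions on open sets\<close>

lemma Ck_on_cong:
  assumes "open S" "\<And>x. x \<in> S \<Longrightarrow> f x = g x" "Ck_on k S f"
  shows "Ck_on k S g"
  using assms
proof (induction k arbitrary: f g)
  case 0
  then show ?case by (auto cong: continuous_on_cong)
next
  case (Suc k)
  have "g differentiable (at x)" if "x \<in> S" for x
  proof -
    obtain D where "(f has_derivative D) (at x)" using Suc.prems(3) \<open>x \<in> S\<close> by (auto simp: differentiable_def)
    then have "(g has_derivative D) (at x)"
      by (rule has_derivative_transform_within_open[OF _ Suc.prems(1) that]) (rule Suc.prems(2))
    then show ?thesis by (auto simp: differentiable_def)
  qed
  moreover have "Ck_on k S (\<lambda>x. frechet_derivative g (at x) v)" for v
  proof (rule Suc.IH[OF Suc.prems(1)])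
    show "frechet_derivative f (at x) v = frechet_derivative g (at x) v" if "x \<in> S" for x
      by (rule fun_cong[OF frechet_derivative_cong_open[OF Suc.prems(1) that Suc.prems(2)]])
    show "Ck_on k S (\<lambda>x. frechet_derivative f (at x) v)" using Suc.prems(3) by simp
  qed
  ultimately show ?case by simp
qed

text \<open>Passes from an explicit derivative \<open>D\<close>, as the differentiation rules
  produce it, to the \<open>frechet_derivative\<close> in the definition of
  \<open>Ck_on\<close>.\<close>

lemma Ck_on_SucI:
  assumes "open S" "\<And>x. x \<in> S \<Longrightarrow> (f has_derivative D x) (at x)" "\<And>v. Ck_on k S (\<lambda>x. D x v)"
  shows "Ck_on (Suc k) S f"
proof -
  have "frechet_derivative f (at x) = D x" if "x \<in> S" for x
    using frechet_derivative_at[OF assms(2)[OF that]] by simp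
  then have "Ck_on k S (\<lambda>x. frechet_derivative f (at x) v)" for v
    by (intro Ck_on_cong[OF assms(1) _ assms(3)[of v]]) simp
  then show ?thesis using assms(2) by (auto simp: differentiable_def)
qed

lemma Ck_on_SucD:
  "Ck_on (Suc k) S f \<Longrightarrow> x \<in> S \<Longrightarrow> (f has_derivative frechet_derivative f (at x)) (at x)"
  by (auto simp: frechet_derivative_works[symmetric])

lemma Ck_on_continuous: "Ck_on k S f \<Longrightarrow> continuous_on S f"
  by (cases k) (auto intro!: continuous_at_imp_continuous_on differentiable_imp_continuous_within)

lemma Ck_on_lower: "Ck_on (Suc k) S f \<Longrightarrow> Ck_on k S f"
proof (induction k arbitrary: f)
  case 0 then show ?case using Ck_on_continuous[of "Suc 0"] by simp
next
  case (Suc k)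
  then show ?case by (auto simp del: Ck_on.simps(2) simp: Ck_on.simps(2)[of "Suc k"] Ck_on.simps(2)[of k])
qed

lemma Ck_on_const: "Ck_on k S (\<lambda>x. c)"
  by (induction k arbitrary: c) auto

lemma Ck_on_add: "open S \<Longrightarrow> Ck_on k S f \<Longrightarrow> Ck_on k S g \<Longrightarrow> Ck_on k S (\<lambda>x. f x + g x)"
proof (induction k arbitrary: f g)
  case 0 then show ?case by (auto intro: continuous_on_add)
next
  case (Suc k)
  show ?case
    by (rule Ck_on_SucI[OF Suc.prems(1) has_derivative_add[OF Ck_on_SucD[OF Suc.prems(2)] Ck_on_SucD[OF Suc.prems(3)]]])
      (use Suc in auto)
qed

lemma Ck_on_bounded_linear: "bounded_linear L \<Longrightarrow> open S \<Longrightarrow> Ck_on k S f \<Longrightarrow> Ck_on k S (\<lambda>x. L (f x))"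
proof (induction k arbitrary: f)
  case 0 then show ?case by (auto intro: bounded_linear.continuous_on)
next
  case (Suc k)
  show ?case
    by (rule Ck_on_SucI[OF Suc.prems(2) bounded_linear.has_derivative[OF Suc.prems(1) Ck_on_SucD[OF Suc.prems(3)]]])
      (use Suc in auto)
qed

lemma Ck_on_mult:
  fixes f g :: "'e::euclidean_space \<Rightarrow> real"
  shows "open S \<Longrightarrow> Ck_on k S f \<Longrightarrow> Ck_on k S g \<Longrightarrow> Ck_on k S (\<lambda>x. f x * g x)"
proof (induction k arbitrary: f g)
  case 0 then show ?case by (auto intro: continuous_on_mult)
next
  case (Suc k)
  show ?case
    by (rule Ck_on_SucI[OF Suc.prems(1) has_derivative_mult[OF Ck_on_SucD[OF Suc.prems(2)] Ck_on_SucD[OF Suc.prems(3)]]])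
      (use Suc.prems Ck_on_lower[of k S f] Ck_on_lower[of k S g] in \<open>auto intro!: Ck_on_add Suc.IH\<close>)
qed

lemma Ck_on_inverse:
  fixes f :: "'e::euclidean_space \<Rightarrow> real"
  shows "open S \<Longrightarrow> (\<And>x. x \<in> S \<Longrightarrow> f x \<noteq> 0) \<Longrightarrow> Ck_on k S f \<Longrightarrow> Ck_on k S (\<lambda>x. inverse (f x))"
proof (induction k arbitrary: f)
  case 0 then show ?case by (auto intro: continuous_on_inverse)
next
  case (Suc k)
  \<comment> \<open>The derivative of \<open>1 / f\<close> contains \<open>1 / f\<close> again, but
    one order lower, where the induction hypothesis applies.\<close>
  have i: "Ck_on k S (\<lambda>x. inverse (f x))" using Suc.prems Ck_on_lower by (intro Suc.IH) auto
  have "Ck_on k S (\<lambda>x. (-1) * (inverse (f x) * frechet_derivative f (at x) v * inverse (f x)))" for v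
    using Suc.prems i by (intro Ck_on_mult Ck_on_const) auto
  then show ?case
    by (intro Ck_on_SucI[OF Suc.prems(1) Deriv.has_derivative_inverse[OF Suc.prems(2) Ck_on_SucD[OF Suc.prems(3)]]]) simp_all
qed

lemma Ck_on_fst:
  "open S \<Longrightarrow> Ck_on k S f \<Longrightarrow> Ck_on k (S \<times> (UNIV :: 'f::euclidean_space set)) (\<lambda>z. f (fst z))"
proof (induction k arbitrary: f)
  case 0 then show ?case by (auto intro!: continuous_intros elim: continuous_on_compose2)
next
  case (Suc k)
  have d: "((\<lambda>z. f (fst z)) has_derivative (\<lambda>h. frechet_derivative f (at (fst z)) (fst h))) (at z)"
    if "z \<in> S \<times> UNIV" for z :: "'a \<times> 'f"
    using has_derivative_compose[OF has_derivative_fst[OF has_derivative_ident] Ck_on_SucD[OF Suc.prems(2)], of z UNIV] that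
    by auto
  show ?case
    by (rule Ck_on_SucI[OF open_Times[OF Suc.prems(1) open_UNIV] d]) (use Suc in auto)
qed

lemma smooth_on_cong: "open S \<Longrightarrow> (\<And>x. x \<in> S \<Longrightarrow> f x = g x) \<Longrightarrow> smooth_on S f \<Longrightarrow> smooth_on S g"
  unfolding smooth_on_def using Ck_on_cong by blast

lemma smooth_on_const: "smooth_on S (\<lambda>x. c)"
  by (simp add: smooth_on_def Ck_on_const)

lemma smooth_on_add: "open S \<Longrightarrow> smooth_on S f \<Longrightarrow> smooth_on S g \<Longrightarrow> smooth_on S (\<lambda>x. f x + g x)"
  by (simp add: smooth_on_def Ck_on_add)

lemma smooth_on_bounded_linear: "bounded_linear L \<Longrightarrow> open S \<Longrightarrow> smooth_on S f \<Longrightarrow> smooth_on S (\<lambda>x. L (f x))"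
  by (simp add: smooth_on_def Ck_on_bounded_linear)

lemma smooth_on_mult:
  fixes f g :: "'e::euclidean_space \<Rightarrow> real"
  shows "open S \<Longrightarrow> smooth_on S f \<Longrightarrow> smooth_on S g \<Longrightarrow> smooth_on S (\<lambda>x. f x * g x)"
  by (simp add: smooth_on_def Ck_on_mult)

lemma smooth_on_minus: "open S \<Longrightarrow> smooth_on S f \<Longrightarrow> smooth_on S (\<lambda>x. - f x)"
  by (rule smooth_on_bounded_linear[OF bounded_linear_minus[OF bounded_linear_ident]])

lemma smooth_on_diff: "open S \<Longrightarrow> smooth_on S f \<Longrightarrow> smooth_on S g \<Longrightarrow> smooth_on S (\<lambda>x. f x - g x)"
  using smooth_on_add[of S f "\<lambda>x. - g x"] smooth_on_minus by auto

lemma smooth_on_inverse: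
  fixes f :: "'e::euclidean_space \<Rightarrow> real"
  shows "open S \<Longrightarrow> (\<And>x. x \<in> S \<Longrightarrow> f x \<noteq> 0) \<Longrightarrow> smooth_on S f \<Longrightarrow> smooth_on S (\<lambda>x. inverse (f x))"
  by (simp add: smooth_on_def Ck_on_inverse)

lemma smooth_on_fst:
  "open S \<Longrightarrow> smooth_on S f \<Longrightarrow> smooth_on (S \<times> (UNIV :: 'f::euclidean_space set)) (\<lambda>z. f (fst z))"
  by (simp add: smooth_on_def Ck_on_fst)

lemma smooth_on_sum:
  "open S \<Longrightarrow> (\<And>i. i \<in> I \<Longrightarrow> smooth_on S (f i)) \<Longrightarrow> smooth_on S (\<lambda>x. \<Sum>i\<in>I. f i x)"
  by (induction I rule: infinite_finite_induct) (auto intro: smooth_on_const smooth_on_add)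

lemma smooth_on_has_derivative:
  "smooth_on S f \<Longrightarrow> x \<in> S \<Longrightarrow> (f has_derivative frechet_derivative f (at x)) (at x)"
  unfolding smooth_on_def using Ck_on_SucD by blast

lemma smooth_on_derivative: "smooth_on S f \<Longrightarrow> smooth_on S (\<lambda>x. frechet_derivative f (at x) v)"
  unfolding smooth_on_def using Ck_on.simps(2) by blast

definition coeffs_smooth :: "'e::euclidean_space set \<Rightarrow> ('e \<Rightarrow> 'v list \<Rightarrow> 'b::real_normed_vector) \<Rightarrow> bool" where
  "coeffs_smooth S F \<longleftrightarrow> (\<forall>vs. smooth_on S (\<lambda>x. F x vs))"

lemma coeffs_smooth_diff: "coeffs_smooth S F \<Longrightarrow> x \<in> S \<Longrightarrow> coeffs_diff F x"
  unfolding coeffs_smooth_def by (intro coeffs_diffI) (auto intro: smooth_on_has_derivative)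

lemma coeffs_smooth_wedge:
  fixes F G :: "'e::euclidean_space \<Rightarrow> 'v list \<Rightarrow> real"
  assumes "open S" "coeffs_smooth S F" "coeffs_smooth S G"
  shows "coeffs_smooth S (\<lambda>x. F x \<^bold>\<and> G x)"
  using assms unfolding coeffs_smooth_def wedge_def
  by (auto intro!: smooth_on_sum smooth_on_mult smooth_on_const)

lemma coeffs_smooth_local_d:
  fixes F :: "'e::euclidean_space \<Rightarrow> 'e list \<Rightarrow> real"
  assumes "open S" "coeffs_smooth S F"
  shows "coeffs_smooth S (local_d F)"
  using assms unfolding coeffs_smooth_def local_d_def
  by (auto intro!: smooth_on_sum smooth_on_mult smooth_on_const smooth_on_derivative)

section \<open>Naturality of the exterior derivative on 2-forms\<close>

lemma line_derivative:
  assumes "(f has_derivative f') (at (a + s *\<^sub>R u))"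
  shows "((\<lambda>s. f (a + s *\<^sub>R u) :: real) has_field_derivative f' u) (at s)"
proof -
  have "((\<lambda>s. a + s *\<^sub>R u) has_derivative (\<lambda>d. d *\<^sub>R u)) (at s)"
    by (auto intro!: derivative_eq_intros)
  from has_derivative_compose[OF this assms] 
  have "((\<lambda>s. f (a + s *\<^sub>R u)) has_derivative (\<lambda>d. f' (d *\<^sub>R u))) (at s)" .
  moreover have "d * f' u = f' (d *\<^sub>R u)" for d
    using linear_cmul[OF has_derivative_linear[OF assms]] by simp
  ultimately show ?thesis by (rule has_derivative_imp_has_field_derivative)
qed

text \<open>The second difference on the left is symmetric in \<open>u\<close> and \<open>v\<close>.
  The mean value theorem, in direction \<open>u\<close> and then in direction \<open>v\<close>, ties
  it to one order of differentiation; exchanging the roles ties it to the other.\<close>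

lemma mixed_difference:
  fixes f :: "'e::euclidean_space \<Rightarrow> real"
  assumes f: "Ck_on 2 S f" and h: "h > 0"
    and S: "\<And>s t. s \<in> {0..h} \<Longrightarrow> t \<in> {0..h} \<Longrightarrow> x + s *\<^sub>R u + t *\<^sub>R v \<in> S"
  shows "\<exists>\<xi>\<in>{0..h}. \<exists>\<eta>\<in>{0..h}. f (x + h *\<^sub>R u + h *\<^sub>R v) - f (x + h *\<^sub>R u) - f (x + h *\<^sub>R v) + f x
    = h * h * frechet_derivative (\<lambda>y. frechet_derivative f (at y) u) (at (x + \<xi> *\<^sub>R u + \<eta> *\<^sub>R v)) v"
proof -
  let ?Du = "\<lambda>y. frechet_derivative f (at y) u"
  have f2: "Ck_on (Suc (Suc 0)) S f" using f by (simp add: numeral_2_eq_2)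
  have f1: "Ck_on (Suc 0) S ?Du" using f2 by simp
  define p where "p s = f ((x + h *\<^sub>R v) + s *\<^sub>R u) - f (x + s *\<^sub>R u)" for s
  have "DERIV p s :> ?Du ((x + h *\<^sub>R v) + s *\<^sub>R u) - ?Du (x + s *\<^sub>R u)" if "0 \<le> s" "s \<le> h" for s
  proof -
    have "x + h *\<^sub>R v + s *\<^sub>R u \<in> S" "x + s *\<^sub>R u \<in> S"
      using S[of s h] S[of s 0] that h by (auto simp: algebra_simps)
    then show ?thesis unfolding p_def
      by (intro DERIV_diff line_derivative Ck_on_SucD[OF f2])
  qed
  from MVT2[OF h this] obtain \<xi> where \<xi>: "0 < \<xi>" "\<xi> < h"
    "p h - p 0 = (h - 0) * (?Du ((x + h *\<^sub>R v) + \<xi> *\<^sub>R u) - ?Du (x + \<xi> *\<^sub>R u))" by blast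
  have "DERIV (\<lambda>t. ?Du ((x + \<xi> *\<^sub>R u) + t *\<^sub>R v)) t :>
      frechet_derivative ?Du (at ((x + \<xi> *\<^sub>R u) + t *\<^sub>R v)) v" if "0 \<le> t" "t \<le> h" for t
    using S[of \<xi> t] that \<xi> by (intro line_derivative Ck_on_SucD[OF f1]) auto
  from MVT2[OF h this] obtain \<eta> where \<eta>: "0 < \<eta>" "\<eta> < h"
    "?Du ((x + \<xi> *\<^sub>R u) + h *\<^sub>R v) - ?Du ((x + \<xi> *\<^sub>R u) + 0 *\<^sub>R v) =
      (h - 0) * frechet_derivative ?Du (at ((x + \<xi> *\<^sub>R u) + \<eta> *\<^sub>R v)) v" by blast
  have "f (x + h *\<^sub>R u + h *\<^sub>R v) - f (x + h *\<^sub>R u) - f (x + h *\<^sub>R v) + f x = p h - p 0"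
    by (simp add: p_def algebra_simps)
  also have "\<dots> = h * (?Du ((x + \<xi> *\<^sub>R u) + h *\<^sub>R v) - ?Du ((x + \<xi> *\<^sub>R u) + 0 *\<^sub>R v))"
    using \<xi>(3) by (simp add: algebra_simps)
  finally show ?thesis using \<xi> \<eta> by (intro bexI[of _ \<xi>] bexI[of _ \<eta>]) auto
qed

text \<open>Schwarz's theorem. Half of a supposed gap is the tolerance \<open>r\<close>: near
  \<open>x\<close> both mixed derivatives stay within it, yet on a small parallelogram they share a
  value.\<close>

lemma second_derivative_symmetric_real:
  fixes f :: "'e::euclidean_space \<Rightarrow> real"
  assumes S: "open S" "x \<in> S" and f: "Ck_on 2 S f"
  shows "frechet_derivative (\<lambda>y. frechet_derivative f (at y) u) (at x) v =
    frechet_derivative (\<lambda>y. frechet_derivative f (at y) v) (at x) u"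
proof (rule ccontr)
  define A where "A u v y = frechet_derivative (\<lambda>y. frechet_derivative f (at y) u) (at y) v" for u v y
  assume "frechet_derivative (\<lambda>y. frechet_derivative f (at y) u) (at x) v \<noteq>
    frechet_derivative (\<lambda>y. frechet_derivative f (at y) v) (at x) u"
  then have ne: "A u v x \<noteq> A v u x" by (simp add: A_def)
  define r where "r = \<bar>A u v x - A v u x\<bar> / 2"
  have r: "r > 0" using ne by (simp add: r_def)
  have "\<exists>\<delta>>0. \<forall>y. dist y x < \<delta> \<longrightarrow> dist (A u v y) (A u v x) < r" for u v
  proof -
    have "Ck_on (Suc (Suc 0)) S f" using f by (simp add: numeral_2_eq_2)
    then have "continuous_on S (A u v)" unfolding A_def by simp
    then have "(A u v \<longlongrightarrow> A u v x) (nhds x)"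
      using S by (simp add: continuous_on_eq_continuous_at isCont_def flip: tendsto_at_iff_tendsto_nhds)
    from tendstoD[OF this r] show ?thesis by (simp add: eventually_nhds_metric)
  qed
  from this[of u v] this[of v u] obtain \<delta>1 \<delta>2 where \<delta>1: "\<delta>1 > 0" "\<And>y. dist y x < \<delta>1 \<Longrightarrow> dist (A u v y) (A u v x) < r"
    and \<delta>2: "\<delta>2 > 0" "\<And>y. dist y x < \<delta>2 \<Longrightarrow> dist (A v u y) (A v u x) < r" by metis
  obtain \<delta>3 where \<delta>3: "\<delta>3 > 0" "\<And>y. dist y x < \<delta>3 \<Longrightarrow> y \<in> S"
    using S by (metis open_dist)
  define \<delta> where "\<delta> = min \<delta>1 (min \<delta>2 \<delta>3)"
  have \<delta>: "\<delta> > 0" using \<delta>1 \<delta>2 \<delta>3 by (simp add: \<delta>_def)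
  \<comment> \<open>This size keeps the parallelogram spanned by \<open>h *\<^sub>R u\<close> and
    \<open>h *\<^sub>R v\<close> in the ball of radius \<delta>; the summand 1 covers the case
    \<open>u = v = 0\<close>.\<close>
  define h where "h = \<delta> / (norm u + norm v + 1)"
  have pos: "norm u + norm v + 1 > 0" by (simp add: add_nonneg_pos)
  have h: "h > 0" using \<delta> pos by (simp add: h_def)
  have near: "dist (x + s *\<^sub>R u + t *\<^sub>R v) x < \<delta>" if "s \<in> {0..h}" "t \<in> {0..h}" for s t
  proof -
    have "dist (x + s *\<^sub>R u + t *\<^sub>R v) x = norm (s *\<^sub>R u + t *\<^sub>R v)" by (simp add: dist_norm algebra_simps)
    also have "\<dots> \<le> s * norm u + t * norm v" using norm_triangle_ineq[of "s *\<^sub>R u" "t *\<^sub>R v"] that by simp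
    also have "\<dots> \<le> h * norm u + h * norm v" using that by (intro add_mono mult_right_mono) auto
    also have "\<dots> < h * (norm u + norm v + 1)" using h by (simp add: algebra_simps)
    also have "\<dots> = \<delta>" using pos by (simp add: h_def)
    finally show ?thesis .
  qed
  have near': "dist (x + s *\<^sub>R v + t *\<^sub>R u) x < \<delta>" if "s \<in> {0..h}" "t \<in> {0..h}" for s t
    using near[OF that(2,1)] by (simp add: algebra_simps)
  obtain \<xi> \<eta> where 1: "\<xi> \<in> {0..h}" "\<eta> \<in> {0..h}" 
    "f (x + h *\<^sub>R u + h *\<^sub>R v) - f (x + h *\<^sub>R u) - f (x + h *\<^sub>R v) + f x = h * h * A u v (x + \<xi> *\<^sub>R u + \<eta> *\<^sub>R v)"
    using mixed_difference[OF f h, of x u v] near \<delta>3 unfolding A_def \<delta>_def by fastforce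
  obtain \<xi>' \<eta>' where 2: "\<xi>' \<in> {0..h}" "\<eta>' \<in> {0..h}" 
    "f (x + h *\<^sub>R v + h *\<^sub>R u) - f (x + h *\<^sub>R v) - f (x + h *\<^sub>R u) + f x = h * h * A v u (x + \<xi>' *\<^sub>R v + \<eta>' *\<^sub>R u)"
    using mixed_difference[OF f h, of x v u] near' \<delta>3 unfolding A_def \<delta>_def by fastforce
  have "h * h * A u v (x + \<xi> *\<^sub>R u + \<eta> *\<^sub>R v) = h * h * A v u (x + \<xi>' *\<^sub>R v + \<eta>' *\<^sub>R u)"
    using 1(3) 2(3) by (simp add: algebra_simps)
  then have eq: "A u v (x + \<xi> *\<^sub>R u + \<eta> *\<^sub>R v) = A v u (x + \<xi>' *\<^sub>R v + \<eta>' *\<^sub>R u)" using h by simp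
  have "dist (A u v (x + \<xi> *\<^sub>R u + \<eta> *\<^sub>R v)) (A u v x) < r"
    using near[OF 1(1,2)] by (intro \<delta>1) (simp add: \<delta>_def)
  moreover have "dist (A v u (x + \<xi>' *\<^sub>R v + \<eta>' *\<^sub>R u)) (A v u x) < r"
    using near'[OF 2(1,2)] by (intro \<delta>2) (simp add: \<delta>_def)
  moreover have "\<bar>a - b\<bar> \<le> \<bar>X - a\<bar> + \<bar>X - b\<bar>" for X a b :: real by linarith
  ultimately show False unfolding eq r_def dist_real_def by (metis add_strict_mono field_sum_of_halves not_less)
qed

lemma second_derivative_symmetric:
  fixes F :: "'e::euclidean_space \<Rightarrow> 'f::euclidean_space"
  assumes S: "open S" "x \<in> S" and F: "smooth_on S F"
  shows "frechet_derivative (\<lambda>y. frechet_derivative F (at y) u) (at x) v =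
    frechet_derivative (\<lambda>y. frechet_derivative F (at y) v) (at x) u"
proof (rule euclidean_eqI)
  fix i :: 'f assume "i \<in> Basis"
  have sm: "smooth_on S (\<lambda>y. F y \<bullet> i)"
    by (rule smooth_on_bounded_linear[OF bounded_linear_inner_left S(1) F])
  have 1: "frechet_derivative (\<lambda>y. F y \<bullet> i) (at y) = (\<lambda>h. frechet_derivative F (at y) h \<bullet> i)" if "y \<in> S" for y
    by (rule frechet_derivative_at[symmetric])
      (rule bounded_linear.has_derivative[OF bounded_linear_inner_left smooth_on_has_derivative[OF F that]])
  have 2: "frechet_derivative (\<lambda>y. frechet_derivative (\<lambda>y. F y \<bullet> i) (at y) u) (at x) v =
     frechet_derivative (\<lambda>y. frechet_derivative F (at y) u) (at x) v \<bullet> i" for u v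
  proof -
    have "frechet_derivative (\<lambda>y. frechet_derivative (\<lambda>y. F y \<bullet> i) (at y) u) (at x) =
       frechet_derivative (\<lambda>y. frechet_derivative F (at y) u \<bullet> i) (at x)"
      by (rule frechet_derivative_cong_open[OF S]) (simp add: 1)
    also have "\<dots> = (\<lambda>h. frechet_derivative (\<lambda>y. frechet_derivative F (at y) u) (at x) h \<bullet> i)"
      by (rule frechet_derivative_at[symmetric])
        (rule bounded_linear.has_derivative[OF bounded_linear_inner_left smooth_on_has_derivative[OF smooth_on_derivative[OF F] S(2)]])
    finally show ?thesis by simp
  qed
  have "Ck_on 2 S (\<lambda>y. F y \<bullet> i)" using sm by (simp add: smooth_on_def)
  from second_derivative_symmetric_real[OF S this, of u v]
  show "frechet_derivative (\<lambda>y. frechet_derivative F (at y) u) (at x) v \<bullet> i =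
    frechet_derivative (\<lambda>y. frechet_derivative F (at y) v) (at x) u \<bullet> i"
    unfolding 2 .
qed

lemma bilinear_expand:
  assumes "\<And>b. linear (\<lambda>a. B a b)" "\<And>a. linear (B a)"
  shows "B a b = (\<Sum>i\<in>Basis. \<Sum>j\<in>Basis. (a \<bullet> i) * (b \<bullet> j) * B i j :: real)"
proof -
  have "B a b = B (\<Sum>i\<in>Basis. (a \<bullet> i) *\<^sub>R i) (\<Sum>j\<in>Basis. (b \<bullet> j) *\<^sub>R j)" by (simp add: euclidean_representation)
  also have "\<dots> = (\<Sum>i\<in>Basis. (a \<bullet> i) * B i (\<Sum>j\<in>Basis. (b \<bullet> j) *\<^sub>R j))"
    unfolding linear_sum[OF assms(1)] linear_cmul[OF assms(1)] by simp
  also have "\<dots> = (\<Sum>i\<in>Basis. (a \<bullet> i) * (\<Sum>j\<in>Basis. (b \<bullet> j) * B i j))"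
    unfolding linear_sum[OF assms(2)] linear_cmul[OF assms(2)] by simp
  finally show ?thesis by (simp add: sum_distrib_left mult.assoc)
qed

text \<open>Differentiability in \<open>z\<close> is given for fixed arguments only. Expansion in
  the standard basis turns the expression into a finite sum of products of differentiable
  scalars.\<close>

lemma has_derivative_bilinear_family:
  fixes F :: "'e::euclidean_space \<Rightarrow> 'f::euclidean_space" and B :: "'f \<Rightarrow> 'f \<Rightarrow> 'f \<Rightarrow> real"
  assumes V: "open V" "x \<in> V" and W: "open W" "\<And>y. y \<in> V \<Longrightarrow> F y \<in> W"
    and lin: "\<And>z b. z \<in> W \<Longrightarrow> linear (\<lambda>a. B z a b)" "\<And>z a. z \<in> W \<Longrightarrow> linear (B z a)"
    and B: "\<And>a b. ((\<lambda>z. B z a b) has_derivative DB a b) (at (F x))"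
    and F: "(F has_derivative F') (at x)" and a: "(a has_derivative a') (at x)" and b: "(b has_derivative b') (at x)"
  shows "((\<lambda>y. B (F y) (a y) (b y)) has_derivative
    (\<lambda>h. DB (a x) (b x) (F' h) + B (F x) (a' h) (b x) + B (F x) (a x) (b' h))) (at x)"
proof -
  \<comment> \<open>The derivative in \<open>z\<close> is itself bilinear in the fixed arguments, by
    uniqueness of derivatives.\<close>
  have DB: "DB p q h = (\<Sum>i\<in>Basis. \<Sum>j\<in>Basis. (p \<bullet> i) * (q \<bullet> j) * DB i j h)" for p q h
  proof -
    have "((\<lambda>z. \<Sum>i\<in>Basis. \<Sum>j\<in>Basis. (p \<bullet> i) * (q \<bullet> j) * B z i j) has_derivative
       (\<lambda>h. \<Sum>i\<in>Basis. \<Sum>j\<in>Basis. (p \<bullet> i) * (q \<bullet> j) * DB i j h)) (at (F x))"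
      by (intro has_derivative_sum has_derivative_mult_right B)
    then have "((\<lambda>z. B z p q) has_derivative (\<lambda>h. \<Sum>i\<in>Basis. \<Sum>j\<in>Basis. (p \<bullet> i) * (q \<bullet> j) * DB i j h)) (at (F x))"
      by (rule has_derivative_transform_within_open[OF _ W(1) W(2)[OF V(2)]]) (simp add: bilinear_expand[of "B _" p q] lin)
    from has_derivative_unique[OF B this] show ?thesis by metis
  qed
  have "((\<lambda>y. \<Sum>i\<in>Basis. \<Sum>j\<in>Basis. (a y \<bullet> i) * (b y \<bullet> j) * B (F y) i j) has_derivative
    (\<lambda>h. \<Sum>i\<in>Basis. \<Sum>j\<in>Basis. (a x \<bullet> i) * (b x \<bullet> j) * DB i j (F' h) +
      ((a x \<bullet> i) * (b' h \<bullet> j) + (a' h \<bullet> i) * (b x \<bullet> j)) * B (F x) i j)) (at x)"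
    by (intro has_derivative_sum has_derivative_mult has_derivative_inner_left a b has_derivative_compose[OF F B])
  then have 1: "((\<lambda>y. B (F y) (a y) (b y)) has_derivative
    (\<lambda>h. \<Sum>i\<in>Basis. \<Sum>j\<in>Basis. (a x \<bullet> i) * (b x \<bullet> j) * DB i j (F' h) +
      ((a x \<bullet> i) * (b' h \<bullet> j) + (a' h \<bullet> i) * (b x \<bullet> j)) * B (F x) i j)) (at x)"
    by (rule has_derivative_transform_within_open[OF _ V]) (rule bilinear_expand[symmetric]; rule lin; rule W(2))
  have 2: "B (F x) p q = (\<Sum>i\<in>Basis. \<Sum>j\<in>Basis. (p \<bullet> i) * (q \<bullet> j) * B (F x) i j)" for p q
    by (rule bilinear_expand) (use lin W(2)[OF V(2)] in auto)
  show ?thesis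
    by (rule has_derivative_eq_rhs[OF 1], rule ext)
      (unfold DB[of "a x" "b x"] 2[of "a' _" "b x"] 2[of "a x" "b' _"], simp add: algebra_simps sum.distrib)
qed

lemma length_3: "length vs = 3 \<longleftrightarrow> (\<exists>u v w. vs = [u, v, w])"
  by (simp add: numeral_3_eq_3 length_Suc_conv) blast

text \<open>Second derivatives of \<open>F\<close> enter through the moving arguments. They are
  symmetric while \<alpha> alternates, so they cancel in pairs. Degree 2 is the case of
  \<omega>.\<close>

lemma local_d_pullback_2form:
  fixes F :: "'e::euclidean_space \<Rightarrow> 'f::euclidean_space" and \<alpha> :: "'f \<Rightarrow> 'f list \<Rightarrow> real"
  assumes V: "open V" "x \<in> V" and F: "smooth_on V F" and W: "open W" "\<And>y. y \<in> V \<Longrightarrow> F y \<in> W"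
    and \<alpha>: "\<And>z. z \<in> W \<Longrightarrow> kform 2 (\<alpha> z)" "coeffs_smooth W \<alpha>" and diff: "coeffs_diff \<beta> x"
    and \<beta>: "\<And>y vs. y \<in> V \<Longrightarrow> \<beta> y vs = \<alpha> (F y) (map (frechet_derivative F (at y)) vs)"
  shows "local_d \<beta> x vs = local_d \<alpha> (F x) (map (frechet_derivative F (at x)) vs)"
proof -
  let ?D = "\<lambda>y. frechet_derivative F (at y)"
  let ?D2 = "\<lambda>u v. frechet_derivative (\<lambda>y. ?D y v) (at x) u"
  have Fx: "F x \<in> W" using W(2) V(2) .
  have diff\<alpha>: "coeffs_diff \<alpha> (F x)" by (rule coeffs_smooth_diff[OF \<alpha>(2) Fx])
  have linD: "linear (?D y)" if "y \<in> V" for y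
    using has_derivative_linear[OF smooth_on_has_derivative[OF F that]] .
  have k\<beta>: "kform 2 (\<beta> y)" if "y \<in> V" for y
  proof -
    have "\<beta> y = (\<lambda>vs. \<alpha> (F y) (map (?D y) vs))" by (rule ext) (rule \<beta>[OF that])
    then show ?thesis using kform_map[OF \<alpha>(1)[OF W(2)[OF that]] linD[OF that]] by simp
  qed
  have sym: "?D2 u v = ?D2 v u" for u v by (rule second_derivative_symmetric[OF V F])
  have m: "multi (\<alpha> z)" if "z \<in> W" for z using \<alpha>(1)[OF that] by (simp add: kform_iff)
  have lin: "linear (\<lambda>a. \<alpha> z [a, b])" "linear (\<lambda>b. \<alpha> z [a, b])" if "z \<in> W" for z a b
    using multi_linear[OF m[OF that], of "[]" "[b]"] multi_linear[OF m[OF that], of "[a]" "[]"] by simp_all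
  have asym: "\<alpha> (F x) [a, b] = - \<alpha> (F x) [b, a]" for a b
    using multi_swap[OF m[OF Fx], of "[]" a b "[]"] by simp
  have dd: "dir_deriv \<beta> x u [v, w] = dir_deriv \<alpha> (F x) (?D x u) [?D x v, ?D x w] +
    \<alpha> (F x) [?D2 u v, ?D x w] + \<alpha> (F x) [?D x v, ?D2 u w]" for u v w
  proof (rule dir_derivI)
    have "((\<lambda>y. \<alpha> (F y) [?D y v, ?D y w]) has_derivative
     (\<lambda>h. dir_deriv \<alpha> (F x) (?D x h) [?D x v, ?D x w] +
      \<alpha> (F x) [?D2 h v, ?D x w] + \<alpha> (F x) [?D x v, ?D2 h w])) (at x)"
      by (rule has_derivative_bilinear_family[OF V W, where B = "\<lambda>z a b. \<alpha> z [a, b]"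
         and DB = "\<lambda>a b h. dir_deriv \<alpha> (F x) h [a, b]"])
       (auto intro!: lin has_dir_deriv diff\<alpha> smooth_on_has_derivative[OF F V(2)]
          smooth_on_has_derivative[OF smooth_on_derivative[OF F] V(2)])
    then show "((\<lambda>y. \<beta> y [v, w]) has_derivative
     (\<lambda>h. dir_deriv \<alpha> (F x) (?D x h) [?D x v, ?D x w] +
      \<alpha> (F x) [?D2 h v, ?D x w] + \<alpha> (F x) [?D x v, ?D2 h w])) (at x)"
      by (rule has_derivative_transform_within_open[OF _ V]) (simp add: \<beta>)
  qed
  show ?thesis
  proof (cases "length vs = 3")
    case True
    then obtain u v w where vs: "vs = [u, v, w]" by (auto simp: length_3)
    have l3: "local_d \<gamma> y [u, v, w] = dir_deriv \<gamma> y u [v, w] - dir_deriv \<gamma> y v [u, w] + dir_deriv \<gamma> y w [u, v]"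
      for \<gamma> :: "'b::euclidean_space \<Rightarrow> 'b list \<Rightarrow> real" and y u v w
      by (simp add: local_d_Cons dir_deriv_ins) (simp add: ins_def)
    show ?thesis unfolding vs list.map l3 dd
      using sym[of u v] sym[of u w] sym[of v w] asym[of "?D x u"] asym[of "?D x v"] asym[of "?D x w"] by simp
  next
    case False
    then show ?thesis
      using kform_degree[OF kform_local_d[OF V k\<beta> diff]] kform_degree[OF kform_local_d[OF W(1) Fx \<alpha>(1) diff\<alpha>]] by simp
  qed
qed

section \<open>The metric and orientation of a \<open>G\<^sub>2\<close>-form\<close>

lemma kform_multi: "kform k \<alpha> \<Longrightarrow> multi (\<alpha> :: _ \<Rightarrow> real)" by (simp add: kform_iff)

text \<open>The cubic identity determines the metric up to a scale \<open>k\<close>, and \<open>|\<phi>|\<^sup>2 = 7\<close> forces \<open>k\<^sup>3 = 1\<close>.\<close>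

lemma g2_coframe_unique:
  fixes e e' :: "nat \<Rightarrow> 'v::euclidean_space \<Rightarrow> real"
  assumes "coframe7 e" "coframe7 e'" and eq: "g2_model e = g2_model e'"
  shows "frame_metric 7 e = frame_metric 7 e'" "ewedge e [1, 2, 3, 4, 5, 6, 7] = ewedge e' [1, 2, 3, 4, 5, 6, 7]"
proof -
  obtain b b' where b: "dual_frame 7 e b" and b': "dual_frame 7 e' b'"
    using assms coframe7_dual_frame by metis
  interpret F: g2_frame e b by unfold_locales (rule b)
  interpret F': g2_frame e' b' by unfold_locales (rule b')
  let ?g = "frame_metric 7 e" and ?g' = "frame_metric 7 e'"
  let ?\<mu> = "ewedge e [1, 2, 3, 4, 5, 6, 7]" and ?\<mu>' = "ewedge e' [1, 2, 3, 4, 5, 6, 7]"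
  have cubic: "?g u u * ?\<mu> vs = ?g' u u * ?\<mu>' vs" for u vs
    using fun_cong[OF F.model_cubic[of u], of vs] fun_cong[OF F'.model_cubic[of u], of vs] eq by simp
  \<comment> \<open>The vector \<open>b 1\<close> has unit length for \<open>?g\<close>, so the
    cubic identity at \<open>u = b 1\<close> compares the two volume forms by the factor
    \<open>k\<close>.\<close>
  define k where "k = ?g' (b 1) (b 1)"
  have "?g (b 1) (b 1) = 1" using frame_metric_basis(1)[OF b, of 1 "b 1"] F.e_b[of 1 1] by simp
  then have \<mu>: "?\<mu> vs = k * ?\<mu>' vs" for vs using cubic[of "b 1" vs] by (simp add: k_def)
  have "?\<mu>' (map b' [1, 2, 3, 4, 5, 6, 7]) = ewedge_index [1, 2, 3, 4, 5, 6, 7] [1, 2, 3, 4, 5, 6, 7]"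
    by (rule F'.ewedge_frame) auto
  then have one: "?\<mu>' (map b' [1, 2, 3, 4, 5, 6, 7]) = 1" by (simp del: list.map)
  have diag: "?g' u u = k * ?g u u" for u
    using cubic[of u "map b' [1, 2, 3, 4, 5, 6, 7]"] unfolding \<mu> one by (simp add: mult.commute)
  have ip: "inner_product_on_type ?g" "inner_product_on_type ?g'"
    using inner_product_frame_metric b b' by auto
  \<comment> \<open>The cubic identity sees only the quadratic forms; polarization recovers the
    bilinear ones.\<close>
  have polar: "h u v = (h (u + v) (u + v) - h u u - h v v) / 2" if "inner_product_on_type h" for h and u v :: 'v
  proof -
    have l: "linear (h u)" and s: "\<And>u v. h u v = h v u" for u using that by (auto simp: inner_product_on_type_def)
    show ?thesis using s[of u v] by (simp add: linear_add[OF l] s[of "u + v"])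
  qed
  have g: "?g' u v = k * ?g u v" for u v
    unfolding polar[OF ip(1), of u v] polar[OF ip(2), of u v] diag by (simp add: algebra_simps)
  have "k > 0" 
  proof -
    have "b 1 \<noteq> 0" using F.e_b[of 1 1] linear_0[OF F.e_linear[of 1]] by auto
    then show ?thesis using ip(2) by (simp add: k_def inner_product_on_type_def)
  qed
  \<comment> \<open>Scaling by \<open>1 / sqrt k\<close> makes the \<open>?g\<close>-orthonormal
    frame orthonormal for \<open>?g'\<close>. The squared norm of the 3-form is
    \<open>7 * r ^ 6\<close> in the scaled frame and 7 in the frame \<open>b'\<close>, and both are
    computed with \<open>?g'\<close>.\<close>
  define r where "r = 1 / sqrt k"
  have r: "r * r * k = 1" using \<open>k > 0\<close> by (simp add: r_def)
  define es where "es = map (\<lambda>v. r *\<^sub>R v) (frame_list 7 b)"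
  have gs: "?g' (r *\<^sub>R u) (r *\<^sub>R v) = r * r * k * ?g u v" for u v
  proof -
    have "linear (?g' u)" for u using ip(2) by (auto simp: inner_product_on_type_def)
    then have "?g' (r *\<^sub>R u) (r *\<^sub>R v) = r * ?g' (r *\<^sub>R u) v" by (simp add: linear_cmul)
    also have "?g' (r *\<^sub>R u) v = r * ?g' u v"
      using ip(2) linear_cmul[of "?g' v" r u] by (simp add: inner_product_on_type_def)
    finally show ?thesis by (simp add: g)
  qed
  have o: "orthonormal_basis ?g (frame_list 7 b)" "orthonormal_basis ?g' (frame_list 7 b')"
    using orthonormal_frame_list b b' by auto
  have oes: "orthonormal_basis ?g' es"
    using o(1) by (simp add: orthonormal_basis_def es_def gs r)
  have m: "multi (g2_model e)" using F.kform_models(4) by (rule kform_multi)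
  have sc: "g2_model e (map (\<lambda>v. r *\<^sub>R v) ws) = r ^ 3 * g2_model e ws" if "length ws = 3" for ws
  proof -
    obtain u v w where ws: "ws = [u, v, w]" using \<open>length ws = 3\<close> by (auto simp: length_3)
    show ?thesis unfolding ws
      using multi_args_scale[OF m, of "[]" r u "[r *\<^sub>R v, r *\<^sub>R w]"] multi_args_scale[OF m, of "[u]" r v "[r *\<^sub>R w]"]
        multi_args_scale[OF m, of "[u, v]" r w "[]"] by (simp add: power3_eq_cube)
  qed
  have "pairing 3 es (g2_model e) (g2_model e) = pairing 3 (frame_list 7 b') (g2_model e) (g2_model e)"
    by (rule pairing_invariant[OF ip(2) oes o(2) m m])
  then have "pairing 3 es (g2_model e) (g2_model e) = 7" using F'.pairing_model eq by simp
  moreover have "pairing 3 es (g2_model e) (g2_model e) = (r ^ 3 * r ^ 3) * pairing 3 (frame_list 7 b) (g2_model e) (g2_model e)"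
  proof -
    have "(\<Sum>ws\<leftarrow>combs 3 (frame_list 7 b). g2_model e (map (\<lambda>v. r *\<^sub>R v) ws) * g2_model e (map (\<lambda>v. r *\<^sub>R v) ws)) =
       (\<Sum>ws\<leftarrow>combs 3 (frame_list 7 b). (r ^ 3 * r ^ 3) * (g2_model e ws * g2_model e ws))"
      by (rule arg_cong[of _ _ sum_list], rule map_cong) (auto dest!: combs_length simp: sc)
    then show ?thesis by (simp add: pairing_def es_def combs_map o_def sum_list_const_mult)
  qed
  ultimately have "(r * r) ^ 3 = 1" using F.pairing_model by (simp add: power_mult_distrib)
  then have "r * r = 1" using power_eq_1_iff[of "r * r" 3] by simp
  then have "k = 1" using r by simp
  then show "?g = ?g'" "?\<mu> = ?\<mu>'" using g \<mu> by (auto simp: fun_eq_iff)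
qed

text \<open>Frees the metric and the volume form from the coframe selected in their definitions: any
  adapted coframe computes them.\<close>

lemma g2_adapted_metric:
  assumes "g2_adapted (\<phi> c x) e"
  shows "g2_metric \<phi> c x = frame_metric 7 e" "g2_vol \<phi> c x = ewedge e [1, 2, 3, 4, 5, 6, 7]"
proof -
  define e' where "e' = (SOME e. g2_adapted (\<phi> c x) e)"
  have "g2_adapted (\<phi> c x) e'" unfolding e'_def by (rule someI[of "g2_adapted (\<phi> c x)" e]) (rule assms)
  then have "coframe7 e'" "coframe7 e" "g2_model e' = g2_model e" using assms by (auto simp: g2_adapted_def)
  note u = g2_coframe_unique[OF this]
  show "g2_metric \<phi> c x = frame_metric 7 e"
    unfolding u(1)[symmetric] by (simp add: fun_eq_iff g2_metric_def frame_metric_def Let_def e'_def)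
  show "g2_vol \<phi> c x = ewedge e [1, 2, 3, 4, 5, 6, 7]"
    unfolding u(2)[symmetric] by (simp add: g2_vol_def Let_def e'_def)
qed

section \<open>Unitary frames\<close>

definition hermitian_pair :: "('w::real_vector \<Rightarrow> 'w \<Rightarrow> real) \<Rightarrow> ('w \<Rightarrow> 'w) \<Rightarrow> bool" where
  "hermitian_pair g J \<longleftrightarrow> inner_product_on_type g \<and> linear J \<and> (\<forall>v. J (J v) = - v) \<and> (\<forall>v w. g (J v) (J w) = g v w)"

text \<open>The complex pairs occupy the positions \<open>2 * i - 1\<close> and
  \<open>2 * i\<close>. Their number \<open>k\<close> may be smaller than the complex dimension, so
  that frames can be built pair by pair.\<close>

definition unitary_frame :: "('w::real_vector \<Rightarrow> 'w \<Rightarrow> real) \<Rightarrow> ('w \<Rightarrow> 'w) \<Rightarrow> nat \<Rightarrow> (nat \<Rightarrow> 'w) \<Rightarrow> bool" where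
  "unitary_frame g J k b \<longleftrightarrow> (\<forall>i\<in>{1..2 * k}. \<forall>j\<in>{1..2 * k}. g (b i) (b j) = (if i = j then 1 else 0)) \<and>
     (\<forall>i\<in>{1..k}. J (b (2 * i - 1)) = b (2 * i))"

definition unit_orthogonal :: "('w::real_vector \<Rightarrow> 'w \<Rightarrow> real) \<Rightarrow> nat \<Rightarrow> (nat \<Rightarrow> 'w) \<Rightarrow> 'w \<Rightarrow> bool" where
  "unit_orthogonal g k b u \<longleftrightarrow> g u u = 1 \<and> (\<forall>i\<in>{1..2 * k}. g (b i) u = 0)"

definition pair_form :: "('w::real_vector \<Rightarrow> 'w \<Rightarrow> real) \<Rightarrow> ('w \<Rightarrow> 'w) \<Rightarrow> 'w list \<Rightarrow> real" where
  "pair_form g J vs = (case vs of [v, w] \<Rightarrow> g (J v) w | _ \<Rightarrow> 0)"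

text \<open>Since \<open>g\<close> is not the inner product of the type, \<open>G w\<close>
  represents \<open>g w\<close> with respect to the latter. A nonzero vector orthogonal to all
  \<open>G (b i)\<close> exists by counting dimensions and is then normalized for
  \<open>g\<close>.\<close>

lemma exists_unit_orthogonal:
  fixes g :: "'w::euclidean_space \<Rightarrow> 'w \<Rightarrow> real"
  assumes ip: "inner_product_on_type g" and k: "2 * k < DIM('w)"
  shows "\<exists>u. unit_orthogonal g k b u"
proof -
  have lin: "linear (g w)" and pos: "v \<noteq> 0 \<Longrightarrow> g v v > 0" and sym: "g v w = g w v" for v w
    using ip by (auto simp: inner_product_on_type_def)
  define G where "G w = (\<Sum>i\<in>Basis. g w i *\<^sub>R i)" for w
  have G: "g w v = v \<bullet> G w" for w v
  proof -
    have "g w v = g w (\<Sum>i\<in>Basis. (v \<bullet> i) *\<^sub>R i)" by (simp add: euclidean_representation)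
    also have "\<dots> = (\<Sum>i\<in>Basis. (v \<bullet> i) * g w i)" by (simp only: linear_sum[OF lin] linear_cmul[OF lin] real_scaleR_def)
    finally show ?thesis by (simp add: G_def inner_sum_right mult.commute)
  qed
  have "dim (G ` b ` {1..2 * k}) \<le> card (G ` b ` {1..2 * k})" by (rule dim_le_card') simp
  also have "\<dots> \<le> 2 * k" by (metis card_atLeastAtMost card_image_le diff_Suc_1 finite_atLeastAtMost finite_imageI order_trans)
  finally have "dim (G ` b ` {1..2 * k}) < DIM('w)" using k by simp
  from orthogonal_to_subspace_exists[OF this] obtain x where x: "x \<noteq> 0" "\<And>y. y \<in> span (G ` b ` {1..2 * k}) \<Longrightarrow> orthogonal x y"
    by blast
  have o: "g (b i) x = 0" if "i \<in> {1..2 * k}" for i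
    using x(2)[OF span_base, of "G (b i)"] that by (simp add: G orthogonal_def)
  define r where "r = 1 / sqrt (g x x)"
  have "r * r * g x x = 1" using pos[OF x(1)] by (simp add: r_def)
  then have "g (r *\<^sub>R x) (r *\<^sub>R x) = 1"
    by (simp add: linear_cmul[OF lin] sym[of "r *\<^sub>R x"] mult.assoc)
  then have "unit_orthogonal g k b (r *\<^sub>R x)" by (simp add: unit_orthogonal_def linear_cmul[OF lin] o)
  then show ?thesis by blast
qed

context
  fixes g :: "'w::real_vector \<Rightarrow> 'w \<Rightarrow> real" and J :: "'w \<Rightarrow> 'w"
  assumes H: "hermitian_pair g J"
begin

lemma hermitian_lin: "linear (g w)" "linear (\<lambda>v. g v w)" "linear J"
  and hermitian_sym: "g v w = g w v" and hermitian_J: "J (J v) = - v" "g (J v) (J w) = g v w"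
proof -
  show s: "g v w = g w v" for v w using H by (auto simp: hermitian_pair_def inner_product_on_type_def)
  show l: "linear (g w)" for w using H by (auto simp: hermitian_pair_def inner_product_on_type_def)
  show "linear (\<lambda>v. g v w)" using l[of w] by (simp add: s[of _ w])
qed (use H in \<open>auto simp: hermitian_pair_def\<close>)

lemmas hermitian_simps = linear_add[OF hermitian_lin(1)] linear_cmul[OF hermitian_lin(1)] linear_neg[OF hermitian_lin(1)]
  linear_add[OF hermitian_lin(2)] linear_cmul[OF hermitian_lin(2)] linear_neg[OF hermitian_lin(2)]
  linear_add[OF hermitian_lin(3)] linear_cmul[OF hermitian_lin(3)] hermitian_J

lemma hermitian_skew: "g (J v) w = - g v (J w)"
  using hermitian_J(2)[of v "J w"] by (simp add: hermitian_simps)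

lemma hermitian_self: "g (J v) v = 0" "g v (J v) = 0"
  using hermitian_skew[of v v] hermitian_sym[of v "J v"] by auto

text \<open>J permutes the frame up to sign and is skew for \<open>g\<close>, so orthogonality to
  the frame passes from \<open>u\<close> to \<open>J u\<close>.\<close>

lemma unit_orthogonal_J:
  assumes U: "unitary_frame g J k b" and u: "unit_orthogonal g k b u" and j: "j \<in> {1..2 * k}"
  shows "g (b j) (J u) = 0"
proof (cases "even j")
  case True
  then obtain i where i: "j = 2 * i" by auto
  then have "i \<in> {1..k}" "2 * i - 1 \<in> {1..2 * k}" using j by auto
  then have "b j = J (b (2 * i - 1))" "g (b (2 * i - 1)) u = 0" using U u by (auto simp: unitary_frame_def unit_orthogonal_def i)
  then show ?thesis by (simp add: hermitian_simps)
next
  case False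
  then obtain i where i: "j = 2 * i + 1" by (auto elim: oddE)
  then have "i < k" using j unfolding atLeastAtMost_iff by presburger
  then have "Suc i \<in> {1..k}" "2 * Suc i \<in> {1..2 * k}" "j = 2 * Suc i - 1" using i by auto
  then have "J (b j) = b (2 * Suc i)" "g (b (2 * Suc i)) u = 0" using U u unfolding unitary_frame_def unit_orthogonal_def by blast+
  then show ?thesis using hermitian_skew[of "b j" u] by simp
qed

lemma unitary_frame_extend:
  assumes U: "unitary_frame g J k b" and u: "unit_orthogonal g k b u"
  shows "unitary_frame g J (Suc k) (b(2 * k + 1 := u, 2 * k + 2 := J u))"
proof -
  let ?b = "b(2 * k + 1 := u, 2 * k + 2 := J u)"
  have uu: "g u u = 1" "g (J u) (J u) = 1" "g u (J u) = 0" "g (J u) u = 0"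
    using u by (auto simp: unit_orthogonal_def hermitian_simps hermitian_self)
  have bu: "g (b i) u = 0" "g u (b i) = 0" "g (b i) (J u) = 0" "g (J u) (b i) = 0" if "i \<in> {1..2 * k}" for i
    using u unit_orthogonal_J[OF U u that] that hermitian_sym[of u "b i"] hermitian_sym[of "J u" "b i"]
    by (auto simp: unit_orthogonal_def)
  have "g (?b i) (?b j) = (if i = j then 1 else 0)" if "i \<in> {1..2 * Suc k}" "j \<in> {1..2 * Suc k}" for i j
  proof -
    have "i \<in> {1..2 * k} \<or> i = 2 * k + 1 \<or> i = 2 * k + 2" "j \<in> {1..2 * k} \<or> j = 2 * k + 1 \<or> j = 2 * k + 2"
      using that unfolding atLeastAtMost_iff by presburger+
    moreover have "g (b i) (b j) = (if i = j then 1 else 0)" if "i \<in> {1..2 * k}" "j \<in> {1..2 * k}"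
      using U that by (simp add: unitary_frame_def)
    ultimately show ?thesis using uu bu by (auto split: if_splits)
  qed
  moreover have "J (?b (2 * i - 1)) = ?b (2 * i)" if "i \<in> {1..Suc k}" for i
  proof (cases "i = Suc k")
    case False
    then have "i \<in> {1..k}" using that by auto
    then have "J (b (2 * i - 1)) = b (2 * i)" using U by (simp add: unitary_frame_def)
    then show ?thesis using \<open>i \<in> {1..k}\<close> by auto
  qed simp
  ultimately show ?thesis by (simp add: unitary_frame_def)
qed

lemma unit_orthogonal_rotate:
  assumes U: "unitary_frame g J k b" and u: "unit_orthogonal g k b u" and cs: "c * c + s * s = 1"
  shows "unit_orthogonal g k b (c *\<^sub>R u + s *\<^sub>R J u)"
  using u cs unit_orthogonal_J[OF U u]
  by (auto simp: unit_orthogonal_def hermitian_simps hermitian_self)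

lemma kform_pair_form: "kform 2 (pair_form g J)"
proof -
  have "linear (\<lambda>v. pair_form g J (vs[i := v]))" if vs: "length vs = 2" and i: "i < 2" for vs i
  proof -
    obtain a b where ab: "vs = [a, b]" using vs by (auto simp: numeral_2_eq_2 length_Suc_conv)
    have "linear (\<lambda>v. g (J v) b)" using linear_compose[OF hermitian_lin(3) hermitian_lin(2)[of b]] by (simp add: o_def)
    moreover have "i = 0 \<or> i = 1" using i by auto
    ultimately show ?thesis using hermitian_lin(1)[of "J a"] by (auto simp: ab pair_form_def)
  qed
  moreover have "pair_form g J vs = 0" if "length vs = 2" "\<not> distinct vs" for vs
    using that by (auto simp: numeral_2_eq_2 length_Suc_conv pair_form_def hermitian_self)
  moreover have "pair_form g J vs = 0" if "length vs \<noteq> 2" for vs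
    using that by (auto simp: pair_form_def split: list.splits)
  ultimately show ?thesis by (auto simp: kform_def)
qed

end

lemma unitary_frame_exists:
  fixes g :: "'w::euclidean_space \<Rightarrow> 'w \<Rightarrow> real"
  assumes H: "hermitian_pair g J"
  shows "2 * k \<le> DIM('w) \<Longrightarrow> \<exists>b. unitary_frame g J k b"
proof (induction k)
  case 0 then show ?case by (simp add: unitary_frame_def)
next
  case (Suc k)
  then obtain b where b: "unitary_frame g J k b" by auto
  obtain u where "unit_orthogonal g k b u"
    using exists_unit_orthogonal[of g k b] H Suc.prems by (auto simp: hermitian_pair_def)
  from unitary_frame_extend[OF H b this] show ?case by blast
qed

text \<open>Uses the phase freedom in the complex line of \<open>u\<close>: multiplying
  \<open>u\<close> by a unit complex number, with J in the role of the imaginary unit, multiplies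
  \<open>\<Lambda> u\<close> by the same number.\<close>

lemma exists_rotated:
  fixes g :: "'w::euclidean_space \<Rightarrow> 'w \<Rightarrow> real" and \<Lambda> :: "'w \<Rightarrow> complex"
  assumes H: "hermitian_pair g J" and U: "unitary_frame g J k b" and k: "2 * k < DIM('w)"
    and \<Lambda>: "linear \<Lambda>" "\<And>v. \<Lambda> (J v) = \<i> * \<Lambda> v"
  shows "\<exists>u r. unit_orthogonal g k b u \<and> \<Lambda> u = complex_of_real r \<and> r \<ge> 0"
proof -
  obtain u where u: "unit_orthogonal g k b u"
    using exists_unit_orthogonal[of g k b] H k by (auto simp: hermitian_pair_def)
  show ?thesis
  proof (cases "\<Lambda> u = 0")
    case True
    then show ?thesis using u by (intro exI[of _ u] exI[of _ 0]) auto
  next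
    case False
    define l where "l = \<Lambda> u"
    \<comment> \<open>The phase opposite to that of \<open>l\<close>, so that \<open>z * l\<close>
      is the modulus of \<open>l\<close>.\<close>
    define z where "z = cnj l / cmod l"
    have l: "cmod l > 0" using False by (simp add: l_def)
    have "cmod z = 1" using l by (simp add: z_def norm_divide)
    then have "Re z * Re z + Im z * Im z = 1" by (metis cmod_power2 power2_eq_square one_power2)
    from unit_orthogonal_rotate[OF H U u this] have "unit_orthogonal g k b (Re z *\<^sub>R u + Im z *\<^sub>R J u)" .
    moreover have "\<Lambda> (Re z *\<^sub>R u + Im z *\<^sub>R J u) = (Re z + \<i> * Im z) * l"
      by (simp add: linear_add[OF \<Lambda>(1)] linear_cmul[OF \<Lambda>(1)] \<Lambda>(2) l_def scaleR_conv_of_real algebra_simps)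
    moreover have "(Re z + \<i> * Im z) * l = complex_of_real (cmod l)"
    proof -
      have "(Re z + \<i> * Im z) * l = z * l" by (simp flip: complex_eq)
      also have "\<dots> = (l * cnj l) / cmod l" by (simp add: z_def)
      also have "\<dots> = complex_of_real (cmod l)"
        using l by (simp add: complex_norm_square[symmetric] power2_eq_square)
      finally show ?thesis .
    qed
    ultimately show ?thesis using l by (intro exI[of _ "Re z *\<^sub>R u + Im z *\<^sub>R J u"] exI[of _ "cmod l"]) auto
  qed
qed

lemma unitary_dual_frame:
  fixes g :: "'w::euclidean_space \<Rightarrow> 'w \<Rightarrow> real"
  assumes H: "hermitian_pair g J" and U: "unitary_frame g J k b" and dim: "DIM('w) = 2 * k"
  shows "dual_frame (2 * k) (\<lambda>i. g (b i)) b" "g = frame_metric (2 * k) (\<lambda>i. g (b i))"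
proof -
  show F: "dual_frame (2 * k) (\<lambda>i. g (b i)) b"
    using U hermitian_lin(1)[OF H] by (auto simp: dual_frame_def dim unitary_frame_def)
  have "g v w = frame_metric (2 * k) (\<lambda>i. g (b i)) v w" for v w
  proof -
    have "g v w = g v (\<Sum>i=1..2 * k. g (b i) w *\<^sub>R b i)" using dual_frame_expand[OF F, of w] by simp
    also have "\<dots> = (\<Sum>i=1..2 * k. g (b i) w * g v (b i))"
      by (simp only: linear_sum[OF hermitian_lin(1)[OF H]] linear_cmul[OF hermitian_lin(1)[OF H]] real_scaleR_def)
    finally show ?thesis by (simp add: frame_metric_def hermitian_sym[OF H, of v] mult.commute)
  qed
  then show "g = frame_metric (2 * k) (\<lambda>i. g (b i))" by (simp add: fun_eq_iff)
qed

section \<open>Normal forms of SU(2)- and SU(3)-structures at a point\<close>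

lemma kform_Re: "kform k \<Psi> \<Longrightarrow> kform k (\<lambda>vs. Re (\<Psi> vs))"
  and kform_Im: "kform k \<Psi> \<Longrightarrow> kform k (\<lambda>vs. Im (\<Psi> vs))"
  unfolding kform_def
  using linear_compose[of _ Re] linear_compose[of _ Im] bounded_linear.linear[OF bounded_linear_Re]
    bounded_linear.linear[OF bounded_linear_Im]
  by (fastforce simp: o_def)+

definition complex_form :: "nat \<Rightarrow> ('w \<Rightarrow> 'w) \<Rightarrow> ('w list \<Rightarrow> complex) \<Rightarrow> bool" where
  "complex_form n J \<Psi> \<longleftrightarrow> (\<forall>vs. length vs = n \<longrightarrow> (\<forall>i<n. \<Psi> (vs[i := J (vs ! i)]) = \<i> * \<Psi> vs))"

lemma upt_1_6: "[1..<Suc 6] = [1, 2, 3, 4, 5, 6]" and upt_1_4: "[1..<Suc 4] = [1, 2, 3, 4]"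
  by (simp_all add: upt_rec)

lemmas dual_eval = ewedge_append ewedge_Cons[symmetric] wedge_linear[THEN ext]

lemma combs_frame_conditions:
  "is \<in> set (combs k [1..<Suc m]) \<Longrightarrow> set is \<subseteq> {1..m} \<and> distinct is"
  using combs_sorted[OF sorted_wrt_upt, of "is" k 1 "Suc m"] combs_subset[of "is" k "[1..<Suc m]"]
  by (auto simp: strict_sorted_iff)

definition omega6 :: "(nat \<Rightarrow> 'v \<Rightarrow> real) \<Rightarrow> 'v list \<Rightarrow> real" where
  "omega6 f = (\<lambda>vs. ewedge f [1, 2] vs + ewedge f [3, 4] vs + ewedge f [5, 6] vs)"

definition psip6 :: "(nat \<Rightarrow> 'v \<Rightarrow> real) \<Rightarrow> 'v list \<Rightarrow> real" where
  "psip6 f = (\<lambda>vs. ewedge f [1, 3, 5] vs - ewedge f [1, 4, 6] vs - ewedge f [2, 3, 6] vs - ewedge f [2, 4, 5] vs)"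

definition psim6 :: "(nat \<Rightarrow> 'v \<Rightarrow> real) \<Rightarrow> 'v list \<Rightarrow> real" where
  "psim6 f = (\<lambda>vs. ewedge f [1, 3, 6] vs + ewedge f [1, 4, 5] vs + ewedge f [2, 3, 5] vs - ewedge f [2, 4, 6] vs)"

definition omega4 :: "(nat \<Rightarrow> 'v \<Rightarrow> real) \<Rightarrow> 'v list \<Rightarrow> real" where
  "omega4 f = (\<lambda>vs. ewedge f [1, 2] vs + ewedge f [3, 4] vs)"

definition psip4 :: "(nat \<Rightarrow> 'v \<Rightarrow> real) \<Rightarrow> 'v list \<Rightarrow> real" where
  "psip4 f = (\<lambda>vs. ewedge f [1, 3] vs - ewedge f [2, 4] vs)"

definition psim4 :: "(nat \<Rightarrow> 'v \<Rightarrow> real) \<Rightarrow> 'v list \<Rightarrow> real" where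
  "psim4 f = (\<lambda>vs. ewedge f [1, 4] vs + ewedge f [2, 3] vs)"

lemmas forms6_defs = omega6_def psip6_def psim6_def
lemmas forms4_defs = omega4_def psip4_def psim4_def

lemma kform_ewedge_dual: "dual_frame m f b \<Longrightarrow> set is \<subseteq> {1..m} \<Longrightarrow> length is = k \<Longrightarrow> kform k (ewedge f is)"
  using kform_ewedge[of "is" f] by (auto simp: dual_frame_def)

lemma kform_forms6:
  assumes "dual_frame 6 f b"
  shows "kform 2 (omega6 f)" "kform 3 (psip6 f)" "kform 3 (psim6 f)"
  unfolding forms6_defs by (intro kform_add kform_diff kform_ewedge_dual[OF assms]; simp)+

lemma kform_forms4:
  assumes "dual_frame 4 f b"
  shows "kform 2 (omega4 f)" "kform 2 (psip4 f)" "kform 2 (psim4 f)"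
  unfolding forms4_defs by (intro kform_add kform_diff kform_ewedge_dual[OF assms]; simp)+

text \<open>A form of type (3, 0) is determined by its value on \<open>b 1\<close>,
  \<open>b 3\<close>, \<open>b 5\<close>. Rotating the last complex line makes this value a real
  number \<open>r \<ge> 0\<close>, and the normalization then leaves only
  \<open>r = 1\<close>.\<close>

lemma su3_frame:
  fixes g :: "'w::euclidean_space \<Rightarrow> 'w \<Rightarrow> real"
  assumes H: "hermitian_pair g J" and dim: "DIM('w) = 6" and \<Psi>: "kform 3 \<Psi>" "complex_form 3 J \<Psi>"
    and norm: "\<And>vs. 3 * ((\<lambda>vs. Re (\<Psi> vs)) \<^bold>\<and> (\<lambda>vs. Im (\<Psi> vs))) vs =
      2 * (pair_form g J \<^bold>\<and> pair_form g J \<^bold>\<and> pair_form g J) vs"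
  shows "\<exists>f b. dual_frame 6 f b \<and> g = frame_metric 6 f \<and> J (b 1) = b 2 \<and> J (b 3) = b 4 \<and> J (b 5) = b 6 \<and>
    pair_form g J = omega6 f \<and> (\<lambda>vs. Re (\<Psi> vs)) = psip6 f \<and> (\<lambda>vs. Im (\<Psi> vs)) = psim6 f"
proof -
  obtain b0 where U0: "unitary_frame g J 2 b0" using unitary_frame_exists[OF H, of 2] dim by auto
  have mult: "\<Psi> [J x, y, z] = \<i> * \<Psi> [x, y, z]" "\<Psi> [x, J y, z] = \<i> * \<Psi> [x, y, z]" "\<Psi> [x, y, J z] = \<i> * \<Psi> [x, y, z]" for x y z
    using \<Psi>(2)[unfolded complex_form_def, rule_format, of "[x, y, z]" 0]
      \<Psi>(2)[unfolded complex_form_def, rule_format, of "[x, y, z]" 1]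
      \<Psi>(2)[unfolded complex_form_def, rule_format, of "[x, y, z]" 2] by (simp_all add: numeral_2_eq_2)
  have rep: "\<Psi> [x, x, z] = 0" "\<Psi> [x, y, x] = 0" "\<Psi> [x, y, y] = 0" for x y z
    using \<Psi>(1) unfolding kform_def by auto
  have lin: "linear (\<lambda>v. \<Psi> (vs[i := v]))" if "length vs = 3" "i < 3" for vs i
    using \<Psi>(1) that unfolding kform_def by blast
  have "linear (\<lambda>v. \<Psi> [b0 1, b0 3, v])" using lin[of "[b0 1, b0 3, 0]" 2] by (simp add: numeral_2_eq_2)
  from exists_rotated[OF H U0 _ this mult(3)] dim obtain u r where
    u: "unit_orthogonal g 2 b0 u" and r: "\<Psi> [b0 1, b0 3, u] = complex_of_real r" "r \<ge> 0" by auto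
  define b where "b = b0(5 := u, 6 := J u)"
  have U: "unitary_frame g J 3 b" using unitary_frame_extend[OF H U0 u] by (simp add: b_def eval_nat_numeral)
  have F: "dual_frame 6 (\<lambda>i. g (b i)) b" "g = frame_metric 6 (\<lambda>i. g (b i))"
    using unitary_dual_frame[OF H U] dim by simp_all
  define f where "f i = g (b i)" for i
  have F: "dual_frame 6 f b" "g = frame_metric 6 f" using F by (simp_all flip: f_def)
  have J: "J (b 1) = b 2" "J (b 3) = b 4" "J (b 5) = b 6"
  proof -
    have "\<forall>i\<in>{1..3}. J (b (2 * i - 1)) = b (2 * i)" using U by (simp add: unitary_frame_def)
    from bspec[OF this, of 1] bspec[OF this, of 2] bspec[OF this, of 3]
    show "J (b 1) = b 2" "J (b 3) = b 4" "J (b 5) = b 6" by simp_all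
  qed
  have J': "J (b 2) = - b 1" "J (b 4) = - b 3" "J (b 6) = - b 5"
    using hermitian_J(1)[OF H] J by metis+
  have r': "\<Psi> [b 1, b 3, b 5] = complex_of_real r" using r(1) by (simp add: b_def)
  have ev: "ewedge f is (map b js) = ewedge_index is js" if "set is \<subseteq> {1..6}" "js \<in> set (combs k [1..<Suc 6])" for "is" js k
    by (rule ewedge_dual_frame[OF F(1)]) (use that(1) combs_frame_conditions[OF that(2)] in auto)
  note km = kform_forms6[OF F(1)]
  \<comment> \<open>Frame vectors with even index are J of their predecessors, so each of the 20
    components is \<open>r\<close> times a power of the imaginary unit, or zero.\<close>
  have tab: "\<forall>is\<in>set (combs 3 [1..<Suc 6]). \<Psi> (map b is) = complex_of_real r * Complex
    (ewedge_index [1, 3, 5] is - ewedge_index [1, 4, 6] is - ewedge_index [2, 3, 6] is - ewedge_index [2, 4, 5] is)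
    (ewedge_index [1, 3, 6] is + ewedge_index [1, 4, 5] is + ewedge_index [2, 3, 5] is - ewedge_index [2, 4, 6] is)"
    unfolding upt_1_6
    by (simp add: combs_numeral J[symmetric] mult rep r' complex_eq_iff del: One_nat_def)
  have Re: "(\<lambda>vs. Re (\<Psi> vs)) = (\<lambda>vs. r * psip6 f vs)"
  proof (rule kform_frame_eqI[OF F(1) kform_Re[OF \<Psi>(1)] kform_mult[OF km(2)]])
    fix "is" assume "is \<in> set (combs 3 [1..<Suc 6])"
    then show "Re (\<Psi> (map b is)) = r * psip6 f (map b is)" 
      using bspec[OF tab] unfolding psip6_def by (simp add: ev)
  qed
  have Im: "(\<lambda>vs. Im (\<Psi> vs)) = (\<lambda>vs. r * psim6 f vs)"
  proof (rule kform_frame_eqI[OF F(1) kform_Im[OF \<Psi>(1)] kform_mult[OF km(3)]])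
    fix "is" assume "is \<in> set (combs 3 [1..<Suc 6])"
    then show "Im (\<Psi> (map b is)) = r * psim6 f (map b is)" 
      using bspec[OF tab] unfolding psim6_def by (simp add: ev)
  qed
  have om: "pair_form g J = omega6 f"
  proof (rule kform_frame_eqI[OF F(1) kform_pair_form[OF H] km(1)])
    fix "is" assume T: "is \<in> set (combs 2 [1..<Suc 6])"
    have gb: "g (b i) (b j) = (if i = j then 1 else 0)" if "i \<in> {1..6}" "j \<in> {1..6}" for i j
      using U that by (simp add: unitary_frame_def)
    have gn: "g (- v) w = - g v w" for v w by (simp add: hermitian_simps[OF H])
    have "\<forall>is\<in>set (combs 2 [1..<Suc 6]). pair_form g J (map b is) =
      ewedge_index [1, 2] is + ewedge_index [3, 4] is + ewedge_index [5, 6] is"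
      unfolding upt_1_6
      by (simp add: combs_numeral pair_form_def J J' gb gn del: One_nat_def)
    then show "pair_form g J (map b is) = omega6 f (map b is)"
      using T unfolding omega6_def by (simp add: ev)
  qed
  \<comment> \<open>Here \<open>\<omega>\<^sup>3\<close> is 6 times the volume form, and the product
    of real and imaginary part of \<Psi> is \<open>4 * r * r\<close> times it; hence
    \<open>12 * (r * r) = 12\<close>.\<close>
  have "3 * (r * (r * (psip6 f \<^bold>\<and> psim6 f) (map b [1, 2, 3, 4, 5, 6]))) =
    2 * (omega6 f \<^bold>\<and> omega6 f \<^bold>\<and> omega6 f) (map b [1, 2, 3, 4, 5, 6])"
    using norm[of "map b [1, 2, 3, 4, 5, 6]"] unfolding Re Im om by (simp add: wedge_linear del: list.map)
  then have "12 * (r * r) = 12"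
    unfolding forms6_defs
    by (simp add: dual_eval ewedge_dual_frame[OF F(1)] del: list.map One_nat_def)
  then have "r * r = 1" by simp
  then have "r = 1" using r(2) by (metis abs_of_nonneg real_sqrt_abs2 real_sqrt_one)
  then show ?thesis using F J om Re Im by (intro exI[of _ f] exI[of _ b]) simp
qed

text \<open>The argument of \<open>su3_frame\<close> with one complex line before the rotated one.
  The squares of \<omega> and of the real part of \<Psi> are 2 and \<open>2 * r * r\<close> times
  the volume form.\<close>

lemma su2_frame:
  fixes g :: "'w::euclidean_space \<Rightarrow> 'w \<Rightarrow> real"
  assumes H: "hermitian_pair g J" and dim: "DIM('w) = 4" and \<Psi>: "kform 2 \<Psi>" "complex_form 2 J \<Psi>"
    and norm: "\<And>vs. (pair_form g J \<^bold>\<and> pair_form g J) vs = ((\<lambda>vs. Re (\<Psi> vs)) \<^bold>\<and> (\<lambda>vs. Re (\<Psi> vs))) vs"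
  shows "\<exists>f b. dual_frame 4 f b \<and> g = frame_metric 4 f \<and> J (b 1) = b 2 \<and> J (b 3) = b 4 \<and>
    pair_form g J = omega4 f \<and> (\<lambda>vs. Re (\<Psi> vs)) = psip4 f \<and> (\<lambda>vs. Im (\<Psi> vs)) = psim4 f"
proof -
  obtain b0 where U0: "unitary_frame g J 1 b0" using unitary_frame_exists[OF H, of 1] dim by auto
  have mult: "\<Psi> [J x, y] = \<i> * \<Psi> [x, y]" "\<Psi> [x, J y] = \<i> * \<Psi> [x, y]" for x y
    using \<Psi>(2)[unfolded complex_form_def, rule_format, of "[x, y]" 0]
      \<Psi>(2)[unfolded complex_form_def, rule_format, of "[x, y]" 1] by simp_all
  have rep: "\<Psi> [x, x] = 0" for x
    using \<Psi>(1) unfolding kform_def by auto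
  have lin: "linear (\<lambda>v. \<Psi> (vs[i := v]))" if "length vs = 2" "i < 2" for vs i
    using \<Psi>(1) that unfolding kform_def by blast
  have "linear (\<lambda>v. \<Psi> [b0 1, v])" using lin[of "[b0 1, 0]" 1] by simp
  from exists_rotated[OF H U0 _ this mult(2)] dim obtain u r where
    u: "unit_orthogonal g 1 b0 u" and r: "\<Psi> [b0 1, u] = complex_of_real r" "r \<ge> 0" by auto
  define b where "b = b0(3 := u, 4 := J u)"
  have U: "unitary_frame g J 2 b" using unitary_frame_extend[OF H U0 u] by (simp add: b_def eval_nat_numeral)
  have F: "dual_frame 4 (\<lambda>i. g (b i)) b" "g = frame_metric 4 (\<lambda>i. g (b i))"
    using unitary_dual_frame[OF H U] dim by simp_all
  define f where "f i = g (b i)" for i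
  have F: "dual_frame 4 f b" "g = frame_metric 4 f" using F by (simp_all flip: f_def)
  have J: "J (b 1) = b 2" "J (b 3) = b 4"
  proof -
    have "\<forall>i\<in>{1..2}. J (b (2 * i - 1)) = b (2 * i)" using U by (simp add: unitary_frame_def)
    from bspec[OF this, of 1] bspec[OF this, of 2]
    show "J (b 1) = b 2" "J (b 3) = b 4" by simp_all
  qed
  have J': "J (b 2) = - b 1" "J (b 4) = - b 3"
    using hermitian_J(1)[OF H] J by metis+
  have r': "\<Psi> [b 1, b 3] = complex_of_real r" using r(1) by (simp add: b_def)
  have ev: "ewedge f is (map b js) = ewedge_index is js" if "set is \<subseteq> {1..4}" "js \<in> set (combs k [1..<Suc 4])" for "is" js k
    by (rule ewedge_dual_frame[OF F(1)]) (use that(1) combs_frame_conditions[OF that(2)] in auto)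
  note km = kform_forms4[OF F(1)]
  have tab: "\<forall>is\<in>set (combs 2 [1..<Suc 4]). \<Psi> (map b is) = complex_of_real r * Complex
    (ewedge_index [1, 3] is - ewedge_index [2, 4] is) (ewedge_index [1, 4] is + ewedge_index [2, 3] is)"
    unfolding upt_1_4
    by (simp add: combs_numeral J[symmetric] mult rep r' complex_eq_iff del: One_nat_def)
  have Re: "(\<lambda>vs. Re (\<Psi> vs)) = (\<lambda>vs. r * psip4 f vs)"
  proof (rule kform_frame_eqI[OF F(1) kform_Re[OF \<Psi>(1)] kform_mult[OF km(2)]])
    fix "is" assume "is \<in> set (combs 2 [1..<Suc 4])"
    then show "Re (\<Psi> (map b is)) = r * psip4 f (map b is)" 
      using bspec[OF tab] unfolding psip4_def by (simp add: ev)
  qed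
  have Im: "(\<lambda>vs. Im (\<Psi> vs)) = (\<lambda>vs. r * psim4 f vs)"
  proof (rule kform_frame_eqI[OF F(1) kform_Im[OF \<Psi>(1)] kform_mult[OF km(3)]])
    fix "is" assume "is \<in> set (combs 2 [1..<Suc 4])"
    then show "Im (\<Psi> (map b is)) = r * psim4 f (map b is)" 
      using bspec[OF tab] unfolding psim4_def by (simp add: ev)
  qed
  have om: "pair_form g J = omega4 f"
  proof (rule kform_frame_eqI[OF F(1) kform_pair_form[OF H] km(1)])
    fix "is" assume T: "is \<in> set (combs 2 [1..<Suc 4])"
    have gb: "g (b i) (b j) = (if i = j then 1 else 0)" if "i \<in> {1..4}" "j \<in> {1..4}" for i j
      using U that by (simp add: unitary_frame_def)
    have gn: "g (- v) w = - g v w" for v w by (simp add: hermitian_simps[OF H])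
    have "\<forall>is\<in>set (combs 2 [1..<Suc 4]). pair_form g J (map b is) =
      ewedge_index [1, 2] is + ewedge_index [3, 4] is"
      unfolding upt_1_4
      by (simp add: combs_numeral pair_form_def J J' gb gn del: One_nat_def)
    then show "pair_form g J (map b is) = omega4 f (map b is)"
      using T unfolding omega4_def by (simp add: ev)
  qed
  have "(omega4 f \<^bold>\<and> omega4 f) (map b [1, 2, 3, 4]) = r * (r * (psip4 f \<^bold>\<and> psip4 f) (map b [1, 2, 3, 4]))"
    using norm[of "map b [1, 2, 3, 4]"] unfolding Re om by (simp add: wedge_linear del: list.map)
  then have "2 * (r * r) = 2"
    unfolding forms4_defs
    by (simp add: dual_eval ewedge_dual_frame[OF F(1)] del: list.map One_nat_def)
  then have "r * r = 1" by simp
  then have "r = 1" using r(2) by (metis abs_of_nonneg real_sqrt_abs2 real_sqrt_one)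
  then show ?thesis using F J om Re Im by (intro exI[of _ f] exI[of _ b]) simp
qed

section \<open>The Lee form\<close>

lemma wedge_commute_even:
  "degree_form 2 (\<alpha> :: _ \<Rightarrow> 'b::comm_ring_1) \<Longrightarrow> degree_form k \<beta> \<Longrightarrow> \<alpha> \<^bold>\<and> \<beta> = \<beta> \<^bold>\<and> \<alpha>"
  using wedge_commute[of 2 \<alpha> k \<beta>] by (auto simp: fun_eq_iff)

lemma grade_inv_even: "degree_form 2 \<alpha> \<Longrightarrow> grade_inv \<alpha> = \<alpha>"
  by (simp add: grade_inv_degree fun_eq_iff)

lemma ins_one_form: "degree_form 1 \<theta> \<Longrightarrow> ins v \<theta> = (\<lambda>vs. \<theta> [v] * wedge_one vs)"
  by (auto simp: ins_def degree_form_def wedge_one_def fun_eq_iff neq_Nil_conv)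

lemma kform_degree_form: "kform k \<alpha> \<Longrightarrow> degree_form k (\<alpha> :: _ \<Rightarrow> real)"
  by (simp add: kform_iff)

lemma one_form_covector: "degree_form 1 \<theta> \<Longrightarrow> \<theta> = covector (\<lambda>v. \<theta> [v])"
  by (auto simp: covector_def degree_form_def fun_eq_iff split: list.splits)

lemma linear_one_form: "kform 1 (\<theta> :: _ \<Rightarrow> real) \<Longrightarrow> linear (\<lambda>v. \<theta> [v])"
  using multi_linear[of \<theta> "[]" "[]"] by (simp add: kform_iff)

text \<open>The equation \<open>d\<omega>\<^sup>n\<^sup>-\<^sup>1 = \<theta> \<and>
  \<omega>\<^sup>n\<^sup>-\<^sup>1\<close> at a point, where \<gamma> stands for
  \<open>d\<omega>\<close>. The factor 2 is that of
  \<open>d\<omega>\<^sup>2 = 2 \<omega> \<and> d\<omega>\<close>; having \<theta> on the right costs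
  no sign, as \<omega> has even degree.\<close>

definition lee_relation :: "nat \<Rightarrow> ('w::real_vector list \<Rightarrow> real) \<Rightarrow> ('w list \<Rightarrow> real) \<Rightarrow> ('w list \<Rightarrow> real) \<Rightarrow> bool" where
  "lee_relation n \<omega> \<gamma> \<theta> \<longleftrightarrow> kform 1 \<theta> \<and> (n = 2 \<longrightarrow> \<gamma> = \<omega> \<^bold>\<and> \<theta>) \<and>
     (n = 3 \<longrightarrow> (\<lambda>vs. 2 * (\<omega> \<^bold>\<and> \<gamma>) vs) = \<omega> \<^bold>\<and> \<omega> \<^bold>\<and> \<theta>)"

lemma kform_above_dim:
  assumes "kform k (\<alpha> :: 'w::euclidean_space list \<Rightarrow> real)" "dual_frame m f (b :: nat \<Rightarrow> 'w)" "m < k"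
  shows "\<alpha> = (\<lambda>_. 0)"
proof -
  have c: "combs k xs = []" if "length xs < k" for xs :: "nat list" and k
    using that by (induction k xs rule: combs.induct) auto
  show ?thesis
    by (rule kform_frame_eqI[OF assms(2,1) kform_zero]) (use c[of "[1..<Suc m]" k] assms(3) in simp)
qed

lemma combs_length_self: "combs (length xs) xs = [xs]"
proof (induction xs)
  case (Cons x xs)
  have "combs k ys = []" if "length ys < k" for ys :: "'a list" and k
    using that by (induction k ys rule: combs.induct) auto
  then show ?case using Cons by simp
qed simp

text \<open>Applied to the standard basis as \<open>s\<close>, this provides a denominator that
  vanishes nowhere on a chart.\<close>

lemma top_form_nonzero:
  assumes "kform m (\<alpha> :: 'w::euclidean_space list \<Rightarrow> real)" "length s = m" "span (set s) = UNIV" "\<alpha> vs \<noteq> 0"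
  shows "\<alpha> s \<noteq> 0"
proof
  assume z: "\<alpha> s = 0"
  have "\<alpha> vs = 0"
  proof (rule multi_zero_on_span[of \<alpha> s])
    show "multi \<alpha>" using assms by (simp add: kform_iff)
    show "set vs \<subseteq> span (set s)" using assms by simp
    show "\<alpha> ws = 0" if "ws \<in> set (combs k s)" for k ws
    proof (cases "k = m")
      case True
      then show ?thesis using that z combs_length_self[of s] assms(2) by simp
    next
      case False
      then show ?thesis using combs_length[OF that] kform_degree[OF assms(1)] by simp
    qed
  qed
  then show False using assms(4) by simp
qed

text \<open>Contracting \<open>\<omega>\<^sup>n \<and> \<theta> = 0\<close> with \<open>v\<close> isolates \<open>\<theta>(v)\<close>.\<close>

lemma lee_formula:
  assumes n: "n \<in> {2, 3}" and F: "dual_frame (2 * n) f (b :: nat \<Rightarrow> 'w::euclidean_space)"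
    and \<omega>: "kform 2 (\<omega> :: 'w list \<Rightarrow> real)" and lee: "lee_relation n \<omega> \<gamma> \<theta>"
  shows "\<theta> [v] * wedge_pow \<omega> n s = real (n * (n - 1)) * (wedge_pow \<omega> (n - 2) \<^bold>\<and> \<gamma> \<^bold>\<and> ins v \<omega>) s"
proof -
  let ?\<iota> = "ins v \<omega>"
  have \<theta>: "kform 1 \<theta>" using lee by (simp add: lee_relation_def)
  have \<iota>: "kform 1 ?\<iota>" using \<omega> by (intro kform_ins) (simp add: numeral_2_eq_2)
  note d = kform_degree_form[OF \<omega>] kform_degree_form[OF \<theta>] kform_degree_form[OF \<iota>]
  have comm: "\<omega> \<^bold>\<and> \<beta> = \<beta> \<^bold>\<and> \<omega>" if "degree_form k \<beta>" for k \<beta> by (rule wedge_commute_even[OF d(1) that])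
  have c1: "\<omega> \<^bold>\<and> ?\<iota> \<^bold>\<and> \<beta> = ?\<iota> \<^bold>\<and> \<omega> \<^bold>\<and> \<beta>" for \<beta> using comm[OF d(3)] by (metis wedge_assoc)
  have c2: "\<omega> \<^bold>\<and> \<theta> \<^bold>\<and> \<beta> = \<theta> \<^bold>\<and> \<omega> \<^bold>\<and> \<beta>" for \<beta> using comm[OF d(2)] by (metis wedge_assoc)
  have \<theta>\<iota>: "(?\<iota> \<^bold>\<and> \<theta>) = (\<lambda>vs. - (\<theta> \<^bold>\<and> ?\<iota>) vs)" using wedge_commute[OF d(3,2)] by (simp add: fun_eq_iff)
  have one: "\<omega> \<^bold>\<and> (\<lambda>vs. c * wedge_one vs) = (\<lambda>vs. c * \<omega> vs)" for c by (simp add: fun_eq_iff wedge_linear wedge_one_right)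
  note ev = ins_wedge grade_inv_even[OF d(1)] ins_one_form[OF d(2)] wedge_linear one \<theta>\<iota> c1[symmetric]
  show ?thesis
  proof (cases "n = 2")
    case True
    \<comment> \<open>A form of degree 5 on a space of dimension 4, hence zero; its contraction with
      \<open>v\<close> is the equation wanted.\<close>
    have "kform 5 (\<omega> \<^bold>\<and> \<omega> \<^bold>\<and> \<theta>)" by (rule kform_wedge_eq[OF \<omega> kform_wedge[OF \<omega> \<theta>]]) simp
    then have "\<omega> \<^bold>\<and> \<omega> \<^bold>\<and> \<theta> = (\<lambda>_. 0)" using F by (rule kform_above_dim) (simp add: True)
    then have "ins v (\<omega> \<^bold>\<and> \<omega> \<^bold>\<and> \<theta>) s = 0" by (simp add: ins_def)
    then have "\<theta> [v] * (\<omega> \<^bold>\<and> \<omega>) s = 2 * (\<omega> \<^bold>\<and> \<theta> \<^bold>\<and> ?\<iota>) s" by (simp add: ev)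
    then show ?thesis using lee True
      by (simp add: lee_relation_def numeral_2_eq_2 wedge_one_right wedge_one_left wedge_assoc)
  next
    case False
    then have n3: "n = 3" using n by simp
    have "kform 7 (\<omega> \<^bold>\<and> \<omega> \<^bold>\<and> \<omega> \<^bold>\<and> \<theta>)" by (rule kform_wedge_eq[OF \<omega> kform_wedge[OF \<omega> kform_wedge[OF \<omega> \<theta>]]]) simp
    then have "\<omega> \<^bold>\<and> \<omega> \<^bold>\<and> \<omega> \<^bold>\<and> \<theta> = (\<lambda>_. 0)" using F by (rule kform_above_dim) (simp add: n3)
    then have "ins v (\<omega> \<^bold>\<and> \<omega> \<^bold>\<and> \<omega> \<^bold>\<and> \<theta>) s = 0" by (simp add: ins_def)
    \<comment> \<open>Of the factor \<open>n * (n - 1) = 6\<close>, the 3 comes from contracting the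
      three factors \<omega> and the 2 from the Lee relation.\<close>
    then have "\<theta> [v] * (\<omega> \<^bold>\<and> \<omega> \<^bold>\<and> \<omega>) s = 3 * (\<omega> \<^bold>\<and> \<omega> \<^bold>\<and> \<theta> \<^bold>\<and> ?\<iota>) s" by (simp add: ev wedge_linear[THEN ext] wedge_one_right)
    also have "\<omega> \<^bold>\<and> \<omega> \<^bold>\<and> \<theta> \<^bold>\<and> ?\<iota> = (\<omega> \<^bold>\<and> \<omega> \<^bold>\<and> \<theta>) \<^bold>\<and> ?\<iota>" by (simp add: wedge_assoc)
    also have "\<omega> \<^bold>\<and> \<omega> \<^bold>\<and> \<theta> = (\<lambda>vs. 2 * (\<omega> \<^bold>\<and> \<gamma>) vs)" using lee n3 by (simp add: lee_relation_def)
    finally show ?thesis using n3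
      by (simp add: numeral_3_eq_3 wedge_one_right wedge_one_left wedge_assoc wedge_linear)
  qed
qed

text \<open>By definition the Lee form is J applied to \<open>\<star> d \<star> \<omega>\<close>.
  The first part evaluates the inner star, so that
  \<open>d \<star> \<omega> = \<omega> \<and> d\<omega>\<close>; the second turns the outer star
  into the wedge equation that characterizes the Lee form.\<close>

lemma lee6:
  fixes f :: "nat \<Rightarrow> 'w::euclidean_space \<Rightarrow> real"
  assumes F: "dual_frame 6 f b" and J: "linear J" "\<And>v. J (J v) = - v" "J (b 1) = b 2" "J (b 3) = b 4" "J (b 5) = b 6"
    and \<mu>: "\<mu> = (\<lambda>vs. wedge_pow (omega6 f) 3 vs / fact 3)"
  shows "hodge (frame_metric 6 f) \<mu> (omega6 f) = (\<lambda>vs. 1 / 2 * (omega6 f \<^bold>\<and> omega6 f) vs)"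
    and "kform 3 \<gamma> \<Longrightarrow> lee_relation 3 (omega6 f) \<gamma> (\<lambda>vs. hodge (frame_metric 6 f) \<mu> (omega6 f \<^bold>\<and> \<gamma>) (map J vs))"
proof -
  note km = kform_forms6[OF F]
  let ?v = "ewedge f [1, 2, 3, 4, 5, 6]"
  have kv: "kform 6 ?v" by (rule kform_ewedge_dual[OF F]) simp_all
  have "omega6 f \<^bold>\<and> omega6 f \<^bold>\<and> omega6 f = (\<lambda>vs. 6 * ?v vs)"
  proof (rule kform_frame_eqI[OF F])
    show "kform 6 (omega6 f \<^bold>\<and> omega6 f \<^bold>\<and> omega6 f)" by (rule kform_wedge_eq[OF km(1) kform_wedge[OF km(1) km(1)]]) simp
    show "kform 6 (\<lambda>vs. 6 * ?v vs)" by (rule kform_mult[OF kv])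
    fix "is" assume "is \<in> set (combs 6 [1..<Suc 6])"
    then have "is": "is = [1, 2, 3, 4, 5, 6]" unfolding upt_1_6 by (simp add: combs_numeral del: One_nat_def)
    show "(omega6 f \<^bold>\<and> omega6 f \<^bold>\<and> omega6 f) (map b is) = 6 * ?v (map b is)"
      unfolding "is" omega6_def by (simp add: dual_eval ewedge_dual_frame[OF F] del: list.map One_nat_def)
  qed
  then have \<mu>v: "\<mu> = ?v" unfolding \<mu> by (simp add: numeral_3_eq_3 wedge_one_right fun_eq_iff)
  have vol: "?v (map b (filter (\<lambda>i. i \<notin> set T) [1..<Suc 6] @ T)) =
    ewedge_index [1, 2, 3, 4, 5, 6] (filter (\<lambda>i. i \<notin> set T) [1..<Suc 6] @ T)" if "T \<in> set (combs l [1..<Suc 6])" for T l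
    using combs_frame_conditions[OF that] by (intro ewedge_dual_frame[OF F]) auto
  note kh = kform_hodge[OF inner_product_frame_metric[OF F] orthonormal_frame_list[OF F]]
  show "hodge (frame_metric 6 f) \<mu> (omega6 f) = (\<lambda>vs. 1 / 2 * (omega6 f \<^bold>\<and> omega6 f) vs)"
    unfolding \<mu>v
  proof (rule kform_frame_eqI[OF F])
    show "kform 4 (hodge (frame_metric 6 f) ?v (omega6 f))" by (rule kh[OF km(1)]) (use kv in simp)
    show "kform 4 (\<lambda>vs. 1 / 2 * (omega6 f \<^bold>\<and> omega6 f) vs)" by (intro kform_mult kform_wedge_eq[OF km(1,1)]) simp
    fix "is" assume T: "is \<in> set (combs 4 [1..<Suc 6])"
    have "\<forall>is\<in>set (combs 4 [1..<Suc 6]). omega6 f (map b (filter (\<lambda>i. i \<notin> set is) [1..<Suc 6])) *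
      ewedge_index [1, 2, 3, 4, 5, 6] (filter (\<lambda>i. i \<notin> set is) [1..<Suc 6] @ is) =
      1 / 2 * (omega6 f \<^bold>\<and> omega6 f) (map b is)"
      unfolding upt_1_6 omega6_def
      by (simp add: combs_numeral dual_eval ewedge_dual_frame[OF F] del: One_nat_def list.map)
    then show "hodge (frame_metric 6 f) ?v (omega6 f) (map b is) = 1 / 2 * (omega6 f \<^bold>\<and> omega6 f) (map b is)"
      using T by (simp only: hodge_frame[OF F km(1) kv T] vol)
  qed
  assume \<gamma>: "kform 3 \<gamma>"
  have k5: "kform 5 (omega6 f \<^bold>\<and> \<gamma>)" by (rule kform_wedge_eq[OF km(1) \<gamma>]) simp
  define \<theta> where "\<theta> = (\<lambda>vs. hodge (frame_metric 6 f) \<mu> (omega6 f \<^bold>\<and> \<gamma>) (map J vs))"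
  have kh1: "kform 1 (hodge (frame_metric 6 f) \<mu> (omega6 f \<^bold>\<and> \<gamma>))" unfolding \<mu>v by (rule kh[OF k5]) (use kv in simp)
  then have k\<theta>: "kform 1 \<theta>" unfolding \<theta>_def by (rule kform_map[OF _ J(1)])
  have hh: "hodge (frame_metric 6 f) \<mu> (omega6 f \<^bold>\<and> \<gamma>) [b j] = (omega6 f \<^bold>\<and> \<gamma>) (map b (filter (\<lambda>i. i \<notin> set [j]) [1, 2, 3, 4, 5, 6])) *
    ewedge_index [1, 2, 3, 4, 5, 6] (filter (\<lambda>i. i \<notin> set [j]) [1, 2, 3, 4, 5, 6] @ [j])" if "j \<in> {1..6}" for j
  proof -
    have T: "[j] \<in> set (combs 1 [1..<Suc 6])" using that unfolding upt_1_6 by (auto simp: combs_numeral)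
    have "hodge (frame_metric 6 f) ?v (omega6 f \<^bold>\<and> \<gamma>) (map b [j]) = (omega6 f \<^bold>\<and> \<gamma>) (map b (filter (\<lambda>i. i \<notin> set [j]) [1..<Suc 6])) *
      ewedge_index [1, 2, 3, 4, 5, 6] (filter (\<lambda>i. i \<notin> set [j]) [1..<Suc 6] @ [j])"
      using hodge_frame[OF F k5 kv T] vol[OF T] by simp
    then show ?thesis unfolding \<mu>v upt_1_6 by simp
  qed
  have J': "J (b 2) = - b 1" "J (b 4) = - b 3" "J (b 6) = - b 5" using J by metis+
  note kh1m = kh1[unfolded kform_iff, THEN conjunct1]
  have neg: "hodge (frame_metric 6 f) \<mu> (omega6 f \<^bold>\<and> \<gamma>) [- v] = - hodge (frame_metric 6 f) \<mu> (omega6 f \<^bold>\<and> \<gamma>) [v]" for v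
    using linear_neg[OF multi_linear[OF kh1m, of "[]" "[]"]] by simp
  have ce: "(covector (f i) \<^bold>\<and> \<alpha>) (map b js) = dual_contract i (\<lambda>ks. \<alpha> (map b ks)) js"
    if "i \<in> {1..6}" "set js \<subseteq> {1..6}" "distinct js" for i js \<alpha>
    by (rule covector_wedge_dual_frame[OF F that])
  note ev = ce ewedge_Cons ewedge_Nil wedge_linear wedge_assoc wedge_one_left wedge_one_right
  \<comment> \<open>Each value is the trace of \<gamma> over the two complex lines that do not
    contain the vector.\<close>
  have \<theta>v: "\<theta> (map b [1]) = \<gamma> (map b [1, 3, 4]) + \<gamma> (map b [1, 5, 6])"
    "\<theta> (map b [2]) = \<gamma> (map b [2, 3, 4]) + \<gamma> (map b [2, 5, 6])"
    "\<theta> (map b [3]) = \<gamma> (map b [1, 2, 3]) + \<gamma> (map b [3, 5, 6])"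
    "\<theta> (map b [4]) = \<gamma> (map b [1, 2, 4]) + \<gamma> (map b [4, 5, 6])"
    "\<theta> (map b [5]) = \<gamma> (map b [1, 2, 5]) + \<gamma> (map b [3, 4, 5])"
    "\<theta> (map b [6]) = \<gamma> (map b [1, 2, 6]) + \<gamma> (map b [3, 4, 6])"
  proof -
    have t: "\<theta> (map b [j]) = hodge (frame_metric 6 f) \<mu> (omega6 f \<^bold>\<and> \<gamma>) [J (b j)]" for j by (simp add: \<theta>_def)
    show "\<theta> (map b [1]) = \<gamma> (map b [1, 3, 4]) + \<gamma> (map b [1, 5, 6])"
    "\<theta> (map b [2]) = \<gamma> (map b [2, 3, 4]) + \<gamma> (map b [2, 5, 6])"
    "\<theta> (map b [3]) = \<gamma> (map b [1, 2, 3]) + \<gamma> (map b [3, 5, 6])"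
    "\<theta> (map b [4]) = \<gamma> (map b [1, 2, 4]) + \<gamma> (map b [4, 5, 6])"
    "\<theta> (map b [5]) = \<gamma> (map b [1, 2, 5]) + \<gamma> (map b [3, 4, 5])"
    "\<theta> (map b [6]) = \<gamma> (map b [1, 2, 6]) + \<gamma> (map b [3, 4, 6])"
      unfolding t J J' neg
      by (simp_all add: hh del: One_nat_def list.map, simp_all add: omega6_def ev del: One_nat_def list.map)
  qed
  have "(\<lambda>vs. 2 * (omega6 f \<^bold>\<and> \<gamma>) vs) = omega6 f \<^bold>\<and> omega6 f \<^bold>\<and> \<theta>"
  proof (rule kform_frame_eqI[OF F kform_mult[OF k5]])
    show "kform 5 (omega6 f \<^bold>\<and> omega6 f \<^bold>\<and> \<theta>)" by (rule kform_wedge_eq[OF km(1) kform_wedge[OF km(1) k\<theta>]]) simp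
    fix "is" assume T: "is \<in> set (combs 5 [1..<Suc 6])"
    have "\<forall>is\<in>set (combs 5 [1..<Suc 6]). 2 * (omega6 f \<^bold>\<and> \<gamma>) (map b is) = (omega6 f \<^bold>\<and> omega6 f \<^bold>\<and> \<theta>) (map b is)"
      unfolding upt_1_6 omega6_def
      by (simp add: combs_numeral ev \<theta>v del: One_nat_def list.map)
    then show "2 * (omega6 f \<^bold>\<and> \<gamma>) (map b is) = (omega6 f \<^bold>\<and> omega6 f \<^bold>\<and> \<theta>) (map b is)" using T by blast
  qed
  then have "lee_relation 3 (omega6 f) \<gamma> \<theta>" using k\<theta> by (simp add: lee_relation_def)
  then show "lee_relation 3 (omega6 f) \<gamma> (\<lambda>vs. hodge (frame_metric 6 f) \<mu> (omega6 f \<^bold>\<and> \<gamma>) (map J vs))"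
    unfolding \<theta>_def .
qed

text \<open>In real dimension 4 the form \<omega> is self-dual, so
  \<open>\<star> d \<star> \<omega>\<close> is the star of \<open>d\<omega>\<close> itself.\<close>

lemma lee4:
  fixes f :: "nat \<Rightarrow> 'w::euclidean_space \<Rightarrow> real"
  assumes F: "dual_frame 4 f b" and J: "linear J" "\<And>v. J (J v) = - v" "J (b 1) = b 2" "J (b 3) = b 4"
    and \<mu>: "\<mu> = (\<lambda>vs. wedge_pow (omega4 f) 2 vs / fact 2)"
  shows "hodge (frame_metric 4 f) \<mu> (omega4 f) = omega4 f"
    and "kform 3 \<gamma> \<Longrightarrow> lee_relation 2 (omega4 f) \<gamma> (\<lambda>vs. hodge (frame_metric 4 f) \<mu> \<gamma> (map J vs))"
proof -
  note km = kform_forms4[OF F]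
  let ?v = "ewedge f [1, 2, 3, 4]"
  have kv: "kform 4 ?v" by (rule kform_ewedge_dual[OF F]) simp_all
  have "omega4 f \<^bold>\<and> omega4 f = (\<lambda>vs. 2 * ?v vs)"
  proof (rule kform_frame_eqI[OF F])
    show "kform 4 (omega4 f \<^bold>\<and> omega4 f)" by (rule kform_wedge_eq[OF km(1,1)]) simp
    show "kform 4 (\<lambda>vs. 2 * ?v vs)" by (rule kform_mult[OF kv])
    fix "is" assume "is \<in> set (combs 4 [1..<Suc 4])"
    then have "is": "is = [1, 2, 3, 4]" unfolding upt_1_4 by (simp add: combs_numeral del: One_nat_def)
    show "(omega4 f \<^bold>\<and> omega4 f) (map b is) = 2 * ?v (map b is)"
      unfolding "is" omega4_def by (simp add: dual_eval ewedge_dual_frame[OF F] del: list.map One_nat_def)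
  qed
  then have \<mu>v: "\<mu> = ?v" unfolding \<mu> by (simp add: numeral_2_eq_2 wedge_one_right fun_eq_iff)
  have vol: "?v (map b (filter (\<lambda>i. i \<notin> set T) [1..<Suc 4] @ T)) =
    ewedge_index [1, 2, 3, 4] (filter (\<lambda>i. i \<notin> set T) [1..<Suc 4] @ T)" if "T \<in> set (combs l [1..<Suc 4])" for T l
    using combs_frame_conditions[OF that] by (intro ewedge_dual_frame[OF F]) auto
  note kh = kform_hodge[OF inner_product_frame_metric[OF F] orthonormal_frame_list[OF F]]
  show "hodge (frame_metric 4 f) \<mu> (omega4 f) = omega4 f"
    unfolding \<mu>v
  proof (rule kform_frame_eqI[OF F])
    show "kform 2 (hodge (frame_metric 4 f) ?v (omega4 f))" by (rule kh[OF km(1)]) (use kv in simp)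
    show "kform 2 (omega4 f)" by (rule km)
    fix "is" assume T: "is \<in> set (combs 2 [1..<Suc 4])"
    have "\<forall>is\<in>set (combs 2 [1..<Suc 4]). omega4 f (map b (filter (\<lambda>i. i \<notin> set is) [1..<Suc 4])) *
      ewedge_index [1, 2, 3, 4] (filter (\<lambda>i. i \<notin> set is) [1..<Suc 4] @ is) = omega4 f (map b is)"
      unfolding upt_1_4 omega4_def
      by (simp add: combs_numeral dual_eval ewedge_dual_frame[OF F] del: One_nat_def list.map)
    then show "hodge (frame_metric 4 f) ?v (omega4 f) (map b is) = omega4 f (map b is)"
      using T by (simp only: hodge_frame[OF F km(1) kv T] vol)
  qed
  assume \<gamma>: "kform 3 \<gamma>"
  define \<theta> where "\<theta> = (\<lambda>vs. hodge (frame_metric 4 f) \<mu> \<gamma> (map J vs))"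
  have kh1: "kform 1 (hodge (frame_metric 4 f) \<mu> \<gamma>)" unfolding \<mu>v by (rule kh[OF \<gamma>]) (use kv in simp)
  then have k\<theta>: "kform 1 \<theta>" unfolding \<theta>_def by (rule kform_map[OF _ J(1)])
  have h: "hodge (frame_metric 4 f) \<mu> \<gamma> [b j] = \<gamma> (map b (filter (\<lambda>i. i \<notin> set [j]) [1, 2, 3, 4])) *
    ewedge_index [1, 2, 3, 4] (filter (\<lambda>i. i \<notin> set [j]) [1, 2, 3, 4] @ [j])" if "j \<in> {1..4}" for j
  proof -
    have T: "[j] \<in> set (combs 1 [1..<Suc 4])" using that unfolding upt_1_4 by (auto simp: combs_numeral)
    have "hodge (frame_metric 4 f) ?v \<gamma> (map b [j]) = \<gamma> (map b (filter (\<lambda>i. i \<notin> set [j]) [1..<Suc 4])) *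
      ewedge_index [1, 2, 3, 4] (filter (\<lambda>i. i \<notin> set [j]) [1..<Suc 4] @ [j])"
      using hodge_frame[OF F \<gamma> kv T] vol[OF T] by simp
    then show ?thesis unfolding \<mu>v upt_1_4 by simp
  qed
  have J': "J (b 2) = - b 1" "J (b 4) = - b 3" using J by metis+
  note kh1m = kh1[unfolded kform_iff, THEN conjunct1]
  have neg: "hodge (frame_metric 4 f) \<mu> \<gamma> [- v] = - hodge (frame_metric 4 f) \<mu> \<gamma> [v]" for v
    using linear_neg[OF multi_linear[OF kh1m, of "[]" "[]"]] by simp
  have ce: "(covector (f i) \<^bold>\<and> \<alpha>) (map b js) = dual_contract i (\<lambda>ks. \<alpha> (map b ks)) js"
    if "i \<in> {1..4}" "set js \<subseteq> {1..4}" "distinct js" for i js \<alpha>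
    by (rule covector_wedge_dual_frame[OF F that])
  note ev = ce ewedge_Cons ewedge_Nil wedge_linear wedge_assoc wedge_one_left wedge_one_right
  have t: "\<theta> (map b [j]) = hodge (frame_metric 4 f) \<mu> \<gamma> [J (b j)]" for j by (simp add: \<theta>_def)
  have \<theta>v: "\<theta> (map b [1]) = \<gamma> (map b [1, 3, 4])" "\<theta> (map b [2]) = \<gamma> (map b [2, 3, 4])"
    "\<theta> (map b [3]) = \<gamma> (map b [1, 2, 3])" "\<theta> (map b [4]) = \<gamma> (map b [1, 2, 4])"
    unfolding t J J' neg by (simp_all add: h neg del: One_nat_def list.map)
  have "\<gamma> = omega4 f \<^bold>\<and> \<theta>"
  proof (rule kform_frame_eqI[OF F \<gamma>])
    show "kform 3 (omega4 f \<^bold>\<and> \<theta>)" by (rule kform_wedge_eq[OF km(1) k\<theta>]) simp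
    fix "is" assume T: "is \<in> set (combs 3 [1..<Suc 4])"
    have "\<forall>is\<in>set (combs 3 [1..<Suc 4]). \<gamma> (map b is) = (omega4 f \<^bold>\<and> \<theta>) (map b is)"
      unfolding upt_1_4 omega4_def
      by (simp add: combs_numeral ev \<theta>v del: One_nat_def list.map)
    then show "\<gamma> (map b is) = (omega4 f \<^bold>\<and> \<theta>) (map b is)" using T by blast
  qed
  then have "lee_relation 2 (omega4 f) \<gamma> \<theta>" using k\<theta> by (simp add: lee_relation_def)
  then show "lee_relation 2 (omega4 f) \<gamma> (\<lambda>vs. hodge (frame_metric 4 f) \<mu> \<gamma> (map J vs))"
    unfolding \<theta>_def .
qed

section \<open>The \<open>G\<^sub>2\<close>-structure \<open>dt \<and> \<omega> + \<psi>\<^sub>+\<close> in a chart\<close>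

text \<open>The bookkeeping of an \<open>SU(3)\<close>-structure on the kernel of \<open>dt\<close> in a \<open>7\<close>-dimensional chart. The
  case \<open>n = 2\<close> fits in with \<open>\<omega> + dt\<^sup>2 \<and> dt\<^sup>3\<close> and \<open>(dt\<^sup>2 + i dt\<^sup>3) \<and> \<Psi>\<close> in place of \<open>\<omega>\<close> and \<open>\<Psi>\<close>.
  The map \<open>L\<close> extends the complex structure of the kernel of \<open>dt\<close>.\<close>

locale g2_chart =
  fixes U :: "'v::euclidean_space set" and dt :: "'v \<Rightarrow> real"
    and om psp psm \<theta> :: "'v \<Rightarrow> 'v list \<Rightarrow> real" and L :: "'v \<Rightarrow> 'v \<Rightarrow> 'v"
  assumes U: "open U"
    and frame_ex: "\<And>z. z \<in> U \<Longrightarrow> \<exists>e b. dual_frame 7 e b \<and> dt = e 1 \<and> om z = model_omega e \<and>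
      psp z = model_psip e \<and> psm z = model_psim e \<and> (\<forall>ws. local_d om z (b 1 # ws) = 0) \<and> \<theta> z [b 1] = 0 \<and>
      linear (L z) \<and> L z (b 1) = 0 \<and> L z (b 2) = b 3 \<and> L z (b 3) = - b 2 \<and> L z (b 4) = b 5 \<and> L z (b 5) = - b 4 \<and>
      L z (b 6) = b 7 \<and> L z (b 7) = - b 6"
    and diff: "\<And>z. z \<in> U \<Longrightarrow> coeffs_diff om z" "\<And>z. z \<in> U \<Longrightarrow> coeffs_diff psp z" "\<And>z. z \<in> U \<Longrightarrow> coeffs_diff psm z"
    and \<theta>: "\<And>z. z \<in> U \<Longrightarrow> kform 1 (\<theta> z)"
    and d_psp: "\<And>z. z \<in> U \<Longrightarrow> local_d psp z = \<theta> z \<^bold>\<and> psp z"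
    and d_psm: "\<And>z. z \<in> U \<Longrightarrow> local_d psm z = \<theta> z \<^bold>\<and> psm z"
    and lee: "\<And>z. z \<in> U \<Longrightarrow> (\<lambda>vs. 2 * (om z \<^bold>\<and> local_d om z) vs) = \<theta> z \<^bold>\<and> om z \<^bold>\<and> om z"
begin

definition phi :: "'v \<Rightarrow> 'v list \<Rightarrow> real" where
  "phi z = (\<lambda>vs. (covector dt \<^bold>\<and> om z) vs + psp z vs)"

lemma kforms: "z \<in> U \<Longrightarrow> kform 2 (om z)" "z \<in> U \<Longrightarrow> kform 3 (psp z)" "z \<in> U \<Longrightarrow> kform 3 (psm z)" "z \<in> U \<Longrightarrow> linear dt"
proof -
  assume z: "z \<in> U"
  from frame_ex[OF z] obtain e b where e: "dual_frame 7 e b" "dt = e 1" "om z = model_omega e"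
      "psp z = model_psip e" "psm z = model_psim e" by blast
  interpret g2_frame e b by unfold_locales (rule e)
  show "kform 2 (om z)" "kform 3 (psp z)" "kform 3 (psm z)" "linear dt"
    using kform_models e_linear[of 1] e by simp_all
qed

lemma gamma_kform: "z \<in> U \<Longrightarrow> kform 3 (local_d om z)"
  using kform_local_d[OF U _ kforms(1) diff(1), of z] by (simp add: numeral_3_eq_3)

lemma om_psi: "z \<in> U \<Longrightarrow> om z \<^bold>\<and> psp z = (\<lambda>_. 0)"
proof -
  assume z: "z \<in> U"
  from frame_ex[OF z] obtain e b where e: "dual_frame 7 e b" "om z = model_omega e" "psp z = model_psip e" by blast
  interpret g2_frame e b by unfold_locales (rule e)
  show ?thesis using omega_wedge_psi e by simp
qed

lemma adapted:
  assumes "z \<in> U" shows "\<exists>e. g2_adapted (phi z) e"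
proof -
  from frame_ex[OF assms] obtain e b where e: "dual_frame 7 e b" "dt = e 1" "om z = model_omega e"
      "psp z = model_psip e" by blast
  have "phi z = g2_model e" unfolding phi_def unfolding g2_model_eq e(2) e(3) e(4) ..
  then have "g2_adapted (phi z) e" using e(1) by (simp add: g2_adapted_def dual_frame_coframe7)
  then show ?thesis by blast
qed

lemma star_phi:
  assumes "z \<in> U" "\<phi> d z = phi z"
  shows "g2_star \<phi> \<phi> d z = (\<lambda>vs. 1 / 2 * (om z \<^bold>\<and> om z) vs - (covector dt \<^bold>\<and> psm z) vs)"
proof -
  from frame_ex[OF assms(1)] obtain e b where e: "dual_frame 7 e b" "dt = e 1" "om z = model_omega e"
      "psp z = model_psip e" "psm z = model_psim e" by blast
  interpret g2_frame e b by unfold_locales (rule e)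
  have p: "\<phi> d z = g2_model e" unfolding assms(2) phi_def unfolding g2_model_eq e(2) e(3) e(4) ..
  then have "g2_adapted (\<phi> d z) e" using e(1) by (simp add: g2_adapted_def dual_frame_coframe7)
  from g2_adapted_metric[of \<phi> d z, OF this] show ?thesis
    using star_model p e by (simp add: g2_star_def fhodge_def)
qed

lemma covector_dt_square: "z \<in> U \<Longrightarrow> covector dt \<^bold>\<and> covector dt = (\<lambda>_. 0)"
  using wedge_commute[OF degree_form_covector[of dt] degree_form_covector[of dt]] by (simp add: fun_eq_iff)

lemma d_phi:
  assumes z: "z \<in> U"
  shows "local_d phi z = (\<lambda>vs. (\<theta> z \<^bold>\<and> psp z) vs - (covector dt \<^bold>\<and> local_d om z) vs)"
proof -
  have "local_d phi z vs = local_d (\<lambda>y. covector dt \<^bold>\<and> om y) z vs + local_d psp z vs" for vs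
    unfolding phi_def[abs_def]
    by (intro local_d_simps(1) coeffs_diff_wedge coeffs_diff_const diff z)
  moreover have "local_d (\<lambda>y. covector dt \<^bold>\<and> om y) z vs = - (covector dt \<^bold>\<and> local_d om z) vs" for vs
    using local_d_wedge[OF coeffs_diff_const diff(1)[OF z], of "covector dt" vs]
    by (simp add: local_d_const grade_inv_degree[OF degree_form_covector] wedge_linear)
  ultimately show ?thesis by (simp add: d_psp[OF z] fun_eq_iff)
qed

lemma gamma_psi:
  assumes z: "z \<in> U"
  shows "local_d om z \<^bold>\<and> psp z = (\<lambda>_. 0)"
proof -
  note k = kforms[OF z] \<theta>[OF z]
  note d = kform_degree_form[OF k(1)] kform_degree_form[OF k(5)]
  have "local_d (\<lambda>y. om y \<^bold>\<and> psp y) z = local_d (\<lambda>y. (\<lambda>_. 0)) z"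
    by (rule local_d_cong[OF U z om_psi])
  then have "(local_d om z \<^bold>\<and> psp z) vs + (om z \<^bold>\<and> \<theta> z \<^bold>\<and> psp z) vs = 0" for vs
    using local_d_wedge[OF diff(1)[OF z] diff(2)[OF z], of vs] by (simp add: local_d_const d_psp[OF z] grade_inv_even[OF d(1)])
  \<comment> \<open>With \<theta> moved to the front, the product of \<open>om z\<close> and
    \<open>psp z\<close> reappears and vanishes.\<close>
  moreover have "om z \<^bold>\<and> \<theta> z \<^bold>\<and> psp z = \<theta> z \<^bold>\<and> om z \<^bold>\<and> psp z"
    using wedge_commute_even[OF d] by (metis wedge_assoc)
  ultimately have "(local_d om z \<^bold>\<and> psp z) vs = 0" for vs by (simp add: om_psi[OF z] wedge_linear)
  then show ?thesis by blast
qed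

text \<open>Of the four products, one contains \<open>dt\<close> twice, one contains the odd form
  \<open>psp z\<close> twice, one contains \<open>psp z\<close> next to \<open>om z\<close> once
  \<open>dt\<close> is moved away, and the last is \<open>gamma_psi\<close>.\<close>

lemma d_phi_wedge_phi:
  assumes z: "z \<in> U"
  shows "local_d phi z \<^bold>\<and> phi z = (\<lambda>_. 0)"
proof -
  let ?dt = "covector dt" and ?\<gamma> = "local_d om z"
  note k = kforms[OF z] \<theta>[OF z] gamma_kform[OF z]
  note d = kform_degree_form[OF k(1)] kform_degree_form[OF k(2)] kform_degree_form[OF k(6)]
  have c: "?\<gamma> \<^bold>\<and> ?dt = (\<lambda>vs. - (?dt \<^bold>\<and> ?\<gamma>) vs)" "psp z \<^bold>\<and> ?dt = (\<lambda>vs. - (?dt \<^bold>\<and> psp z) vs)"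
    using wedge_commute[OF d(3) degree_form_covector] wedge_commute[OF d(2) degree_form_covector] by (simp_all add: fun_eq_iff)
  have 1: "psp z \<^bold>\<and> psp z = (\<lambda>_. 0)" using wedge_commute[OF d(2,2)] by (simp add: fun_eq_iff)
  have 2: "?dt \<^bold>\<and> ?\<gamma> \<^bold>\<and> ?dt \<^bold>\<and> om z = (\<lambda>_. 0)"
  proof -
    have "?dt \<^bold>\<and> ?\<gamma> \<^bold>\<and> ?dt \<^bold>\<and> om z = ?dt \<^bold>\<and> (?\<gamma> \<^bold>\<and> ?dt) \<^bold>\<and> om z" by (simp add: wedge_assoc)
    also have "\<dots> = (\<lambda>vs. - ((?dt \<^bold>\<and> ?dt) \<^bold>\<and> ?\<gamma> \<^bold>\<and> om z) vs)"
      unfolding c by (simp add: wedge_linear[THEN ext] wedge_assoc)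
    finally show ?thesis by (simp add: covector_dt_square[OF z] wedge_linear)
  qed
  have 3: "psp z \<^bold>\<and> ?dt \<^bold>\<and> om z = (\<lambda>_. 0)"
  proof -
    have "psp z \<^bold>\<and> ?dt \<^bold>\<and> om z = (psp z \<^bold>\<and> ?dt) \<^bold>\<and> om z" by (simp add: wedge_assoc)
    also have "\<dots> = (\<lambda>vs. - (?dt \<^bold>\<and> psp z \<^bold>\<and> om z) vs)"
      unfolding c by (simp add: wedge_linear[THEN ext] wedge_assoc)
    also have "psp z \<^bold>\<and> om z = om z \<^bold>\<and> psp z" by (rule wedge_commute_even[OF d(1,2), symmetric])
    finally show ?thesis by (simp add: om_psi[OF z] wedge_linear)
  qed
  show ?thesis
    unfolding d_phi[OF z] phi_def
    by (rule ext) (simp add: wedge_linear wedge_assoc gamma_psi[OF z] 1 2 3)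
qed

lemma d_star_phi:
  assumes z: "z \<in> U" and \<phi>: "\<And>y. y \<in> U \<Longrightarrow> \<phi> d y = phi y"
  shows "local_d (g2_star \<phi> \<phi> d) z = \<theta> z \<^bold>\<and> g2_star \<phi> \<phi> d z"
proof -
  let ?dt = "covector dt" and ?\<gamma> = "local_d om z"
  let ?S = "\<lambda>y vs. 1 / 2 * (om y \<^bold>\<and> om y) vs - (?dt \<^bold>\<and> psm y) vs"
  note k = kforms[OF z] \<theta>[OF z] gamma_kform[OF z]
  note d = kform_degree_form[OF k(1)] kform_degree_form[OF k(5)] kform_degree_form[OF k(6)]
  \<comment> \<open>The formula for the star holds on all of \<open>U\<close>, as differentiating it
    requires.\<close>
  have S: "g2_star \<phi> \<phi> d y = ?S y" if "y \<in> U" for y by (rule star_phi[where \<phi> = \<phi> and d = d, OF that \<phi>[OF that]])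
  have c: "?\<gamma> \<^bold>\<and> om z = om z \<^bold>\<and> ?\<gamma>" by (rule wedge_commute_even[OF d(1,3), symmetric])
  have c2: "\<theta> z \<^bold>\<and> ?dt = (\<lambda>vs. - (?dt \<^bold>\<and> \<theta> z) vs)"
    using wedge_commute[OF d(2) degree_form_covector] by (simp add: fun_eq_iff)
  have dd: "coeffs_diff (\<lambda>y. om y \<^bold>\<and> om y) z" "coeffs_diff (\<lambda>y. ?dt \<^bold>\<and> psm y) z"
    by (intro coeffs_diff_wedge coeffs_diff_const diff z)+
  have "local_d (g2_star \<phi> \<phi> d) z vs = (\<theta> z \<^bold>\<and> g2_star \<phi> \<phi> d z) vs" for vs
  proof -
    have "local_d (g2_star \<phi> \<phi> d) z vs = local_d ?S z vs"
      by (rule fun_cong[OF local_d_cong[OF U z S]])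
    also have "\<dots> = 1 / 2 * local_d (\<lambda>y. om y \<^bold>\<and> om y) z vs - local_d (\<lambda>y. ?dt \<^bold>\<and> psm y) z vs"
      using local_d_simps(2)[OF coeffs_diff_simps(3)[OF dd(1)] dd(2), of "1 / 2" vs] local_d_simps(3)[OF dd(1), of "1 / 2" vs] by simp
    also have "\<dots> = (om z \<^bold>\<and> ?\<gamma>) vs + (?dt \<^bold>\<and> \<theta> z \<^bold>\<and> psm z) vs"
      using local_d_wedge[OF diff(1)[OF z] diff(1)[OF z], of vs] local_d_wedge[OF coeffs_diff_const diff(3)[OF z], of "?dt" vs]
      by (simp add: local_d_const grade_inv_degree[OF degree_form_covector] grade_inv_even[OF d(1)] wedge_linear c d_psm[OF z])
    also have "(?dt \<^bold>\<and> \<theta> z \<^bold>\<and> psm z) vs = - (\<theta> z \<^bold>\<and> ?dt \<^bold>\<and> psm z) vs"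
    proof -
      have "\<theta> z \<^bold>\<and> ?dt \<^bold>\<and> psm z = (\<theta> z \<^bold>\<and> ?dt) \<^bold>\<and> psm z" by (simp add: wedge_assoc)
      then show ?thesis unfolding c2 by (simp add: wedge_linear wedge_assoc)
    qed
    finally show ?thesis using fun_cong[OF lee[OF z], of vs] unfolding S[OF z] wedge_linear by simp
  qed
  then show ?thesis by blast
qed

lemma torsion:
  assumes z: "z \<in> U" and \<phi>: "\<And>y. y \<in> U \<Longrightarrow> \<phi> d y = phi y" and \<Theta>: "\<Theta> d z = \<theta> z"
  shows "g2_torsion \<phi> \<Theta> d z = (\<lambda>vs. local_d om z (map (L z) vs))"
proof -
  let ?dt = "covector dt" and ?\<gamma> = "local_d om z"
  from frame_ex[OF z] obtain e b where e: "dual_frame 7 e b" "dt = e 1" "om z = model_omega e"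
      "psp z = model_psip e" "\<forall>ws. local_d om z (b 1 # ws) = 0" "\<theta> z [b 1] = 0"
      "linear (L z)" "L z (b 1) = 0" "L z (b 2) = b 3" "L z (b 3) = - b 2" "L z (b 4) = b 5" "L z (b 5) = - b 4"
      "L z (b 6) = b 7" "L z (b 7) = - b 6" by blast
  interpret g2_frame e b by unfold_locales (rule e)
  have p: "\<phi> d z = g2_model e" unfolding \<phi>[OF z] phi_def unfolding g2_model_eq e(2) e(3) e(4) ..
  then have "g2_adapted (\<phi> d z) e" using e(1) by (simp add: g2_adapted_def dual_frame_coframe7)
  note m = g2_adapted_metric[of \<phi> d z, OF this]
  have star: "g2_star \<phi> \<alpha> d z = hodge (frame_metric 7 e) (ewedge e [1, 2, 3, 4, 5, 6, 7]) (\<alpha> d z)" for \<alpha>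
    by (simp add: g2_star_def fhodge_def m)
  have d\<phi>: "ext_d \<phi> d z = local_d phi z" unfolding ext_d_eq by (rule local_d_cong[OF U z \<phi>])
  note d = kform_degree_form[OF \<theta>[OF z]]
  have c2: "\<theta> z \<^bold>\<and> ?dt = (\<lambda>vs. - (?dt \<^bold>\<and> \<theta> z) vs)"
    using wedge_commute[OF d degree_form_covector] by (simp add: fun_eq_iff)
  have c3: "\<theta> z \<^bold>\<and> ?dt \<^bold>\<and> om z = (\<lambda>vs. - (?dt \<^bold>\<and> \<theta> z \<^bold>\<and> om z) vs)"
  proof -
    have "\<theta> z \<^bold>\<and> ?dt \<^bold>\<and> om z = (\<theta> z \<^bold>\<and> ?dt) \<^bold>\<and> om z" by (simp add: wedge_assoc)
    then show ?thesis unfolding c2 by (simp add: wedge_linear[THEN ext] wedge_assoc)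
  qed
  have one: "(ext_d \<phi> \<and>\<^sub>M \<phi>) d z = (\<lambda>_. 0)"
    using d_phi_wedge_phi[OF z] by (simp add: fwedge_def d\<phi> \<phi>[OF z])
  \<comment> \<open>The two terms \<open>\<theta> \<and> \<psi>\<^sub>+\<close> cancel by the
    twisted equation; moving \<open>dt\<close> to the front leaves the argument of
    \<open>star_torsion\<close>.\<close>
  have arg: "(\<lambda>vs. (\<theta> z \<^bold>\<and> phi z) vs - local_d phi z vs) = ?dt \<^bold>\<and> (\<lambda>vs. ?\<gamma> vs - (\<theta> z \<^bold>\<and> om z) vs)"
    unfolding d_phi[OF z] phi_def by (simp add: fun_eq_iff wedge_linear c3)
  \<comment> \<open>The first term of the torsion vanishes since
    \<open>d\<phi> \<and> \<phi> = 0\<close>, and the other two combine into a single star.\<close>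
  have 1: "g2_torsion \<phi> \<Theta> d z vs = hodge (frame_metric 7 e) (ewedge e [1, 2, 3, 4, 5, 6, 7])
     (\<lambda>vs. (\<theta> z \<^bold>\<and> phi z) vs - local_d phi z vs) vs" for vs
    unfolding g2_torsion_def star one hodge_zero hodge_linear by (simp add: d\<phi> fwedge_def \<Theta> \<phi>[OF z])
  have 2: "hodge (frame_metric 7 e) (ewedge e [1, 2, 3, 4, 5, 6, 7])
     (\<lambda>vs. (\<theta> z \<^bold>\<and> phi z) vs - local_d phi z vs) = (\<lambda>vs. ?\<gamma> (map (L z) vs))"
  proof -
    define t where "t v = \<theta> z [v]" for v
    have \<theta>t: "\<theta> z = covector t" unfolding t_def by (rule one_form_covector) (use d in simp)
    have "linear t" unfolding t_def by (rule linear_one_form[OF \<theta>[OF z]])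
    moreover have "2 * (model_omega e \<^bold>\<and> ?\<gamma>) vs = (covector t \<^bold>\<and> model_omega e \<^bold>\<and> model_omega e) vs" for vs
      using fun_cong[OF lee[OF z], of vs] by (simp add: e \<theta>t)
    ultimately show ?thesis unfolding arg unfolding \<theta>t e(3) e(2) using e gamma_kform[OF z]
      by (intro star_torsion) (auto simp: t_def)
  qed
  show ?thesis by (rule ext) (simp only: 1 2)
qed

end

section \<open>\<open>SU(n)\<close>-manifolds solving the twisted Calabi--Yau equation\<close>

text \<open>A real factor commutes with taking real and imaginary parts; this splits the twisted
  equation for \<Psi> into two real ones.\<close>

lemma Re_wedge_complexify:
  fixes \<alpha> :: "'v list \<Rightarrow> real" and \<Psi> :: "'v list \<Rightarrow> complex"
  shows "Re (((\<lambda>vs. complex_of_real (\<alpha> vs)) \<^bold>\<and> \<Psi>) vs) = (\<alpha> \<^bold>\<and> (\<lambda>vs. Re (\<Psi> vs))) vs"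
    and "Im (((\<lambda>vs. complex_of_real (\<alpha> vs)) \<^bold>\<and> \<Psi>) vs) = (\<alpha> \<^bold>\<and> (\<lambda>vs. Im (\<Psi> vs))) vs"
proof -
  have s: "shuffle_sign m S = complex_of_real (shuffle_sign m S)" for m S by (simp add: shuffle_sign_def)
  show "Re (((\<lambda>vs. complex_of_real (\<alpha> vs)) \<^bold>\<and> \<Psi>) vs) = (\<alpha> \<^bold>\<and> (\<lambda>vs. Re (\<Psi> vs))) vs"
    unfolding wedge_def s by (simp flip: of_real_mult)
  show "Im (((\<lambda>vs. complex_of_real (\<alpha> vs)) \<^bold>\<and> \<Psi>) vs) = (\<alpha> \<^bold>\<and> (\<lambda>vs. Im (\<Psi> vs))) vs"
    unfolding wedge_def s by (simp flip: of_real_mult)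
qed

lemma Re_local_d:
  fixes F :: "'e::euclidean_space \<Rightarrow> 'e list \<Rightarrow> complex"
  assumes "coeffs_diff F x"
  shows "local_d (\<lambda>y vs. Re (F y vs)) x vs = Re (local_d F x vs)" 
    and "local_d (\<lambda>y vs. Im (F y vs)) x vs = Im (local_d F x vs)"
proof -
  have d: "frechet_derivative (\<lambda>y. Re (F y ws)) (at x) h = Re (frechet_derivative (\<lambda>y. F y ws) (at x) h)"
    "frechet_derivative (\<lambda>y. Im (F y ws)) (at x) h = Im (frechet_derivative (\<lambda>y. F y ws) (at x) h)" for ws h
    using frechet_derivative_at[OF bounded_linear.has_derivative[OF bounded_linear_Re has_dir_deriv[OF assms, of ws]]]
      frechet_derivative_at[OF bounded_linear.has_derivative[OF bounded_linear_Im has_dir_deriv[OF assms, of ws]]]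
    by (auto simp: dir_deriv_def dest: fun_cong[of _ _ h])
  have m: "Re ((- 1) ^ i * w) = (- 1) ^ i * Re w" "Im ((- 1) ^ i * w) = (- 1) ^ i * Im w" for i w
    by (cases "even i"; simp)+
  show "local_d (\<lambda>y vs. Re (F y vs)) x vs = Re (local_d F x vs)" "local_d (\<lambda>y vs. Im (F y vs)) x vs = Im (local_d F x vs)"
    by (simp_all add: local_d_def d m)
qed

lemma coeffs_smooth_wedge_pow:
  "open S \<Longrightarrow> coeffs_smooth S F \<Longrightarrow> coeffs_smooth S (\<lambda>x. wedge_pow (F x) k :: 'v list \<Rightarrow> real)"
proof (induction k)
  case 0 then show ?case by (simp add: coeffs_smooth_def smooth_on_const)
next
  case (Suc k) then show ?case by (simp add: coeffs_smooth_wedge)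
qed

lemma kform_wedge_pow: "kform 2 \<alpha> \<Longrightarrow> kform (2 * k) (wedge_pow \<alpha> k :: _ \<Rightarrow> real)"
proof (induction k)
  case 0 then show ?case by (simp add: kform_iff multi_wedge_one degree_form_wedge_one)
next
  case (Suc k) then show ?case using kform_wedge_eq[of 2 \<alpha> "2 * k" "wedge_pow \<alpha> k" "2 * Suc k"] by simp
qed

lemma field_eqD: "field_eq A \<alpha> \<beta> \<Longrightarrow> c \<in> A \<Longrightarrow> x \<in> chart_range c \<Longrightarrow> \<alpha> c x = \<beta> c x"
  unfolding field_eq_def by blast

lemma wedge_pow_map: "wedge_pow \<alpha> k (map L vs) = wedge_pow (\<lambda>ws. \<alpha> (map L ws)) k vs"
proof -
  have "(\<lambda>vs. wedge_pow \<alpha> k (map L vs)) = wedge_pow (\<lambda>ws. \<alpha> (map L ws)) k"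
    by (induction k) (auto simp: fun_eq_iff wedge_one_def wedge_map)
  then show ?thesis by metis
qed

lemma coeffs_smooth_ins: "coeffs_smooth S F \<Longrightarrow> coeffs_smooth S (\<lambda>x. ins v (F x))"
  by (simp add: coeffs_smooth_def ins_def)

text \<open>Smoothness is known for constant arguments; expanding the moving argument
  \<open>h x\<close> in the standard basis reduces the claim to these.\<close>

lemma smooth_on_linear_slot:
  fixes F :: "'e::euclidean_space \<Rightarrow> 'f::euclidean_space \<Rightarrow> real"
  assumes S: "open S" and lin: "\<And>x. x \<in> S \<Longrightarrow> linear (F x)" and F: "\<And>i. i \<in> Basis \<Longrightarrow> smooth_on S (\<lambda>x. F x i)"
    and h: "smooth_on S h"
  shows "smooth_on S (\<lambda>x. F x (h x))"
proof -
  have eq: "F x (h x) = (\<Sum>i\<in>Basis. (h x \<bullet> i) * F x i)" if "x \<in> S" for x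
  proof -
    have "F x (h x) = F x (\<Sum>i\<in>Basis. (h x \<bullet> i) *\<^sub>R i)" by (simp add: euclidean_representation)
    then show ?thesis by (simp only: linear_sum[OF lin[OF that]] linear_cmul[OF lin[OF that]] real_scaleR_def)
  qed
  have "smooth_on S (\<lambda>x. \<Sum>i\<in>Basis. (h x \<bullet> i) * F x i)"
    by (intro smooth_on_sum smooth_on_mult S F smooth_on_bounded_linear[OF bounded_linear_inner_left S h])
  then show ?thesis by (rule smooth_on_cong[OF S eq[symmetric], rotated])
qed

locale su_manifold =
  fixes n :: nat and X :: "'a topology" and A :: "('a, 'e::euclidean_space) chart set"
    and g :: "('a, 'e) metric_field" and J :: "('a, 'e) endo_field" and \<Psi> :: "('a, 'e, complex) form_field"
  assumes mfd: "smooth_manifold X A" and su: "SU_structure A n g J \<Psi>"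
    and dPsi: "field_eq A (ext_d \<Psi>) (complexify (lee_form n g J) \<and>\<^sub>M \<Psi>)"
    and ddc: "field_eq A (ext_d (d_c_omega g J)) zero_field"
    and dlee: "field_eq A (ext_d (lee_form n g J)) zero_field"
begin

abbreviation "om \<equiv> fundamental_form g J"
abbreviation "lee \<equiv> lee_form n g J"
abbreviation "psp \<equiv> Re_part \<Psi>"
abbreviation "psm \<equiv> Im_part \<Psi>"

lemma n_cases: "n \<in> {2, 3}" and dim: "DIM('e) = 2 * n"
  using su by (auto simp: SU_structure_def)

lemma ah: "almost_hermitian A g J" and Psi_form: "differential_form A n \<Psi>" and Psi_type: "type_n0 A n J \<Psi>"
  using su by (auto simp: SU_structure_def)

lemma chart: "c \<in> A \<Longrightarrow> is_chart X c" using mfd by (simp add: smooth_manifold_def)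

lemma range_open: "c \<in> A \<Longrightarrow> open (chart_range c)" using chart by (simp add: is_chart_def)

lemma om_pair: "om c x = pair_form (g c x) (J c x)"
  by (simp add: fun_eq_iff fundamental_form_def pair_form_def)

lemma hermitian: "c \<in> A \<Longrightarrow> x \<in> chart_range c \<Longrightarrow> hermitian_pair (g c x) (J c x)"
  using ah by (auto simp: almost_hermitian_def riemannian_metric_def almost_complex_structure_def hermitian_pair_def)

lemma g_smooth: "c \<in> A \<Longrightarrow> smooth_on (chart_range c) (\<lambda>x. g c x v w)"
  and J_smooth: "c \<in> A \<Longrightarrow> smooth_on (chart_range c) (\<lambda>x. J c x v)"
  using ah by (auto simp: almost_hermitian_def riemannian_metric_def almost_complex_structure_def)

lemma om_kform: "c \<in> A \<Longrightarrow> x \<in> chart_range c \<Longrightarrow> kform 2 (om c x)"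
  unfolding om_pair by (rule kform_pair_form[OF hermitian])

lemma om_smooth:
  assumes c: "c \<in> A" shows "coeffs_smooth (chart_range c) (om c)"
proof -
  have "smooth_on (chart_range c) (\<lambda>x. om c x vs)" for vs
  proof (cases "length vs = 2")
    case True
    then obtain v w where vs: "vs = [v, w]" by (auto simp: numeral_2_eq_2 length_Suc_conv)
    have "smooth_on (chart_range c) (\<lambda>x. g c x (J c x v) w)"
      by (rule smooth_on_linear_slot[OF range_open[OF c] hermitian_lin(2)[OF hermitian[OF c]] g_smooth[OF c] J_smooth[OF c]])
    then show ?thesis by (simp add: vs fundamental_form_def)
  next
    case False
    then have "om c x vs = 0" for x by (auto simp: fundamental_form_def split: list.splits)
    then show ?thesis by (simp add: smooth_on_const)
  qed
  then show ?thesis by (simp add: coeffs_smooth_def)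
qed

lemma gamma_smooth: "c \<in> A \<Longrightarrow> coeffs_smooth (chart_range c) (local_d (om c))"
  by (rule coeffs_smooth_local_d[OF range_open om_smooth])

lemma gamma_kform: "c \<in> A \<Longrightarrow> x \<in> chart_range c \<Longrightarrow> kform 3 (local_d (om c) x)"
  using kform_local_d[OF range_open _ om_kform coeffs_smooth_diff[OF om_smooth], of c x c] by (simp add: numeral_3_eq_3)

lemma Psi_smooth: "c \<in> A \<Longrightarrow> coeffs_smooth (chart_range c) (\<Psi> c)"
  and Psi_kform: "c \<in> A \<Longrightarrow> x \<in> chart_range c \<Longrightarrow> kform n (\<Psi> c x)"
  using Psi_form by (auto simp: differential_form_def coeffs_smooth_def)

lemma psp_eq: "psp c x = (\<lambda>vs. Re (\<Psi> c x vs))" and psm_eq: "psm c x = (\<lambda>vs. Im (\<Psi> c x vs))"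
  by (auto simp: Re_part_def Im_part_def)

lemma ps_smooth: "c \<in> A \<Longrightarrow> coeffs_smooth (chart_range c) (psp c)" "c \<in> A \<Longrightarrow> coeffs_smooth (chart_range c) (psm c)"
  using Psi_smooth smooth_on_bounded_linear[OF bounded_linear_Re range_open] smooth_on_bounded_linear[OF bounded_linear_Im range_open]
  by (auto simp: coeffs_smooth_def psp_eq psm_eq)

lemma complex_form: "c \<in> A \<Longrightarrow> x \<in> chart_range c \<Longrightarrow> complex_form n (J c x) (\<Psi> c x)"
  using Psi_type unfolding type_n0_def complex_form_def by blast

lemma frame3:
  assumes "n = 3" "c \<in> A" "x \<in> chart_range c"
  shows "\<exists>f b. dual_frame 6 f b \<and> g c x = frame_metric 6 f \<and> J c x (b 1) = b 2 \<and> J c x (b 3) = b 4 \<and> J c x (b 5) = b 6 \<and>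
    om c x = omega6 f \<and> psp c x = psip6 f \<and> psm c x = psim6 f"
proof -
  have "field_eq A (\<lambda>c x vs. 3 * (psp \<and>\<^sub>M psm) c x vs) (\<lambda>c x vs. 2 * (om \<and>\<^sub>M om \<and>\<^sub>M om) c x vs)"
    using su assms(1) by (simp add: SU_structure_def Let_def)
  from field_eqD[OF this assms(2,3)]
  have "(\<lambda>vs. 3 * (psp c x \<^bold>\<and> psm c x) vs) = (\<lambda>vs. 2 * (om c x \<^bold>\<and> om c x \<^bold>\<and> om c x) vs)"
    unfolding fwedge_def .
  from fun_cong[OF this] show ?thesis
    unfolding om_pair psp_eq psm_eq
    using hermitian[OF assms(2,3)] Psi_kform[OF assms(2,3)] complex_form[OF assms(2,3)] dim assms(1)
    by (intro su3_frame) auto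
qed

lemma frame2:
  assumes "n = 2" "c \<in> A" "x \<in> chart_range c"
  shows "\<exists>f b. dual_frame 4 f b \<and> g c x = frame_metric 4 f \<and> J c x (b 1) = b 2 \<and> J c x (b 3) = b 4 \<and>
    om c x = omega4 f \<and> psp c x = psip4 f \<and> psm c x = psim4 f"
proof -
  have "field_eq A (om \<and>\<^sub>M om) (psp \<and>\<^sub>M psp)"
    using su assms(1) by (simp add: SU_structure_def Let_def)
  from field_eqD[OF this assms(2,3)] have "om c x \<^bold>\<and> om c x = psp c x \<^bold>\<and> psp c x"
    unfolding fwedge_def .
  from fun_cong[OF this] show ?thesis
    unfolding om_pair psp_eq psm_eq
    using hermitian[OF assms(2,3)] Psi_kform[OF assms(2,3)] complex_form[OF assms(2,3)] dim assms(1)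
    by (intro su2_frame) auto
qed

text \<open>The form \<open>\<omega>\<^sup>n\<close> is \<open>n!\<close> times the volume form of a
  unitary frame. Its nonvanishing permits division by it in the formula for the Lee form.\<close>

lemma frame_top:
  assumes "c \<in> A" "x \<in> chart_range c"
  shows "\<exists>f b. dual_frame (2 * n) f (b :: nat \<Rightarrow> 'e)" "\<exists>vs. wedge_pow (om c x) n vs \<noteq> 0"
proof -
  have "(\<exists>f b. dual_frame (2 * n) f (b :: nat \<Rightarrow> 'e)) \<and> (\<exists>vs. wedge_pow (om c x) n vs \<noteq> 0)"
  proof (cases "n = 2")
    case True
    from frame2[OF True assms] obtain f and b :: "nat \<Rightarrow> 'e" where F: "dual_frame 4 f b" and o: "om c x = omega4 f" by blast
    have "(omega4 f \<^bold>\<and> omega4 f) (map b [1, 2, 3, 4]) = 2"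
      unfolding omega4_def by (simp add: dual_eval ewedge_dual_frame[OF F] del: list.map One_nat_def)
    then have "wedge_pow (om c x) n (map b [1, 2, 3, 4]) \<noteq> 0"
      unfolding o True by (simp add: numeral_2_eq_2 wedge_one_right del: list.map)
    then show ?thesis using F True by (intro conjI exI) auto
  next
    case False
    then have n3: "n = 3" using n_cases by simp
    from frame3[OF n3 assms] obtain f and b :: "nat \<Rightarrow> 'e" where F: "dual_frame 6 f b" and o: "om c x = omega6 f" by blast
    have "(omega6 f \<^bold>\<and> omega6 f \<^bold>\<and> omega6 f) (map b [1, 2, 3, 4, 5, 6]) = 6"
      unfolding omega6_def by (simp add: dual_eval ewedge_dual_frame[OF F] del: list.map One_nat_def)
    then have "wedge_pow (om c x) n (map b [1, 2, 3, 4, 5, 6]) \<noteq> 0"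
      unfolding o n3 by (simp add: numeral_3_eq_3 wedge_one_right del: list.map)
    then show ?thesis using F n3 by (intro conjI exI) auto
  qed
  then show "\<exists>f b. dual_frame (2 * n) f (b :: nat \<Rightarrow> 'e)" "\<exists>vs. wedge_pow (om c x) n vs \<noteq> 0" by blast+
qed

text \<open>The minus sign in \<open>-J\<delta>\<omega>\<close> and the one in
  \<open>\<delta> = -\<star>d\<star>\<close> cancel.\<close>

lemma lee_eq: "lee c x vs = hodge (g c x) (hermitian_vol n g J c x)
    (local_d (fhodge g (hermitian_vol n g J) om c) x) (map (J c x) vs)"
  by (simp add: lee_form_def J_act_def codiff_even_def fhodge_def ext_d_eq)

text \<open>Frames are used twice: one at every \<open>y\<close> of the chart for the inner star,
  whose value is then differentiated, and one at \<open>x\<close> for the outer star.\<close>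

lemma lee_rel:
  assumes c: "c \<in> A" "x \<in> chart_range c"
  shows "lee_relation n (om c x) (local_d (om c) x) (lee c x)"
proof -
  have JJ: "linear (J c x)" "\<And>v. J c x (J c x v) = - v" if "x \<in> chart_range c" for x
    using hermitian[OF c(1) that] by (auto simp: hermitian_pair_def)
  have vol: "hermitian_vol n g J c x = (\<lambda>vs. wedge_pow (om c x) n vs / fact n)" for x
    by (simp add: hermitian_vol_def fun_eq_iff)
  show ?thesis
  proof (cases "n = 2")
    case True
    have star: "fhodge g (hermitian_vol n g J) om c y = om c y" if y: "y \<in> chart_range c" for y
    proof -
      from frame2[OF True c(1) y] obtain f b where F: "dual_frame 4 f b" "g c y = frame_metric 4 f"
        "J c y (b 1) = b 2" "J c y (b 3) = b 4" "om c y = omega4 f" by blast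
      show ?thesis using lee4(1)[OF F(1) JJ[OF y] F(3,4) refl] unfolding fhodge_def vol unfolding True F(2,5) .
    qed
    have "local_d (fhodge g (hermitian_vol n g J) om c) x = local_d (om c) x"
      by (rule local_d_cong[OF range_open[OF c(1)] c(2) star])
    then have l: "lee c x = (\<lambda>vs. hodge (g c x) (hermitian_vol n g J c x) (local_d (om c) x) (map (J c x) vs))"
      by (intro ext) (simp only: lee_eq)
    from frame2[OF True c] obtain f b where F: "dual_frame 4 f b" "g c x = frame_metric 4 f"
        "J c x (b 1) = b 2" "J c x (b 3) = b 4" "om c x = omega4 f" by blast
    show ?thesis using lee4(2)[OF F(1) JJ[OF c(2)] F(3,4) refl gamma_kform[OF c]] unfolding l vol unfolding True F(2,5) .
  next
    case False
    then have n3: "n = 3" using n_cases by simp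
    have star: "fhodge g (hermitian_vol n g J) om c y = (\<lambda>vs. 1 / 2 * (om c y \<^bold>\<and> om c y) vs)" if y: "y \<in> chart_range c" for y
    proof -
      from frame3[OF n3 c(1) y] obtain f b where F: "dual_frame 6 f b" "g c y = frame_metric 6 f"
        "J c y (b 1) = b 2" "J c y (b 3) = b 4" "J c y (b 5) = b 6" "om c y = omega6 f" by blast
      show ?thesis using lee6(1)[OF F(1) JJ[OF y] F(3,4,5) refl] unfolding fhodge_def vol unfolding n3 F(2,6) .
    qed
    have d: "coeffs_diff (om c) x" by (rule coeffs_smooth_diff[OF om_smooth[OF c(1)] c(2)])
    note dg = kform_degree_form[OF om_kform[OF c]]
    have "local_d (fhodge g (hermitian_vol n g J) om c) x = local_d (\<lambda>y vs. 1 / 2 * (om c y \<^bold>\<and> om c y) vs) x"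
      by (rule local_d_cong[OF range_open[OF c(1)] c(2) star])
    also have "\<dots> = (\<lambda>vs. 1 / 2 * local_d (\<lambda>y. om c y \<^bold>\<and> om c y) x vs)"
      by (rule ext) (rule local_d_simps(3)[OF coeffs_diff_wedge[OF d d]])
    also have "\<dots> = om c x \<^bold>\<and> local_d (om c) x"
      using wedge_commute_even[OF dg kform_degree_form[OF gamma_kform[OF c]]]
      by (simp add: fun_eq_iff local_d_wedge[OF d d] grade_inv_even[OF dg])
    finally have l: "lee c x = (\<lambda>vs. hodge (g c x) (hermitian_vol n g J c x) (om c x \<^bold>\<and> local_d (om c) x) (map (J c x) vs))"
      by (intro ext) (simp only: lee_eq)
    from frame3[OF n3 c] obtain f b where F: "dual_frame 6 f b" "g c x = frame_metric 6 f"
        "J c x (b 1) = b 2" "J c x (b 3) = b 4" "J c x (b 5) = b 6" "om c x = omega6 f" by blast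
    show ?thesis using lee6(2)[OF F(1) JJ[OF c(2)] F(3,4,5) refl gamma_kform[OF c]] unfolding l vol unfolding n3 F(2,6) .
  qed
qed

lemma lee_kform: "c \<in> A \<Longrightarrow> x \<in> chart_range c \<Longrightarrow> kform 1 (lee c x)"
  using lee_rel by (simp add: lee_relation_def)

lemma lee_solve:
  assumes c: "c \<in> A" "x \<in> chart_range c"
  shows "lee c x [v] * wedge_pow (om c x) n s =
    real (n * (n - 1)) * (wedge_pow (om c x) (n - 2) \<^bold>\<and> local_d (om c) x \<^bold>\<and> ins v (om c x)) s"
proof -
  obtain f and b :: "nat \<Rightarrow> 'e" where F: "dual_frame (2 * n) f b" using frame_top(1)[OF c] by blast
  show ?thesis by (rule lee_formula[OF n_cases F om_kform[OF c] lee_rel[OF c]])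
qed

lemma lee_smooth:
  assumes c: "c \<in> A" shows "coeffs_smooth (chart_range c) (lee c)"
proof -
  note S = range_open[OF c]
  \<comment> \<open>A list of constant vectors, the same at all points, so that
    \<open>\<omega>\<^sup>n\<close> evaluated on it is a smooth function on the chart.\<close>
  obtain s :: "'e list" where s: "set s = Basis" "distinct s" using finite_distinct_list[OF finite_Basis] by blast
  have len: "length s = 2 * n" using s dim by (metis distinct_card)
  have nz: "wedge_pow (om c x) n s \<noteq> 0" if x: "x \<in> chart_range c" for x
    using frame_top(2)[OF c x] top_form_nonzero[OF kform_wedge_pow[OF om_kform[OF c x]] len] s by auto
  have "smooth_on (chart_range c) (\<lambda>x. lee c x vs)" for vs
  proof (cases "length vs = 1")
    case True
    then obtain v where vs: "vs = [v]" by (auto simp: length_Suc_conv)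
    let ?N = "\<lambda>x. (wedge_pow (om c x) (n - 2) \<^bold>\<and> local_d (om c) x \<^bold>\<and> ins v (om c x)) s"
    have w: "coeffs_smooth (chart_range c) (\<lambda>x. wedge_pow (om c x) k)" for k
      by (rule coeffs_smooth_wedge_pow[OF S om_smooth[OF c]])
    have "coeffs_smooth (chart_range c) (\<lambda>x. wedge_pow (om c x) (n - 2) \<^bold>\<and> local_d (om c) x \<^bold>\<and> ins v (om c x))"
      by (intro coeffs_smooth_wedge S w gamma_smooth c coeffs_smooth_ins om_smooth)
    then have sm: "smooth_on (chart_range c) (\<lambda>x. (real (n * (n - 1)) * ?N x) * inverse (wedge_pow (om c x) n s))"
      using w[of n] by (intro smooth_on_mult smooth_on_inverse S smooth_on_const nz) (auto simp: coeffs_smooth_def)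
    have "(real (n * (n - 1)) * ?N x) * inverse (wedge_pow (om c x) n s) = lee c x vs" if "x \<in> chart_range c" for x
      unfolding lee_solve[OF c that, symmetric] vs using nz[OF that] by (simp add: field_simps)
    then show ?thesis by (rule smooth_on_cong[OF S _ sm])
  next
    case False
    then have "0 = lee c x vs" if "x \<in> chart_range c" for x using kform_degree[OF lee_kform[OF c that]] by simp
    then show ?thesis by (rule smooth_on_cong[OF S _ smooth_on_const])
  qed
  then show ?thesis by (simp add: coeffs_smooth_def)
qed

lemma dc_eq: "d_c_omega g J c x = (\<lambda>vs. local_d (om c) x (map (J c x) vs))"
  by (simp add: fun_eq_iff d_c_omega_def J_act_def ext_d_eq)

lemma dc_smooth:
  assumes c: "c \<in> A" shows "coeffs_smooth (chart_range c) (d_c_omega g J c)"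
proof -
  note S = range_open[OF c]
  have m: "multi (local_d (om c) x)" if "x \<in> chart_range c" for x using gamma_kform[OF c that] by (simp add: kform_iff)
  have G: "smooth_on (chart_range c) (\<lambda>x. local_d (om c) x vs)" for vs using gamma_smooth[OF c] by (simp add: coeffs_smooth_def)
  have "smooth_on (chart_range c) (\<lambda>x. d_c_omega g J c x vs)" for vs
  proof (cases "length vs = 3")
    case True
    then obtain u v w where vs: "vs = [u, v, w]" by (auto simp: length_3)
    \<comment> \<open>The arguments are replaced by their images under J one after the other,
      because \<open>smooth_on_linear_slot\<close> moves a single slot.\<close>
    have 1: "smooth_on (chart_range c) (\<lambda>x. local_d (om c) x [J c x u, a, b])" for a b
      by (rule smooth_on_linear_slot[OF S _ G J_smooth[OF c]]) (use multi_linear[OF m, of _ "[]"] in simp)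
    have 2: "smooth_on (chart_range c) (\<lambda>x. local_d (om c) x [J c x u, J c x v, b])" for b
      by (rule smooth_on_linear_slot[OF S _ 1 J_smooth[OF c]]) (use multi_linear[OF m, of _ "[_]"] in simp)
    have "smooth_on (chart_range c) (\<lambda>x. local_d (om c) x [J c x u, J c x v, J c x w])"
      by (rule smooth_on_linear_slot[OF S _ 2 J_smooth[OF c]]) (use multi_linear[OF m, of _ "[_, _]" "[]"] in simp)
    then show ?thesis by (simp add: vs dc_eq)
  next
    case False
    then have "0 = d_c_omega g J c x vs" if "x \<in> chart_range c" for x
      using kform_degree[OF gamma_kform[OF c that]] by (simp add: dc_eq)
    then show ?thesis by (rule smooth_on_cong[OF S _ smooth_on_const])
  qed
  then show ?thesis by (simp add: coeffs_smooth_def)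
qed

lemma d_ps:
  assumes c: "c \<in> A" "x \<in> chart_range c"
  shows "local_d (psp c) x = lee c x \<^bold>\<and> psp c x" "local_d (psm c) x = lee c x \<^bold>\<and> psm c x"
proof -
  have "local_d (\<Psi> c) x = (\<lambda>vs. complex_of_real (lee c x vs)) \<^bold>\<and> \<Psi> c x"
    using field_eqD[OF dPsi c] by (simp add: ext_d_eq fwedge_def complexify_def[abs_def])
  then show "local_d (psp c) x = lee c x \<^bold>\<and> psp c x" "local_d (psm c) x = lee c x \<^bold>\<and> psm c x"
    using Re_local_d[OF coeffs_smooth_diff[OF Psi_smooth[OF c(1)] c(2)]]
    by (simp_all add: fun_eq_iff psp_eq[abs_def] psm_eq[abs_def] Re_wedge_complexify)
qed

section \<open>Chart transitions on the base\<close>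

context
  fixes c c' assumes cc: "c \<in> A" "c' \<in> A"
begin

abbreviation "F \<equiv> coord_rep c c' id"

lemma chart_inj: "inj_on (snd c) (fst c)"
proof -
  have "fst c \<subseteq> topspace X" using chart[OF cc(1)] by (simp add: is_chart_def openin_subset)
  then have "topspace (subtopology X (fst c)) = fst c" by auto
  then show ?thesis using chart[OF cc(1)] homeomorphic_imp_injective_map unfolding is_chart_def by metis
qed

lemma F_eq: "q \<in> fst c \<Longrightarrow> F (snd c q) = snd c' q"
  by (simp add: coord_rep_def inv_into_f_f[OF chart_inj])

lemma overlap_open: "open (snd c ` (fst c \<inter> fst c'))"
proof -
  have "openin (subtopology X (fst c)) (fst c \<inter> fst c')"
    using chart[OF cc(2)] by (auto simp: is_chart_def openin_subtopology)
  then have "openin (top_of_set (chart_range c)) (snd c ` (fst c \<inter> fst c'))"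
    using chart[OF cc(1)] homeomorphic_imp_open_map unfolding is_chart_def open_map_def by blast
  then show ?thesis using openin_open_trans range_open[OF cc(1)] by blast
qed

lemma F_smooth: "smooth_on (snd c ` (fst c \<inter> fst c')) F"
  using mfd cc by (simp add: smooth_manifold_def)

lemma F_derivative: "y \<in> snd c ` (fst c \<inter> fst c') \<Longrightarrow> (F has_derivative frechet_derivative F (at y)) (at y)"
  by (rule smooth_on_has_derivative[OF F_smooth])

context
  fixes q assumes q: "q \<in> fst c" "q \<in> fst c'"
begin

abbreviation "D \<equiv> frechet_derivative F (at (snd c q))"

lemma J_natural: "D (J c (snd c q) v) = J c' (snd c' q) (D v)"
  using ah cc q unfolding almost_hermitian_def almost_complex_structure_def Let_def by blast

lemma om_natural: "om c (snd c q) vs = om c' (snd c' q) (map D vs)"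
proof -
  have "g c (snd c q) v w = g c' (snd c' q) (D v) (D w)" for v w
    using ah cc q unfolding almost_hermitian_def riemannian_metric_def Let_def by blast
  then show ?thesis by (auto simp: fundamental_form_def J_natural split: list.splits)
qed

end

lemma gamma_natural:
  assumes q: "q \<in> fst c" "q \<in> fst c'"
  shows "local_d (om c) (snd c q) vs = local_d (om c') (snd c' q) (map (D q) vs)"
proof -
  have "local_d (om c) (snd c q) vs = local_d (om c') (F (snd c q)) (map (D q) vs)"
  proof (rule local_d_pullback_2form[OF overlap_open _ F_smooth range_open[OF cc(2)]])
    show "snd c q \<in> snd c ` (fst c \<inter> fst c')" using q by blast
    show "F y \<in> chart_range c'" if "y \<in> snd c ` (fst c \<inter> fst c')" for y using that F_eq by auto
    show "kform 2 (om c' z)" if "z \<in> chart_range c'" for z by (rule om_kform[OF cc(2) that])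
    show "coeffs_smooth (chart_range c') (om c')" by (rule om_smooth[OF cc(2)])
    show "coeffs_diff (om c) (snd c q)" using coeffs_smooth_diff[OF om_smooth[OF cc(1)]] q by blast
    show "om c y vs = om c' (F y) (map (frechet_derivative F (at y)) vs)" if "y \<in> snd c ` (fst c \<inter> fst c')" for y vs
      using that om_natural F_eq by auto
  qed
  then show ?thesis using F_eq q by simp
qed

lemma dc_natural:
  assumes q: "q \<in> fst c" "q \<in> fst c'"
  shows "d_c_omega g J c (snd c q) vs = d_c_omega g J c' (snd c' q) (map (D q) vs)"
  by (simp add: dc_eq gamma_natural[OF q] J_natural[OF q] o_def)

lemma lee_natural:
  assumes q: "q \<in> fst c" "q \<in> fst c'"
  shows "lee c (snd c q) vs = lee c' (snd c' q) (map (D q) vs)"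
proof (cases "length vs = 1")
  case True
  then obtain v where vs: "vs = [v]" by (auto simp: length_Suc_conv)
  have r: "snd c q \<in> chart_range c" "snd c' q \<in> chart_range c'" using q by auto
  have o: "om c (snd c q) = (\<lambda>ws. om c' (snd c' q) (map (D q) ws))" using om_natural[OF q] by blast
  have \<gamma>: "local_d (om c) (snd c q) = (\<lambda>ws. local_d (om c') (snd c' q) (map (D q) ws))" using gamma_natural[OF q] by blast
  \<comment> \<open>A list on which the top power does not vanish, so that it can be cancelled at
    the end.\<close>
  obtain s where s: "wedge_pow (om c (snd c q)) n s \<noteq> 0" using frame_top(2)[OF cc(1) r(1)] by blast
  have "lee c (snd c q) [v] * wedge_pow (om c (snd c q)) n s =
    real (n * (n - 1)) * (wedge_pow (om c (snd c q)) (n - 2) \<^bold>\<and> local_d (om c) (snd c q) \<^bold>\<and> ins v (om c (snd c q))) s"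
    by (rule lee_solve[OF cc(1) r(1)])
  also have "\<dots> = real (n * (n - 1)) * (wedge_pow (om c' (snd c' q)) (n - 2) \<^bold>\<and> local_d (om c') (snd c' q) \<^bold>\<and>
      ins (D q v) (om c' (snd c' q))) (map (D q) s)"
    by (simp add: wedge_map wedge_pow_map o \<gamma> ins_def[abs_def])
  also have "\<dots> = lee c' (snd c' q) [D q v] * wedge_pow (om c' (snd c' q)) n (map (D q) s)"
    by (rule lee_solve[OF cc(2) r(2), symmetric])
  also have "wedge_pow (om c' (snd c' q)) n (map (D q) s) = wedge_pow (om c (snd c q)) n s"
    by (simp add: wedge_pow_map o)
  finally show ?thesis unfolding vs list.map mult_right_cancel[OF s] .
next
  case False
  then show ?thesis using q kform_degree[OF lee_kform[OF cc(1)]] kform_degree[OF lee_kform[OF cc(2)]] by simp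
qed

lemma ps_natural:
  assumes q: "q \<in> fst c" "q \<in> fst c'"
  shows "psp c (snd c q) vs = psp c' (snd c' q) (map (D q) vs)" "psm c (snd c q) vs = psm c' (snd c' q) (map (D q) vs)"
proof -
  have "\<Psi> c (snd c q) vs = \<Psi> c' (snd c' q) (map (D q) vs)"
  proof -
    have p: "is_pullback A A id \<Psi> \<Psi>" using Psi_form by (simp add: differential_form_def)
    have e: "id q = q" by simp
    from p[unfolded is_pullback_def, rule_format, OF cc q(1), unfolded e, OF q(2)] show ?thesis .
  qed
  then show "psp c (snd c q) vs = psp c' (snd c' q) (map (D q) vs)" "psm c (snd c q) vs = psm c' (snd c' q) (map (D q) vs)"
    by (simp_all add: Re_part_def Im_part_def)
qed

end

end

section \<open>The product with a Euclidean factor\<close>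

definition prod_chart :: "('a, 'e) chart \<Rightarrow> ('a \<times> 'f, 'e \<times> 'f) chart" where
  "prod_chart c = (fst c \<times> UNIV, map_prod (snd c) id)"

text \<open>Recovers \<open>c\<close> from \<open>prod_chart c\<close>, since a field on the product only receives the product chart.\<close>

definition base_chart :: "('a \<times> 'f::zero, 'e \<times> 'f) chart \<Rightarrow> ('a, 'e) chart" where
  "base_chart d = (fst ` fst d, \<lambda>p. fst (snd d (p, 0)))"

text \<open>The pullback under the projection to the base: in product charts the derivative of the
  projection is \<open>fst\<close>.\<close>

definition lift :: "('a, 'e, 'b) form_field \<Rightarrow> ('a \<times> 'f::zero, 'e \<times> 'f, 'b) form_field" where
  "lift \<alpha> d z vs = \<alpha> (base_chart d) (fst z) (map fst vs)"

lemma base_prod_chart [simp]: "base_chart (prod_chart c) = c"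
  by (cases c) (simp add: base_chart_def prod_chart_def)

lemma prod_atlas_standard: "prod_atlas A standard_atlas = prod_chart ` A"
proof (intro equalityI subsetI)
  fix d assume "d \<in> prod_atlas A standard_atlas"
  then obtain c where "c \<in> A" "d = (fst c \<times> UNIV, map_prod (snd c) id)"
    unfolding prod_atlas_def standard_atlas_def by auto
  then show "d \<in> prod_chart ` A" unfolding prod_chart_def by (rule rev_image_eqI)
next
  fix d assume "d \<in> prod_chart ` A"
  then obtain c where "c \<in> A" "d = (fst c \<times> fst (UNIV, id), map_prod (snd c) (snd (UNIV, id)))"
    unfolding prod_chart_def by auto
  then show "d \<in> prod_atlas A standard_atlas" unfolding prod_atlas_def standard_atlas_def
    by (intro CollectI exI[of _ c] exI[of _ "(UNIV, id)"]) simp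
qed

lemma chart_range_prod: "chart_range (prod_chart c) = chart_range c \<times> UNIV"
  by (auto simp: prod_chart_def) force

lemma lift_prod_chart: "lift \<alpha> (prod_chart c) z = (\<lambda>vs. \<alpha> c (fst z) (map fst vs))"
  by (simp add: lift_def fun_eq_iff)

lemma ewedge_fst:
  "list_all2 (\<lambda>i j. \<forall>v. e i v = f j (fst v)) is js \<Longrightarrow> ewedge e is = (\<lambda>vs. ewedge f js (map fst vs))"
proof (induction rule: list_all2_induct)
  case Nil then show ?case by (auto simp: ewedge_Nil wedge_one_def)
next
  case (Cons i "is" j js)
  have "covector (e i) = (\<lambda>vs. covector (f j) (map fst vs))"
    using Cons(1) by (auto simp: covector_def fun_eq_iff split: list.splits)
  then show ?case unfolding ewedge_Cons Cons.IH by (intro ext) (simp only: wedge_map)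
qed

lemma coeffs_smooth_fst:
  "open S \<Longrightarrow> coeffs_smooth S F \<Longrightarrow> coeffs_smooth (S \<times> (UNIV :: 'f::euclidean_space set)) (\<lambda>z vs. F (fst z) (map fst (vs :: ('e::euclidean_space \<times> 'f) list)))"
  unfolding coeffs_smooth_def using smooth_on_fst by blast

lemma coeffs_smooth_simps:
  fixes F G :: "'e::euclidean_space \<Rightarrow> 'v list \<Rightarrow> real"
  assumes "open S" "coeffs_smooth S F" "coeffs_smooth S G"
  shows "coeffs_smooth S (\<lambda>y vs. F y vs + G y vs)" "coeffs_smooth S (\<lambda>y vs. F y vs - G y vs)"
  using assms by (auto simp: coeffs_smooth_def intro: smooth_on_add smooth_on_diff)

lemma coeffs_smooth_const: "coeffs_smooth S (\<lambda>_. \<alpha>)"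
  by (simp add: coeffs_smooth_def smooth_on_const)

lemma wedge_left_commute: "\<alpha> \<^bold>\<and> \<beta> = \<beta> \<^bold>\<and> \<alpha> \<Longrightarrow> \<alpha> \<^bold>\<and> \<beta> \<^bold>\<and> \<gamma> = \<beta> \<^bold>\<and> \<alpha> \<^bold>\<and> \<gamma>"
  by (simp flip: wedge_assoc)

text \<open>The map \<kappa> numbers the coordinates of the Euclidean factor: one for
  \<open>n = 3\<close>, three for \<open>n = 2\<close>.\<close>

locale su_product = su_manifold n X A g J \<Psi>
  for n :: nat and X :: "'a topology" and A :: "('a, 'e::euclidean_space) chart set"
    and g :: "('a, 'e) metric_field" and J :: "('a, 'e) endo_field" and \<Psi> :: "('a, 'e, complex) form_field" +
  fixes \<kappa> :: "nat \<Rightarrow> 'k::finite"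
  assumes \<kappa>: "bij_betw \<kappa> {1..7 - 2 * n} UNIV"
begin

abbreviation "M \<equiv> (prod_chart ` A :: ('a \<times> (real ^ 'k), 'e \<times> (real ^ 'k)) chart set)"

definition dt :: "nat \<Rightarrow> 'e \<times> (real ^ 'k) \<Rightarrow> real" where
  "dt j v = snd v $ \<kappa> j"

definition OM :: "('a \<times> (real ^ 'k), 'e \<times> (real ^ 'k), real) form_field" where
  "OM d z = (if n = 2 then (\<lambda>vs. (covector (dt 2) \<^bold>\<and> covector (dt 3)) vs + lift om d z vs) else lift om d z)"

definition PSP :: "('a \<times> (real ^ 'k), 'e \<times> (real ^ 'k), real) form_field" where
  "PSP d z = (if n = 2 then (\<lambda>vs. (covector (dt 2) \<^bold>\<and> lift psp d z) vs - (covector (dt 3) \<^bold>\<and> lift psm d z) vs) else lift psp d z)"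

definition PSM :: "('a \<times> (real ^ 'k), 'e \<times> (real ^ 'k), real) form_field" where
  "PSM d z = (if n = 2 then (\<lambda>vs. (covector (dt 2) \<^bold>\<and> lift psm d z) vs + (covector (dt 3) \<^bold>\<and> lift psp d z) vs) else lift psm d z)"

text \<open>The case distinction is taken out of the function of \<open>z\<close>, so that rules for
  smoothness and for \<open>local_d\<close> apply to it.\<close>

lemma OM_PSP_PSM:
  "n = 2 \<Longrightarrow> OM d = (\<lambda>z vs. (covector (dt 2) \<^bold>\<and> covector (dt 3)) vs + lift om d z vs)" "n \<noteq> 2 \<Longrightarrow> OM d = lift om d"
  "n = 2 \<Longrightarrow> PSP d = (\<lambda>z vs. (covector (dt 2) \<^bold>\<and> lift psp d z) vs - (covector (dt 3) \<^bold>\<and> lift psm d z) vs)"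
  "n \<noteq> 2 \<Longrightarrow> PSP d = lift psp d"
  "n = 2 \<Longrightarrow> PSM d = (\<lambda>z vs. (covector (dt 2) \<^bold>\<and> lift psm d z) vs + (covector (dt 3) \<^bold>\<and> lift psp d z) vs)"
  "n \<noteq> 2 \<Longrightarrow> PSM d = lift psm d"
  by (unfold OM_def PSP_def PSM_def, (rule ext, simp)+)

definition PHI :: "('a \<times> (real ^ 'k), 'e \<times> (real ^ 'k), real) form_field" where
  "PHI d z = (\<lambda>vs. (covector (dt 1) \<^bold>\<and> OM d z) vs + PSP d z vs)"

text \<open>The complex structure on the kernel of \<open>dt 1\<close>, extended by zero. For
  \<open>n = 2\<close> the directions 2 and 3 form an additional complex line, on which
  \<open>dt 2 + i dt 3\<close> is complex linear.\<close>

definition LL :: "('a, 'e) chart \<Rightarrow> 'e \<times> (real ^ 'k) \<Rightarrow> 'e \<times> (real ^ 'k) \<Rightarrow> 'e \<times> (real ^ 'k)" where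
  "LL c z v = (J c (fst z) (fst v), if n = 2 then dt 2 v *\<^sub>R axis (\<kappa> 3) 1 - dt 3 v *\<^sub>R axis (\<kappa> 2) 1 else 0)"

lemma LL_simps:
  "n = 2 \<Longrightarrow> LL c z v = (J c (fst z) (fst v), dt 2 v *\<^sub>R axis (\<kappa> 3) 1 - dt 3 v *\<^sub>R axis (\<kappa> 2) 1)"
  "n \<noteq> 2 \<Longrightarrow> LL c z v = (J c (fst z) (fst v), 0)"
  by (unfold LL_def, simp_all)

lemma linear_dt: "linear (dt j)"
  by (rule linearI) (simp_all add: dt_def)

lemma dt_simps: "dt j (v, 0) = 0"
  "i \<in> {1..7 - 2 * n} \<Longrightarrow> j \<in> {1..7 - 2 * n} \<Longrightarrow> dt i (v, axis (\<kappa> j) 1) = (if i = j then 1 else 0)"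
  using \<kappa> by (auto simp: dt_def axis_def bij_betw_def inj_on_def)

lemma card_k: "CARD('k) = 7 - 2 * n"
  using bij_betw_same_card[OF \<kappa>] by simp

lemma dim_prod: "DIM('e \<times> (real ^ 'k)) = 7"
  using dim card_k n_cases by auto

context
  fixes c assumes c: "c \<in> A"
begin

abbreviation "U \<equiv> chart_range c \<times> (UNIV :: (real ^ 'k) set)"
abbreviation "pc \<equiv> prod_chart c :: ('a \<times> (real ^ 'k), 'e \<times> (real ^ 'k)) chart"

lemma open_U: "open U" by (rule open_Times[OF range_open[OF c] open_UNIV])

lemma lift_smooth: "coeffs_smooth (chart_range c) (\<alpha> c) \<Longrightarrow> coeffs_smooth U (lift \<alpha> pc)"
  unfolding lift_prod_chart[abs_def] by (rule coeffs_smooth_fst[OF range_open[OF c]])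

lemma lift_kform: "kform k (\<alpha> c (fst z)) \<Longrightarrow> kform k (lift \<alpha> pc z :: _ \<Rightarrow> real)"
  unfolding lift_prod_chart by (rule kform_map) (simp_all add: linear_fst)

lemma lift_d: 
  fixes \<alpha> :: "('a, 'e, real) form_field"
  assumes "coeffs_smooth (chart_range c) (\<alpha> c)" "z \<in> U"
  shows "local_d (lift \<alpha> pc) z = (\<lambda>vs. local_d (\<alpha> c) (fst z) (map fst vs))"
  unfolding lift_prod_chart[abs_def]
  by (rule ext, rule local_d_fst(1)) (use coeffs_smooth_diff[OF assms(1)] assms(2) in auto)

lemma smooth_all: "coeffs_smooth U (OM pc)" "coeffs_smooth U (PSP pc)" "coeffs_smooth U (PSM pc)" "coeffs_smooth U (lift lee pc)"
  "coeffs_smooth U (PHI pc)"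
proof -
  note w = coeffs_smooth_wedge[OF open_U coeffs_smooth_const] lift_smooth om_smooth[OF c] ps_smooth[OF c]
  show o: "coeffs_smooth U (OM pc)"
    by (cases "n = 2"; unfold OM_PSP_PSM; intro coeffs_smooth_simps open_U coeffs_smooth_const w)
  show p: "coeffs_smooth U (PSP pc)"
    by (cases "n = 2"; unfold OM_PSP_PSM; intro coeffs_smooth_simps open_U w)
  show "coeffs_smooth U (PSM pc)"
    by (cases "n = 2"; unfold OM_PSP_PSM; intro coeffs_smooth_simps open_U w)
  show "coeffs_smooth U (lift lee pc)" by (rule lift_smooth[where \<alpha> = lee, OF lee_smooth[OF c]])
  show "coeffs_smooth U (PHI pc)" unfolding PHI_def
    by (intro coeffs_smooth_simps open_U coeffs_smooth_wedge coeffs_smooth_const o p)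
qed

text \<open>The added product of \<open>dt 2\<close> and \<open>dt 3\<close> has constant
  coefficients and is closed, so for both values of \<open>n\<close> the derivative is the pullback
  of \<open>d\<omega>\<close>.\<close>

lemma d_OM: "z \<in> U \<Longrightarrow> local_d (OM pc) z = (\<lambda>vs. local_d (om c) (fst z) (map fst vs))"
proof -
  assume z: "z \<in> U"
  have d: "coeffs_diff (lift om pc) z" by (rule coeffs_smooth_diff[OF lift_smooth[where \<alpha> = om, OF om_smooth[OF c]] z])
  have "local_d (OM pc) z vs = local_d (lift om pc) z vs" for vs
  proof (cases "n = 2")
    case True
    then show ?thesis
      using local_d_simps(1)[OF coeffs_diff_const d, of "covector (dt 2) \<^bold>\<and> covector (dt 3)" vs]
      unfolding OM_PSP_PSM(1)[OF True] by (simp add: local_d_const)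
  qed (simp add: OM_PSP_PSM(2))
  then show ?thesis using lift_d[where \<alpha> = om, OF om_smooth[OF c] z] by (simp add: fun_eq_iff)
qed

lemma lift_d_ps:
  assumes z: "z \<in> U"
  shows "local_d (lift psp pc) z = lift lee pc z \<^bold>\<and> lift psp pc z" "local_d (lift psm pc) z = lift lee pc z \<^bold>\<and> lift psm pc z"
  using d_ps[OF c, of "fst z"] z
  unfolding lift_d[where \<alpha> = psp, OF ps_smooth(1)[OF c] z] lift_d[where \<alpha> = psm, OF ps_smooth(2)[OF c] z]
  by (auto simp: lift_prod_chart wedge_map fun_eq_iff)

lemma lee_lift_kform: "z \<in> U \<Longrightarrow> kform 1 (lift lee pc z)"
  by (rule lift_kform) (use lee_kform[OF c, of "fst z"] in auto)

text \<open>Both \<open>d\<close> and multiplication by \<theta> anticommute with multiplication by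
  a constant covector, so the twisted equation passes from \<Psi> to its product with
  \<open>dt 2 + i dt 3\<close>.\<close>

lemma d_PS:
  assumes z: "z \<in> U"
  shows "local_d (PSP pc) z = lift lee pc z \<^bold>\<and> PSP pc z" "local_d (PSM pc) z = lift lee pc z \<^bold>\<and> PSM pc z"
proof -
  let ?\<theta> = "lift lee pc z"
  note dl = kform_degree_form[OF lee_lift_kform[OF z]]
  have cd: "coeffs_diff (lift psp pc) z" "coeffs_diff (lift psm pc) z"
    using coeffs_smooth_diff[OF lift_smooth z] ps_smooth[OF c] by auto
  have w: "local_d (\<lambda>y. covector (dt j) \<^bold>\<and> lift \<alpha> pc y) z vs = (?\<theta> \<^bold>\<and> covector (dt j) \<^bold>\<and> lift \<alpha> pc z) vs"
    if "local_d (lift \<alpha> pc) z = ?\<theta> \<^bold>\<and> lift \<alpha> pc z" "coeffs_diff (lift \<alpha> pc) z" for j vs and \<alpha> :: "('a, 'e, real) form_field"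
  proof -
    have c2: "?\<theta> \<^bold>\<and> covector (dt j) = (\<lambda>vs. - (covector (dt j) \<^bold>\<and> ?\<theta>) vs)"
      using wedge_commute[OF dl degree_form_covector] by (simp add: fun_eq_iff)
    have "?\<theta> \<^bold>\<and> covector (dt j) \<^bold>\<and> lift \<alpha> pc z = (?\<theta> \<^bold>\<and> covector (dt j)) \<^bold>\<and> lift \<alpha> pc z" by (simp add: wedge_assoc)
    also have "\<dots> = (\<lambda>vs. - (covector (dt j) \<^bold>\<and> ?\<theta> \<^bold>\<and> lift \<alpha> pc z) vs)" unfolding c2 by (simp add: wedge_linear[THEN ext] wedge_assoc)
    finally show ?thesis using local_d_wedge[OF coeffs_diff_const that(2), of "covector (dt j)" vs]
      by (simp add: local_d_const that(1) grade_inv_degree[OF degree_form_covector] wedge_linear)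
  qed
  note wd = coeffs_diff_wedge[OF coeffs_diff_const]
  note ls = local_d_simps(2)[OF wd[OF cd(1)] wd[OF cd(2)]] local_d_simps(1)[OF wd[OF cd(2)] wd[OF cd(1)]]
    w[OF lift_d_ps(1)[OF z] cd(1)] w[OF lift_d_ps(2)[OF z] cd(2)]
  show "local_d (PSP pc) z = lift lee pc z \<^bold>\<and> PSP pc z"
    by (cases "n = 2"; unfold OM_PSP_PSM; rule ext; simp add: lift_d_ps[OF z] wedge_linear ls)
  show "local_d (PSM pc) z = lift lee pc z \<^bold>\<and> PSM pc z"
    by (cases "n = 2"; unfold OM_PSP_PSM; rule ext; simp add: lift_d_ps[OF z] wedge_linear ls)
qed

text \<open>For \<open>n = 3\<close> this is the Lee relation pulled back. For \<open>n = 2\<close>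
  the square of \<open>dt 2 \<and> dt 3\<close> vanishes,
  \<open>\<omega> \<and> \<omega> \<and> \<theta>\<close> is a 5-form pulled back from a 4-manifold,
  and the mixed terms agree by \<open>d\<omega> = \<omega> \<and> \<theta>\<close>.\<close>

lemma lee_OM:
  assumes z: "z \<in> U"
  shows "(\<lambda>vs. 2 * (OM pc z \<^bold>\<and> local_d (OM pc) z) vs) = lift lee pc z \<^bold>\<and> OM pc z \<^bold>\<and> OM pc z"
proof -
  let ?\<theta> = "lift lee pc z" and ?o = "lift om pc z" and ?\<gamma> = "\<lambda>vs. local_d (om c) (fst z) (map fst vs)"
  have x: "fst z \<in> chart_range c" using z by auto
  note k = om_kform[OF c x] lee_kform[OF c x] gamma_kform[OF c x]
  have kl: "kform 2 ?o" by (rule lift_kform) (rule k)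
  note dl = kform_degree_form[OF lee_lift_kform[OF z]] kform_degree_form[OF kl]
  have lr: "lee_relation n (om c (fst z)) (local_d (om c) (fst z)) (lee c (fst z))" by (rule lee_rel[OF c x])
  show ?thesis
  proof (cases "n = 2")
    case False
    then have n3: "n = 3" using n_cases by simp
    have "2 * (om c (fst z) \<^bold>\<and> local_d (om c) (fst z)) vs = (om c (fst z) \<^bold>\<and> om c (fst z) \<^bold>\<and> lee c (fst z)) vs" for vs
      using lr n3 unfolding lee_relation_def by (auto dest: fun_cong)
    from this[of "map fst vs" for vs] have "2 * (?o \<^bold>\<and> ?\<gamma>) vs = (?o \<^bold>\<and> ?o \<^bold>\<and> ?\<theta>) vs" for vs
      by (simp add: lift_prod_chart wedge_map)
    then have "(\<lambda>vs. 2 * (?o \<^bold>\<and> ?\<gamma>) vs) = ?o \<^bold>\<and> ?o \<^bold>\<and> ?\<theta>" by (rule ext)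
    also have "\<dots> = ?\<theta> \<^bold>\<and> ?o \<^bold>\<and> ?o"
      unfolding wedge_commute_even[OF dl(2,1)] by (rule wedge_left_commute[OF wedge_commute_even[OF dl(2,1)]])
    finally show ?thesis unfolding d_OM[OF z] unfolding OM_PSP_PSM(2)[OF False] .
  next
    case True
    let ?d = "covector (dt 2) \<^bold>\<and> covector (dt 3)"
    have dd: "degree_form 2 ?d" using degree_form_wedge[OF degree_form_covector degree_form_covector, of "dt 2" "dt 3"] by (simp add: numeral_2_eq_2)
    have sq: "covector l \<^bold>\<and> covector l = (\<lambda>_. 0)" for l :: "'e \<times> (real ^ 'k) \<Rightarrow> real"
      using wedge_commute[OF degree_form_covector[of l] degree_form_covector[of l]] by (simp add: fun_eq_iff)
    have d2: "?d \<^bold>\<and> ?d = (\<lambda>_. 0)"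
    proof -
      have "covector (dt 3) \<^bold>\<and> covector (dt 2) = (\<lambda>vs. - (covector (dt 2) \<^bold>\<and> covector (dt 3)) vs)"
        using wedge_commute[OF degree_form_covector[of "dt 3"] degree_form_covector[of "dt 2"]] by (simp add: fun_eq_iff)
      note swap = this
      have "?d \<^bold>\<and> ?d = covector (dt 2) \<^bold>\<and> ((covector (dt 3) \<^bold>\<and> covector (dt 2)) \<^bold>\<and> covector (dt 3))"
        by (simp only: wedge_assoc)
      also have "\<dots> = (\<lambda>vs. - (((covector (dt 2) \<^bold>\<and> covector (dt 2)) \<^bold>\<and> covector (dt 3)) \<^bold>\<and> covector (dt 3)) vs)"
        unfolding swap by (simp only: wedge_linear[THEN ext] wedge_assoc)
      finally show ?thesis unfolding sq by (simp add: wedge_linear[THEN ext])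
    qed
    obtain f and b :: "nat \<Rightarrow> 'e" where F: "dual_frame (2 * n) f b" using frame_top(1)[OF c x] by blast
    have "kform 5 (om c (fst z) \<^bold>\<and> om c (fst z) \<^bold>\<and> lee c (fst z))"
      by (rule kform_wedge_eq[OF k(1) kform_wedge[OF k(1,2)]]) simp
    then have "om c (fst z) \<^bold>\<and> om c (fst z) \<^bold>\<and> lee c (fst z) = (\<lambda>_. 0)"
      by (rule kform_above_dim[OF _ F]) (simp add: True)
    from fun_cong[OF this, of "map fst vs" for vs] have "(?o \<^bold>\<and> ?o \<^bold>\<and> ?\<theta>) vs = 0" for vs
      by (simp add: lift_prod_chart wedge_map)
    then have oot: "?o \<^bold>\<and> ?o \<^bold>\<and> ?\<theta> = (\<lambda>_. 0)" by (rule ext)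
    have "local_d (om c) (fst z) = om c (fst z) \<^bold>\<and> lee c (fst z)" using lr True by (simp add: lee_relation_def)
    then have \<gamma>: "?\<gamma> = ?o \<^bold>\<and> ?\<theta>" by (simp add: fun_eq_iff lift_prod_chart wedge_map)
    have c1: "?o \<^bold>\<and> ?\<theta> = ?\<theta> \<^bold>\<and> ?o" by (rule wedge_commute_even[OF dl(2,1)])
    have c2: "?d \<^bold>\<and> ?\<theta> = ?\<theta> \<^bold>\<and> ?d" by (rule wedge_commute_even[OF dd dl(1)])
    have c3: "?d \<^bold>\<and> ?o = ?o \<^bold>\<and> ?d" by (rule wedge_commute_even[OF dd dl(2)])
    have t1: "?\<theta> \<^bold>\<and> ?o \<^bold>\<and> ?o = (\<lambda>_. 0)"
      unfolding wedge_left_commute[OF c1, symmetric] c1[symmetric] by (rule oot)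
    have t2: "?\<theta> \<^bold>\<and> ?o \<^bold>\<and> ?d = ?d \<^bold>\<and> ?\<theta> \<^bold>\<and> ?o" 
      unfolding c3[symmetric] by (rule wedge_left_commute[OF c2, symmetric])
    have t3: "?\<theta> \<^bold>\<and> ?d \<^bold>\<and> ?o = ?d \<^bold>\<and> ?\<theta> \<^bold>\<and> ?o"
      by (rule wedge_left_commute[OF c2, symmetric])
    have OM: "OM pc z = (\<lambda>vs. ?d vs + ?o vs)" unfolding OM_PSP_PSM(1)[OF True] ..
    have "2 * (OM pc z \<^bold>\<and> local_d (OM pc) z) vs = (?\<theta> \<^bold>\<and> OM pc z \<^bold>\<and> OM pc z) vs" for vs
      unfolding d_OM[OF z] \<gamma> OM using fun_cong[OF oot, of vs]
      by (simp only: wedge_linear[THEN ext] wedge_linear c1 d2 t1 t2 t3) simp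
    then show ?thesis by blast
  qed
qed

lemma frame_exists:
  assumes z: "z \<in> U"
  shows "\<exists>e b. dual_frame 7 e b \<and> dt 1 = e 1 \<and> OM pc z = model_omega e \<and>
      PSP pc z = model_psip e \<and> PSM pc z = model_psim e \<and> (\<forall>ws. local_d (OM pc) z (b 1 # ws) = 0) \<and> lift lee pc z [b 1] = 0 \<and>
      linear (LL c z) \<and> LL c z (b 1) = 0 \<and> LL c z (b 2) = b 3 \<and> LL c z (b 3) = - b 2 \<and> LL c z (b 4) = b 5 \<and> LL c z (b 5) = - b 4 \<and>
      LL c z (b 6) = b 7 \<and> LL c z (b 7) = - b 6"
proof -
  have x: "fst z \<in> chart_range c" using z by auto
  let ?J = "J c (fst z)"
  have JJ: "linear ?J" "\<And>v. ?J (?J v) = - v" using hermitian[OF c x] by (auto simp: hermitian_pair_def)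
  have J0: "?J 0 = 0" by (rule linear_0[OF JJ(1)])
  have linL: "linear (LL c z)"
    by (rule linearI) (simp_all add: LL_def linear_add[OF JJ(1)] linear_cmul[OF JJ(1)] linear_add[OF linear_dt]
       linear_cmul[OF linear_dt] algebra_simps)
  \<comment> \<open>The vector \<open>(0, s)\<close> is tangent to the Euclidean factor, and
    pulled-back forms vanish on it.\<close>
  have g0: "local_d (OM pc) z ((0, s) # ws) = 0" for s ws
    using linear_0[OF multi_linear[of "local_d (om c) (fst z)" "[]" "map fst ws"]] gamma_kform[OF c x]
    by (simp add: d_OM[OF z] kform_iff)
  have l0: "lift lee pc z [(0, s)] = 0" for s
    using linear_0[OF linear_one_form[OF lee_kform[OF c x]]] by (simp add: lift_prod_chart)
  show ?thesis
  proof (cases "n = 2")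
    case False
    then have n3: "n = 3" using n_cases by simp
    from frame3[OF n3 c x] obtain f b where F: "dual_frame 6 f b" and J: "?J (b 1) = b 2" "?J (b 3) = b 4" "?J (b 5) = b 6"
      and o: "om c (fst z) = omega6 f" "psp c (fst z) = psip6 f" "psm c (fst z) = psim6 f" by blast
    have J': "?J (b 2) = - b 1" "?J (b 4) = - b 3" "?J (b 6) = - b 5" using JJ(2) J by metis+
    \<comment> \<open>Index 1 is the Euclidean direction, so the six indices of the base frame are
      shifted by one.\<close>
    define e where "e i = (if i = 1 then dt 1 else (\<lambda>v. f (i - 1) (fst v)))" for i :: nat
    define b' where "b' i = (if i = 1 then (0, axis (\<kappa> 1) (1::real)) else (b (i - 1), 0))" for i :: nat
    have lf: "linear (f i)" if "i \<in> {1..6}" for i using F that by (simp add: dual_frame_def)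
    have fb: "f i (b j) = (if i = j then 1 else 0)" if "i \<in> {1..6}" "j \<in> {1..6}" for i j using F that by (simp add: dual_frame_def)
    have "dual_frame 7 e b'"
      unfolding dual_frame_def
    proof (intro conjI ballI)
      show "DIM('e \<times> (real ^ 'k)) = 7" by (rule dim_prod)
      fix i :: nat assume i: "i \<in> {1..7}"
      show "linear (e i)"
      proof (cases "i \<le> 1")
        case True then show ?thesis using linear_dt i by (simp add: e_def)
      next
        case False
        then have "i - 1 \<in> {1..6}" using i by auto
        from linear_compose[OF linear_fst lf[OF this]] show ?thesis using False by (simp add: e_def o_def)
      qed
      fix j :: nat assume j: "j \<in> {1..7}"
      show "e i (b' j) = (if i = j then 1 else 0)"
      proof -
        have f0: "f (i - 1) 0 = 0" if "i \<in> {2..7}" for i using that by (intro linear_0 lf) auto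
        have f1: "f (i - 1) (b (j - 1)) = (if i = j then 1 else 0)" if "i \<in> {2..7}" "j \<in> {2..7}" for i j
        proof -
          have "i - 1 \<in> {1..6}" "j - 1 \<in> {1..6}" "i - 1 = j - 1 \<longleftrightarrow> i = j" using that by auto
          then show ?thesis using fb by simp
        qed
        have "i = 1 \<or> i \<in> {2..7}" "j = 1 \<or> j \<in> {2..7}" using i j by auto
        then show ?thesis using f0[of i] f1[of i j] dt_simps(1)[of 1] dt_simps(2)[of 1 1] n3
          by (elim disjE) (simp_all add: e_def b'_def)
      qed
    qed
    moreover have "dt 1 = e 1" by (simp add: e_def)
    moreover have "OM pc z = model_omega e" "PSP pc z = model_psip e" "PSM pc z = model_psim e"
    proof -
      note w2 = ewedge_fst[of e f "[_, _]" "[_, _]"] and w3 = ewedge_fst[of e f "[_, _, _]" "[_, _, _]"]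
      show "OM pc z = model_omega e"
        using w2[of 2 3 1 2] w2[of 4 5 3 4] w2[of 6 7 5 6]
        unfolding OM_PSP_PSM(2)[OF False] by (simp add: lift_prod_chart o omega6_def model_omega_def e_def)
      show "PSP pc z = model_psip e"
        using w3[of 2 4 6 1 3 5] w3[of 2 5 7 1 4 6] w3[of 3 4 7 2 3 6] w3[of 3 5 6 2 4 5]
        unfolding OM_PSP_PSM(4)[OF False] by (simp add: lift_prod_chart o psip6_def model_psip_def e_def)
      show "PSM pc z = model_psim e"
        using w3[of 2 4 7 1 3 6] w3[of 2 5 6 1 4 5] w3[of 3 4 6 2 3 5] w3[of 3 5 7 2 4 6]
        unfolding OM_PSP_PSM(6)[OF False] by (simp add: lift_prod_chart o psim6_def model_psim_def e_def)
    qed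
    moreover have "LL c z (b' 1) = 0" "LL c z (b' 2) = b' 3" "LL c z (b' 3) = - b' 2" "LL c z (b' 4) = b' 5"
      "LL c z (b' 5) = - b' 4" "LL c z (b' 6) = b' 7" "LL c z (b' 7) = - b' 6"
      by (simp_all add: LL_simps(2)[OF False] b'_def J[unfolded One_nat_def] J'[unfolded One_nat_def] J0 zero_prod_def)
    moreover have "\<forall>ws. local_d (OM pc) z (b' 1 # ws) = 0" "lift lee pc z [b' 1] = 0" by (simp_all add: b'_def g0 l0)
    ultimately show ?thesis using linL by (intro exI[of _ e] exI[of _ b']) blast
  next
    case True
    from frame2[OF True c x] obtain f b where F: "dual_frame 4 f b" and J: "?J (b 1) = b 2" "?J (b 3) = b 4"
      and o: "om c (fst z) = omega4 f" "psp c (fst z) = psip4 f" "psm c (fst z) = psim4 f" by blast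
    have J': "?J (b 2) = - b 1" "?J (b 4) = - b 3" using JJ(2) J by metis+
    \<comment> \<open>Indices 1 to 3 are Euclidean, so the base frame is shifted by three, and the
      pair (2, 3) is the added complex line.\<close>
    define e where "e i = (if i \<le> 3 then dt i else (\<lambda>v. f (i - 3) (fst v)))" for i :: nat
    define b' where "b' i = (if i \<le> 3 then (0, axis (\<kappa> i) (1::real)) else (b (i - 3), 0))" for i :: nat
    have lf: "linear (f i)" if "i \<in> {1..4}" for i using F that by (simp add: dual_frame_def)
    have fb: "f i (b j) = (if i = j then 1 else 0)" if "i \<in> {1..4}" "j \<in> {1..4}" for i j using F that by (simp add: dual_frame_def)
    have dt: "dt i (v, axis (\<kappa> j) 1) = (if i = j then 1 else 0)" if "i \<in> {1..3}" "j \<in> {1..3}" for i j v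
      using dt_simps(2)[of i j v] that True by simp
    have "dual_frame 7 e b'"
      unfolding dual_frame_def
    proof (intro conjI ballI)
      show "DIM('e \<times> (real ^ 'k)) = 7" by (rule dim_prod)
      fix i :: nat assume i: "i \<in> {1..7}"
      show "linear (e i)"
      proof (cases "i \<le> 3")
        case True then show ?thesis using linear_dt i by (simp add: e_def)
      next
        case False
        then have "i - 3 \<in> {1..4}" using i by auto
        from linear_compose[OF linear_fst lf[OF this]] show ?thesis using False by (simp add: e_def o_def)
      qed
      fix j :: nat assume j: "j \<in> {1..7}"
      show "e i (b' j) = (if i = j then 1 else 0)"
      proof -
        have f0: "f (i - 3) 0 = 0" if "i \<in> {4..7}" for i using that by (intro linear_0 lf) auto
        have f1: "f (i - 3) (b (j - 3)) = (if i = j then 1 else 0)" if "i \<in> {4..7}" "j \<in> {4..7}" for i j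
        proof -
          have "i - 3 \<in> {1..4}" "j - 3 \<in> {1..4}" "i - 3 = j - 3 \<longleftrightarrow> i = j" using that by auto
          then show ?thesis using fb by simp
        qed
        have "i \<in> {1..3} \<or> i \<in> {4..7}" "j \<in> {1..3} \<or> j \<in> {4..7}" using i j by auto
        then show ?thesis using f0[of i] f1[of i j] dt_simps(1)[of i] dt[of i j]
          by (elim disjE) (simp_all add: e_def b'_def)
      qed
    qed
    moreover have "dt 1 = e 1" by (simp add: e_def)
    moreover have "OM pc z = model_omega e" "PSP pc z = model_psip e" "PSM pc z = model_psim e"
    proof -
      note w2 = ewedge_fst[of e f "[_, _]" "[_, _]"]
      have ee: "e 2 = dt 2" "e 3 = dt 3" by (simp_all add: e_def)
      have ww: "ewedge e [4, 5] = (\<lambda>vs. ewedge f [1, 2] (map fst vs))" "ewedge e [6, 7] = (\<lambda>vs. ewedge f [3, 4] (map fst vs))"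
        "ewedge e [4, 6] = (\<lambda>vs. ewedge f [1, 3] (map fst vs))" "ewedge e [5, 7] = (\<lambda>vs. ewedge f [2, 4] (map fst vs))"
        "ewedge e [4, 7] = (\<lambda>vs. ewedge f [1, 4] (map fst vs))" "ewedge e [5, 6] = (\<lambda>vs. ewedge f [2, 3] (map fst vs))"
        by (rule ewedge_fst; simp add: e_def)+
      have one: "ewedge e [2, 3] = covector (dt 2) \<^bold>\<and> covector (dt 3)"
        "\<And>is. ewedge e (2 # is) = covector (dt 2) \<^bold>\<and> ewedge e is" "\<And>is. ewedge e (3 # is) = covector (dt 3) \<^bold>\<and> ewedge e is"
        by (simp_all add: ewedge_Cons ewedge_Nil wedge_one_right ee)
      show "OM pc z = model_omega e"
        unfolding OM_PSP_PSM(1)[OF True] by (rule ext) (simp add: lift_prod_chart o omega4_def model_omega_def one(1) ww)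
      show "PSP pc z = model_psip e"
        unfolding OM_PSP_PSM(3)[OF True] by (rule ext) (simp add: lift_prod_chart o psip4_def psim4_def model_psip_def one(2,3) ww wedge_linear)
      show "PSM pc z = model_psim e"
        unfolding OM_PSP_PSM(5)[OF True] by (rule ext) (simp add: lift_prod_chart o psip4_def psim4_def model_psim_def one(2,3) ww wedge_linear)
    qed
    moreover have "LL c z (b' 1) = 0" "LL c z (b' 2) = b' 3" "LL c z (b' 3) = - b' 2" "LL c z (b' 4) = b' 5"
      "LL c z (b' 5) = - b' 4" "LL c z (b' 6) = b' 7" "LL c z (b' 7) = - b' 6"
      by (simp_all add: LL_simps(1)[OF True] b'_def J[unfolded One_nat_def] J'[unfolded One_nat_def] J0 zero_prod_def dt dt_simps(1))
    moreover have "\<forall>ws. local_d (OM pc) z (b' 1 # ws) = 0" "lift lee pc z [b' 1] = 0" by (simp_all add: b'_def g0 l0)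
    ultimately show ?thesis using linL by (intro exI[of _ e] exI[of _ b']) blast
  qed
qed

lemma g2_chart: "g2_chart U (dt 1) (OM pc) (PSP pc) (PSM pc) (lift lee pc) (LL c)"
proof unfold_locales
  show "open U" by (rule open_U)
  fix z assume z: "z \<in> U"
  show "\<exists>e b. dual_frame 7 e b \<and> dt 1 = e 1 \<and> OM pc z = model_omega e \<and>
      PSP pc z = model_psip e \<and> PSM pc z = model_psim e \<and> (\<forall>ws. local_d (OM pc) z (b 1 # ws) = 0) \<and> lift lee pc z [b 1] = 0 \<and>
      linear (LL c z) \<and> LL c z (b 1) = 0 \<and> LL c z (b 2) = b 3 \<and> LL c z (b 3) = - b 2 \<and> LL c z (b 4) = b 5 \<and> LL c z (b 5) = - b 4 \<and>
      LL c z (b 6) = b 7 \<and> LL c z (b 7) = - b 6"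
    by (rule frame_exists[OF z])
  show "coeffs_diff (OM pc) z" "coeffs_diff (PSP pc) z" "coeffs_diff (PSM pc) z"
    by (rule coeffs_smooth_diff[OF smooth_all(1) z] coeffs_smooth_diff[OF smooth_all(2) z] coeffs_smooth_diff[OF smooth_all(3) z])+
  show "kform 1 (lift lee pc z)" by (rule lee_lift_kform[OF z])
  show "local_d (PSP pc) z = lift lee pc z \<^bold>\<and> PSP pc z" "local_d (PSM pc) z = lift lee pc z \<^bold>\<and> PSM pc z"
    by (rule d_PS[OF z])+
  show "(\<lambda>vs. 2 * (OM pc z \<^bold>\<and> local_d (OM pc) z) vs) = lift lee pc z \<^bold>\<and> OM pc z \<^bold>\<and> OM pc z"
    by (rule lee_OM[OF z])
qed

end

end

section \<open>Chart transitions on the product\<close>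

context su_product
begin

context
  fixes c c' q and t :: "real ^ 'k"
  assumes cc: "c \<in> A" "c' \<in> A" and q: "q \<in> fst c" "q \<in> fst c'"
begin

abbreviation "tr \<equiv> frechet_derivative (coord_rep c c' id) (at (snd c q))"

lemma prod_inv:
  assumes "r \<in> fst c"
  shows "inv_into (fst (prod_chart c)) (snd (prod_chart c)) (snd c r, s) = (r, s :: real ^ 'k)"
proof (rule inv_into_f_eq)
  show "inj_on (snd (prod_chart c)) (fst (prod_chart c :: ('a \<times> (real ^ 'k), 'e \<times> (real ^ 'k)) chart))"
    using chart_inj[OF cc] by (auto simp: prod_chart_def inj_on_def)
qed (use assms in \<open>auto simp: prod_chart_def\<close>)

lemma prod_overlap: "open (snd c ` (fst c \<inter> fst c') \<times> (UNIV :: (real ^ 'k) set))"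
  "(snd c q, t :: real ^ 'k) \<in> snd c ` (fst c \<inter> fst c') \<times> UNIV"
  using overlap_open[OF cc] q by (auto intro: open_Times)

lemma tr_derivative: "(coord_rep c c' id has_derivative tr) (at (snd c q))"
  by (rule F_derivative[OF cc]) (use q in blast)

lemma tr_derivative_fst:
  "((\<lambda>z. coord_rep c c' id (fst z)) has_derivative (\<lambda>h. tr (fst h))) (at (snd c q, t :: real ^ 'k))"
  using has_derivative_compose[OF has_derivative_fst[OF has_derivative_ident], of "coord_rep c c' id" tr "(snd c q, t)" UNIV]
    tr_derivative by simp

text \<open>Product charts change by the base transition times the identity, so the derivative is
  block diagonal.\<close>

lemma prod_transition:
  "frechet_derivative (coord_rep (prod_chart c) (prod_chart c') id) (at (snd c q, t :: real ^ 'k)) = map_prod tr id"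
proof -
  have "((\<lambda>z. (coord_rep c c' id (fst z), snd z)) has_derivative (\<lambda>h. (tr (fst h), snd h))) (at (snd c q, t))"
    by (intro has_derivative_Pair tr_derivative_fst has_derivative_snd has_derivative_ident)
  then have "(coord_rep (prod_chart c) (prod_chart c') id has_derivative (\<lambda>h. (tr (fst h), snd h))) (at (snd c q, t))"
  proof (rule has_derivative_transform_within_open[OF _ prod_overlap])
    fix z :: "'e \<times> (real ^ 'k)" assume "z \<in> snd c ` (fst c \<inter> fst c') \<times> UNIV"
    then obtain r s where r: "r \<in> fst c" "z = (snd c r, s)" by auto
    show "(coord_rep c c' id (fst z), snd z) = coord_rep (prod_chart c) (prod_chart c') id z"
      using prod_inv[OF r(1), of s] F_eq[OF cc r(1)] by (simp add: r(2) coord_rep_def) (simp add: prod_chart_def)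
  qed
  from frechet_derivative_at[OF this] show ?thesis by (simp add: map_prod_def case_prod_beta')
qed

lemma fst_transition:
  "frechet_derivative (coord_rep (prod_chart c) c' fst) (at (snd c q, t :: real ^ 'k)) = (\<lambda>h. tr (fst h))"
proof -
  have "(coord_rep (prod_chart c) c' fst has_derivative (\<lambda>h. tr (fst h))) (at (snd c q, t))"
  proof (rule has_derivative_transform_within_open[OF tr_derivative_fst prod_overlap])
    fix z :: "'e \<times> (real ^ 'k)" assume "z \<in> snd c ` (fst c \<inter> fst c') \<times> UNIV"
    then obtain r s where r: "r \<in> fst c" "z = (snd c r, s)" by auto
    show "coord_rep c c' id (fst z) = coord_rep (prod_chart c) c' fst z"
      using prod_inv[OF r(1), of s] F_eq[OF cc r(1)] by (simp add: r(2) coord_rep_def)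
  qed
  from frechet_derivative_at[OF this] show ?thesis by simp
qed

abbreviation "ptr \<equiv> map_prod tr id :: 'e \<times> (real ^ 'k) \<Rightarrow> 'e \<times> (real ^ 'k)"

lemma lift_natural:
  assumes "\<And>vs. \<alpha> c (snd c q) vs = \<alpha> c' (snd c' q) (map tr vs)"
  shows "lift \<alpha> (prod_chart c) (snd c q, t :: real ^ 'k) vs = lift \<alpha> (prod_chart c') (snd c' q, t) (map ptr vs)"
  by (simp add: lift_prod_chart assms o_def)

lemma covector_natural: "covector (dt j) (map ptr vs) = covector (dt j) vs"
  by (auto simp: covector_def dt_def split: list.splits)

lemma PHI_natural: "PHI (prod_chart c) (snd c q, t) vs = PHI (prod_chart c') (snd c' q, t) (map ptr vs)"
proof -
  note l = lift_natural[where \<alpha> = om, OF om_natural[OF cc q]] lift_natural[where \<alpha> = psp, OF ps_natural(1)[OF cc q]]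
    lift_natural[where \<alpha> = psm, OF ps_natural(2)[OF cc q]]
  have o: "OM (prod_chart c) (snd c q, t) vs = OM (prod_chart c') (snd c' q, t) (map ptr vs)" for vs
    by (cases "n = 2"; unfold OM_PSP_PSM; simp add: wedge_map covector_natural l)
  have p: "PSP (prod_chart c) (snd c q, t) vs = PSP (prod_chart c') (snd c' q, t) (map ptr vs)" for vs
    by (cases "n = 2"; unfold OM_PSP_PSM; simp add: wedge_map covector_natural flip: l)
  show ?thesis
    by (simp add: PHI_def wedge_map covector_natural flip: o p)
qed

end

text \<open>The field \<beta> is compared with the lift on the chart ranges alone, since this is
  where the torsion form is known.\<close>

lemma pullback_fst:
  assumes "\<And>c c' q vs. c \<in> A \<Longrightarrow> c' \<in> A \<Longrightarrow> q \<in> fst c \<Longrightarrow> q \<in> fst c' \<Longrightarrow>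
    \<alpha> c (snd c q) vs = \<alpha> c' (snd c' q) (map (frechet_derivative (coord_rep c c' id) (at (snd c q))) vs)"
    and eq: "\<And>c z. c \<in> A \<Longrightarrow> z \<in> chart_range c \<times> UNIV \<Longrightarrow> \<beta> (prod_chart c) z = lift \<alpha> (prod_chart c) z"
  shows "is_pullback M A fst \<alpha> \<beta>"
  unfolding is_pullback_def
proof (intro ballI impI allI)
  fix d c' p vs assume "d \<in> M" "c' \<in> A" "p \<in> fst d" "fst p \<in> fst c'"
  then obtain c q t where c: "c \<in> A" "c' \<in> A" "q \<in> fst c" "q \<in> fst c'" "p = (q, t)" "d = prod_chart c"
    by (cases p) (auto simp: prod_chart_def)
  have "snd d p = (snd c q, t)" by (simp add: c prod_chart_def)
  then have z: "(snd c q, t) \<in> chart_range c \<times> UNIV" and sd: "snd (prod_chart c) (q, t) = (snd c q, t)"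
    using c by (auto simp: prod_chart_def)
  show "\<beta> d (snd d p) vs = \<alpha> c' (snd c' (fst p)) (map (frechet_derivative (coord_rep d c' fst) (at (snd d p))) vs)"
    unfolding c(5,6) sd fst_transition[OF c(1-4)] eq[OF c(1) z]
    using assms(1)[OF c(1-4), of "map fst vs"] by (simp add: lift_prod_chart o_def)
qed

lemma pullback_id:
  assumes "\<And>c c' q t vs. c \<in> A \<Longrightarrow> c' \<in> A \<Longrightarrow> q \<in> fst c \<Longrightarrow> q \<in> fst c' \<Longrightarrow> \<alpha> (prod_chart c) (snd c q, t) vs =
    \<alpha> (prod_chart c') (snd c' q, t) (map (map_prod (frechet_derivative (coord_rep c c' id) (at (snd c q))) id) vs)"
  shows "is_pullback M M id \<alpha> \<alpha>"
  unfolding is_pullback_def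
proof (intro ballI impI allI)
  fix d d' p vs assume a: "d \<in> M" "d' \<in> M" "p \<in> fst d" "id p \<in> fst d'"
  then obtain c c' where c: "c \<in> A" "c' \<in> A" "d = prod_chart c" "d' = prod_chart c'" by auto
  obtain q t where p: "p = (q, t)" by (cases p)
  have q: "q \<in> fst c" "q \<in> fst c'" using a by (auto simp: c p prod_chart_def)
  have sd: "snd (prod_chart c) (q, t) = (snd c q, t)" "snd (prod_chart c') (id (q, t)) = (snd c' q, t)"
    by (auto simp: prod_chart_def)
  show "\<alpha> d (snd d p) vs = \<alpha> d' (snd d' (id p)) (map (frechet_derivative (coord_rep d d' id) (at (snd d p))) vs)"
    unfolding c(3,4) p sd prod_transition[OF c(1,2) q] by (rule assms[OF c(1,2) q])
qed

lemma strong_g2T_product: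
  "strong_g2T_structure M PHI (lift lee) \<and>
   field_eq M (ext_d PHI \<and>\<^sub>M PHI) zero_field \<and>
   field_eq M (ext_d (g2_star PHI PHI)) (lift lee \<and>\<^sub>M g2_star PHI PHI) \<and>
   field_eq M (ext_d (g2_torsion PHI (lift lee))) zero_field \<and>
   field_eq M (ext_d (lift lee)) zero_field \<and>
   is_pullback M A fst lee (lift lee) \<and>
   is_pullback M A fst (d_c_omega g J) (g2_torsion PHI (lift lee))"
proof -
  have phi: "PHI (prod_chart c) = g2_chart.phi (dt 1) (OM (prod_chart c)) (PSP (prod_chart c))" if "c \<in> A" for c
    using g2_chart.phi_def[OF g2_chart[OF that]] by (simp add: fun_eq_iff PHI_def)
  have fe: "field_eq M \<alpha> \<beta>" if "\<And>c z. c \<in> A \<Longrightarrow> z \<in> chart_range c \<times> UNIV \<Longrightarrow> \<alpha> (prod_chart c) z = \<beta> (prod_chart c) z"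
    for \<alpha> \<beta> :: "('a \<times> (real ^ 'k), 'e \<times> (real ^ 'k), real) form_field"
    unfolding field_eq_def
  proof (intro ballI)
    fix d z assume "d \<in> M" and z: "z \<in> chart_range d"
    then obtain c where c: "c \<in> A" "d = prod_chart c" by blast
    then show "\<alpha> d z = \<beta> d z" using that[OF c(1)] z unfolding c(2) chart_range_prod by blast
  qed
  have df: "differential_form M k \<alpha>"
    if "\<And>c z. c \<in> A \<Longrightarrow> z \<in> chart_range c \<times> UNIV \<Longrightarrow> kform k (\<alpha> (prod_chart c) z)"
      "\<And>c. c \<in> A \<Longrightarrow> coeffs_smooth (chart_range c \<times> UNIV) (\<alpha> (prod_chart c))" "is_pullback M M id \<alpha> \<alpha>"
    for k and \<alpha> :: "('a \<times> (real ^ 'k), 'e \<times> (real ^ 'k), real) form_field"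
    unfolding differential_form_def
  proof (intro conjI ballI allI)
    fix d assume "d \<in> M"
    then obtain c where c: "c \<in> A" "d = prod_chart c" by blast
    show "kform k (\<alpha> d z)" if "z \<in> chart_range d" for z
      using that(1) \<open>\<And>c z. c \<in> A \<Longrightarrow> z \<in> chart_range c \<times> UNIV \<Longrightarrow> kform k (\<alpha> (prod_chart c) z)\<close>[OF c(1)]
      unfolding c(2) chart_range_prod by blast
    show "smooth_on (chart_range d) (\<lambda>z. \<alpha> d z vs)" for vs
      using that(2)[OF c(1)] unfolding c(2) chart_range_prod coeffs_smooth_def by blast
  qed (rule that(3))
  have torsion: "g2_torsion PHI (lift lee) (prod_chart c) z = lift (d_c_omega g J) (prod_chart c) z"
    if c: "c \<in> A" and z: "z \<in> chart_range c \<times> UNIV" for c z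
  proof -
    have "g2_torsion PHI (lift lee) (prod_chart c) z = (\<lambda>vs. local_d (OM (prod_chart c)) z (map (LL c z) vs))"
      by (rule g2_chart.torsion[OF g2_chart[OF c] z]) (simp_all add: phi[OF c])
    \<comment> \<open>The derivative of \<open>OM\<close> sees only the base components of its
      arguments, and on these \<open>LL\<close> acts as J.\<close>
    also have "\<dots> = lift (d_c_omega g J) (prod_chart c) z"
      by (simp add: fun_eq_iff d_OM[OF c z] lift_prod_chart dc_eq LL_def o_def)
    finally show ?thesis .
  qed
  have e1: "field_eq M (ext_d PHI \<and>\<^sub>M PHI) zero_field"
    by (rule fe) (use g2_chart.d_phi_wedge_phi[OF g2_chart] in \<open>simp add: fwedge_def ext_d_eq phi zero_field_def fun_eq_iff\<close>)
  have e2: "field_eq M (ext_d (g2_star PHI PHI)) (lift lee \<and>\<^sub>M g2_star PHI PHI)"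
    by (rule fe) (use g2_chart.d_star_phi[OF g2_chart, where \<phi> = PHI] in \<open>simp add: fwedge_def ext_d_eq phi\<close>)
  have ld: "ext_d (lift \<alpha>) (prod_chart c) z = zero_field (prod_chart c) z"
    if "field_eq A (ext_d \<alpha>) zero_field" "coeffs_smooth (chart_range c) (\<alpha> c)" "c \<in> A" "z \<in> chart_range c \<times> UNIV"
    for c and z :: "'e \<times> (real ^ 'k)" and \<alpha> :: "('a, 'e, real) form_field"
  proof -
    have "local_d (\<alpha> c) (fst z) = (\<lambda>_. 0)"
      using field_eqD[OF that(1,3), of "fst z"] that(4) by (auto simp: ext_d_eq zero_field_def fun_eq_iff)
    then show ?thesis
      by (simp add: ext_d_eq lift_d[where \<alpha> = \<alpha>, OF that(3,2,4)] zero_field_def fun_eq_iff)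
  qed
  have e3: "field_eq M (ext_d (g2_torsion PHI (lift lee))) zero_field"
  proof (rule fe)
    fix c and z :: "'e \<times> (real ^ 'k)" assume c: "c \<in> A" and z: "z \<in> chart_range c \<times> UNIV"
    \<comment> \<open>The torsion equals the pullback of \<open>d\<^sup>c\<omega>\<close> on the
      whole open chart range, so both have the same derivative.\<close>
    have "ext_d (g2_torsion PHI (lift lee)) (prod_chart c) z = ext_d (lift (d_c_omega g J)) (prod_chart c) z"
      unfolding ext_d_eq by (rule local_d_cong[OF open_U[OF c] z torsion[OF c]])
    then show "ext_d (g2_torsion PHI (lift lee)) (prod_chart c) z = zero_field (prod_chart c) z"
      using ld[OF ddc dc_smooth[OF c] c z] by simp
  qed
  have e4: "field_eq M (ext_d (lift lee)) zero_field"
    by (rule fe) (rule ld[OF dlee lee_smooth])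
  have p1: "is_pullback M A fst lee (lift lee)"
    by (rule pullback_fst) (auto intro: lee_natural)
  have p2: "is_pullback M A fst (d_c_omega g J) (g2_torsion PHI (lift lee))"
    by (rule pullback_fst[OF dc_natural torsion])
  have d3: "differential_form M 3 PHI"
  proof (rule df)
    show "is_pullback M M id PHI PHI" by (rule pullback_id[OF PHI_natural])
    show "kform 3 (PHI (prod_chart c) z)" if c: "c \<in> A" and z: "z \<in> chart_range c \<times> UNIV" for c z
      using kform_wedge_eq[OF kform_covector[OF linear_dt] g2_chart.kforms(1)[OF g2_chart[OF c] z], of 3 1]
        g2_chart.kforms(2)[OF g2_chart[OF c] z] unfolding PHI_def by (intro kform_add) simp_all
  qed (rule smooth_all(5))
  have d1: "differential_form M 1 (lift lee)"
    by (rule df[OF lee_lift_kform smooth_all(4) pullback_id[OF lift_natural[where \<alpha> = lee, OF _ _ _ _ lee_natural]]])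
  have "g2_structure M PHI"
    unfolding g2_structure_def
  proof (intro conjI ballI d3)
    fix d z assume "d \<in> M" and z: "z \<in> chart_range d"
    then obtain c where c: "c \<in> A" "d = prod_chart c" by blast
    show "\<exists>e. g2_adapted (PHI d z) e"
      using g2_chart.adapted[OF g2_chart[OF c(1)]] z unfolding c(2) chart_range_prod phi[OF c(1)] by blast
  qed
  then show ?thesis
    using e1 e2 e3 e4 p1 p2 d1 by (simp add: strong_g2T_structure_def g2T_structure_def)
qed

end

theorem proposition3p5:
  fixes n :: nat
    and X :: "'a topology"
    and A :: "('a, real ^ 'm::finite) chart set"
    and g :: "('a, real ^ 'm) metric_field"
    and J :: "('a, real ^ 'm) endo_field"
    and \<Psi> :: "('a, real ^ 'm, complex) form_field"
    and M :: "('a \<times> (real ^ 'k::finite), (real ^ 'm) \<times> (real ^ 'k)) chart set"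
  assumes "n \<in> {2, 3}"
    and "CARD('m) = 2 * n"
    and "CARD('k) = 7 - 2 * n"
    and "smooth_manifold X A"
    and "SU_structure A n g J \<Psi>"
    and "field_eq A (ext_d \<Psi>) (complexify (lee_form n g J) \<and>\<^sub>M \<Psi>)"
    and "field_eq A (ext_d (d_c_omega g J)) zero_field"
    and "field_eq A (ext_d (lee_form n g J)) zero_field"
    and "M = prod_atlas A standard_atlas"
  shows "\<exists>\<phi> \<theta>. strong_g2T_structure M \<phi> \<theta> \<and>
           field_eq M (ext_d \<phi> \<and>\<^sub>M \<phi>) zero_field \<and>
           field_eq M (ext_d (g2_star \<phi> \<phi>)) (\<theta> \<and>\<^sub>M g2_star \<phi> \<phi>) \<and>
           field_eq M (ext_d (g2_torsion \<phi> \<theta>)) zero_field \<and>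
           field_eq M (ext_d \<theta>) zero_field \<and>
           is_pullback M A fst (lee_form n g J) \<theta> \<and>
           is_pullback M A fst (d_c_omega g J) (g2_torsion \<phi> \<theta>)"
proof -
  \<comment> \<open>The coordinates are numbered from 1 so as to match the indices of the
    coframe.\<close>
  obtain \<kappa> :: "nat \<Rightarrow> 'k" where "bij_betw \<kappa> {1..CARD('k)} UNIV"
    using ex_bij_betw_nat_finite_1[of "UNIV :: 'k set"] by auto
  then interpret su_product n X A g J \<Psi> \<kappa>
    using assms by unfold_locales simp_all
  show ?thesis
    unfolding assms(9) prod_atlas_standard using strong_g2T_product by blast
qed

end
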